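(* Work in ZFC. For any ordinal $\delta$, the following are equivalent: (1) $\mathrm{Val}_{\mathcal{V}}(V_\delta,\mathcal{L}_{\in,V_\delta})=\mathrm{S5}$, i.e. $V_\delta$ satisfies the rank-potentialist maximality principle for assertions in the language of set theory with parameters from $V_\delta$; (2) $\delta$ is $\Sigma_3$-correct, i.e. $V_\delta\prec_{\Sigma_3}V$.
   Context: $\mathcal{V}=\{V_\beta\mid\beta\in\mathrm{Ord}\}$ is rank potentialism: worlds are the rank-initial segments $V_\beta$, $V_\beta$ accesses $V_\gamma$ iff $\beta\le\gamma$; $\Diamond\varphi$ at $V_\beta$ means $\varphi$ holds at some $V_\gamma$ with $\gamma\ge\beta$, $\Box\varphi$ at all such; quantifiers range over the current world. $\mathcal{L}_{\in,V_\delta}$ is the language of set theory with parameters from $V_\delta$. $\mathrm{Val}_{\mathcal{V}}(W,\mathcal{L}')$ is the set of propositional modal formulas all of whose substitution instances by $\mathcal{L}'$-assertions are true at $W$. $V_\delta\prec_{\Sigma_3}V$ means $V_\delta$ and $V$ agree on the truth of $\Sigma_3$ formulas with parameters from $V_\delta$. *)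

theory Defs
  imports Main
begin

section \<open>The language of set theory\<close>

text \<open>Variables are natural numbers; parameters are supplied by the environment.\<close>

datatype fm =
    Mem nat nat
  | Eq nat nat
  | Neg fm
  | Conj fm fm
  | Exists nat fm

abbreviation Forall :: "nat \<Rightarrow> fm \<Rightarrow> fm" where
  "Forall x \<phi> \<equiv> Neg (Exists x (Neg \<phi>))"

primrec fv :: "fm \<Rightarrow> nat set" where
  "fv (Mem x y) = {x, y}"
| "fv (Eq x y) = {x, y}"
| "fv (Neg \<phi>) = fv \<phi>"
| "fv (Conj \<phi> \<psi>) = fv \<phi> \<union> fv \<psi>"
| "fv (Exists x \<phi>) = fv \<phi> - {x}"

text \<open>
  Satisfaction in the structure with domain \<open>D\<close> and membership relation \<open>E\<close>
  (\<open>E x y\<close> reads ``\<open>x\<close> is an element of \<open>y\<close>''). The domain is allowed to be empty.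
\<close>

primrec sat :: "'v set \<Rightarrow> ('v \<Rightarrow> 'v \<Rightarrow> bool) \<Rightarrow> (nat \<Rightarrow> 'v) \<Rightarrow> fm \<Rightarrow> bool" where
  "sat D E e (Mem x y) \<longleftrightarrow> E (e x) (e y)"
| "sat D E e (Eq x y) \<longleftrightarrow> e x = e y"
| "sat D E e (Neg \<phi>) \<longleftrightarrow> \<not> sat D E e \<phi>"
| "sat D E e (Conj \<phi> \<psi>) \<longleftrightarrow> sat D E e \<phi> \<and> sat D E e \<psi>"
| "sat D E e (Exists x \<phi>) \<longleftrightarrow> (\<exists>a\<in>D. sat D E (e(x := a)) \<phi>)"

inductive Delta0 :: "fm \<Rightarrow> bool" where
  "Delta0 (Mem x y)"
| "Delta0 (Eq x y)"
| "Delta0 \<phi> \<Longrightarrow> Delta0 (Neg \<phi>)"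
| "Delta0 \<phi> \<Longrightarrow> Delta0 \<psi> \<Longrightarrow> Delta0 (Conj \<phi> \<psi>)"
| "Delta0 \<phi> \<Longrightarrow> x \<noteq> y \<Longrightarrow> Delta0 (Exists x (Conj (Mem x y) \<phi>))"

inductive Sigma_fm :: "nat \<Rightarrow> fm \<Rightarrow> bool" and Pi_fm :: "nat \<Rightarrow> fm \<Rightarrow> bool" where
  "Delta0 \<phi> \<Longrightarrow> Sigma_fm 0 \<phi>"
| "Delta0 \<phi> \<Longrightarrow> Pi_fm 0 \<phi>"
| "Pi_fm n \<phi> \<Longrightarrow> Sigma_fm (Suc n) \<phi>"
| "Sigma_fm (Suc n) \<phi> \<Longrightarrow> Sigma_fm (Suc n) (Exists x \<phi>)"
| "Sigma_fm n \<phi> \<Longrightarrow> Pi_fm (Suc n) \<phi>"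
| "Pi_fm (Suc n) \<phi> \<Longrightarrow> Pi_fm (Suc n) (Forall x \<phi>)"


section \<open>Models of ZFC\<close>

text \<open>
  The universe \<open>V\<close> is the whole type \<open>'v\<close> with an arbitrary (possibly ill-founded) relation
  \<open>E\<close>. Separation and replacement are the first-order schemes with parameters: variable 0
  (resp. 0 and 1) is the distinguished one, and \<open>e\<close> assigns the parameters to the others.
\<close>

locale zfc_model =
  fixes E :: "'v \<Rightarrow> 'v \<Rightarrow> bool"
  assumes extensionality:
      "(\<forall>z. E z x \<longleftrightarrow> E z y) \<Longrightarrow> x = y"
    and foundation:
      "E z x \<Longrightarrow> \<exists>y. E y x \<and> (\<forall>u. E u x \<longrightarrow> \<not> E u y)"
    and pairing:
      "\<exists>p. \<forall>z. E z p \<longleftrightarrow> z = x \<or> z = y"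
    and union:
      "\<exists>u. \<forall>z. E z u \<longleftrightarrow> (\<exists>y. E y x \<and> E z y)"
    and powerset:
      "\<exists>p. \<forall>z. E z p \<longleftrightarrow> (\<forall>u. E u z \<longrightarrow> E u x)"
    and infinity:
      "\<exists>w. (\<exists>z. E z w \<and> (\<forall>u. \<not> E u z)) \<and>
           (\<forall>x. E x w \<longrightarrow> (\<exists>s. E s w \<and> (\<forall>u. E u s \<longleftrightarrow> E u x \<or> u = x)))"
    and separation:
      "\<exists>b. \<forall>x. E x b \<longleftrightarrow> E x a \<and> sat UNIV E (e(0 := x)) \<phi>"
    and replacement:
      "(\<forall>x. E x a \<longrightarrow> (\<exists>!y. sat UNIV E (e(0 := x, 1 := y)) \<phi>)) \<Longrightarrow>
       \<exists>b. \<forall>y. E y b \<longleftrightarrow> (\<exists>x. E x a \<and> sat UNIV E (e(0 := x, 1 := y)) \<phi>)"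
    and choice:
      "(\<forall>x. E x a \<longrightarrow> (\<exists>y. E y x)) \<Longrightarrow>
       (\<forall>x y z. E x a \<and> E y a \<and> E z x \<and> E z y \<longrightarrow> x = y) \<Longrightarrow>
       \<exists>c. \<forall>x. E x a \<longrightarrow> (\<exists>!y. E y x \<and> E y c)"

definition transitive :: "('v \<Rightarrow> 'v \<Rightarrow> bool) \<Rightarrow> 'v \<Rightarrow> bool" where
  "transitive E x \<longleftrightarrow> (\<forall>y z. E y x \<and> E z y \<longrightarrow> E z x)"

definition Ord :: "('v \<Rightarrow> 'v \<Rightarrow> bool) \<Rightarrow> 'v \<Rightarrow> bool" where
  "Ord E \<beta> \<longleftrightarrow> transitive E \<beta> \<and> (\<forall>y. E y \<beta> \<longrightarrow> transitive E y)"

definition ord_le :: "('v \<Rightarrow> 'v \<Rightarrow> bool) \<Rightarrow> 'v \<Rightarrow> 'v \<Rightarrow> bool" where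
  "ord_le E \<beta> \<gamma> \<longleftrightarrow> E \<beta> \<gamma> \<or> \<beta> = \<gamma>"

text \<open>\<open>p\<close> is the Kuratowski pair of \<open>a\<close> and \<open>b\<close>.\<close>

definition is_pair :: "('v \<Rightarrow> 'v \<Rightarrow> bool) \<Rightarrow> 'v \<Rightarrow> 'v \<Rightarrow> 'v \<Rightarrow> bool" where
  "is_pair E p a b \<longleftrightarrow>
     (\<forall>z. E z p \<longleftrightarrow> (\<forall>u. E u z \<longleftrightarrow> u = a) \<or> (\<forall>u. E u z \<longleftrightarrow> u = a \<or> u = b))"

definition maps_to :: "('v \<Rightarrow> 'v \<Rightarrow> bool) \<Rightarrow> 'v \<Rightarrow> 'v \<Rightarrow> 'v \<Rightarrow> bool" where
  "maps_to E f a b \<longleftrightarrow> (\<exists>p. E p f \<and> is_pair E p a b)"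

text \<open>
  \<open>v\<close> is the value at \<open>\<beta>\<close> of the recursion
  \<open>V\<^sub>\<gamma> = \<Union>\<^bsub>\<xi><\<gamma>\<^esub> Pow (V\<^sub>\<xi>)\<close>. The recursion is carried out inside the model, as witnessed by
  a function \<open>f\<close> of the model on \<open>\<beta> + 1\<close>: \<open>E\<close> may be ill-founded, so that external recursion
  along \<open>E\<close> is not available.
\<close>

definition is_Vset :: "('v \<Rightarrow> 'v \<Rightarrow> bool) \<Rightarrow> 'v \<Rightarrow> 'v \<Rightarrow> bool" where
  "is_Vset E \<beta> v \<longleftrightarrow>
     (\<exists>f. (\<forall>\<gamma>. ord_le E \<gamma> \<beta> \<longrightarrow> (\<exists>!w. maps_to E f \<gamma> w)) \<and>
          (\<forall>\<gamma> w. ord_le E \<gamma> \<beta> \<and> maps_to E f \<gamma> w \<longrightarrow>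
             (\<forall>x. E x w \<longleftrightarrow>
                (\<exists>\<xi> u. E \<xi> \<gamma> \<and> maps_to E f \<xi> u \<and> (\<forall>z. E z x \<longrightarrow> E z u)))) \<and>
          maps_to E f \<beta> v)"

definition Vlevel :: "('v \<Rightarrow> 'v \<Rightarrow> bool) \<Rightarrow> 'v \<Rightarrow> 'v set" where
  "Vlevel E \<beta> = {x. \<exists>v. is_Vset E \<beta> v \<and> E x v}"

definition Sigma_correct :: "nat \<Rightarrow> ('v \<Rightarrow> 'v \<Rightarrow> bool) \<Rightarrow> 'v \<Rightarrow> bool" where
  "Sigma_correct n E \<delta> \<longleftrightarrow>
     (\<forall>\<phi> e. Sigma_fm n \<phi> \<and> (\<forall>i\<in>fv \<phi>. e i \<in> Vlevel E \<delta>) \<longrightarrow>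
        (sat (Vlevel E \<delta>) E e \<phi> \<longleftrightarrow> sat UNIV E e \<phi>))"


section \<open>Propositional modal logic\<close>

datatype 'p mfm =
    Atom 'p
  | Bot
  | Imp "'p mfm" "'p mfm"
  | Box "'p mfm"

abbreviation Dia :: "'p mfm \<Rightarrow> 'p mfm" where
  "Dia \<phi> \<equiv> Imp (Box (Imp \<phi> Bot)) Bot"

text \<open>In \<open>prop_eval\<close>, boxed formulas are treated as further propositional atoms.\<close>

primrec prop_eval :: "('p mfm \<Rightarrow> bool) \<Rightarrow> 'p mfm \<Rightarrow> bool" where
  "prop_eval v (Atom p) \<longleftrightarrow> v (Atom p)"
| "prop_eval v Bot \<longleftrightarrow> False"
| "prop_eval v (Imp \<phi> \<psi>) \<longleftrightarrow> (prop_eval v \<phi> \<longrightarrow> prop_eval v \<psi>)"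
| "prop_eval v (Box \<phi>) \<longleftrightarrow> v (Box \<phi>)"

inductive_set S5 :: "'p mfm set" where
  taut: "(\<And>v. prop_eval v \<phi>) \<Longrightarrow> \<phi> \<in> S5"
| K: "Imp (Box (Imp \<phi> \<psi>)) (Imp (Box \<phi>) (Box \<psi>)) \<in> S5"
| T: "Imp (Box \<phi>) \<phi> \<in> S5"
| four: "Imp (Box \<phi>) (Box (Box \<phi>)) \<in> S5"
| five: "Imp (Dia (Box \<phi>)) \<phi> \<in> S5"
| MP: "Imp \<phi> \<psi> \<in> S5 \<Longrightarrow> \<phi> \<in> S5 \<Longrightarrow> \<psi> \<in> S5"
| Nec: "\<phi> \<in> S5 \<Longrightarrow> Box \<phi> \<in> S5"


section \<open>Rank potentialism\<close>

text \<open>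
  An assertion is a formula together with an assignment of parameters to its free variables.
  The values of the environment at other variables are irrelevant and unconstrained; in
  particular \<open>assertions {}\<close> still contains all sentences.
\<close>

type_synonym 'v assertion = "fm \<times> (nat \<Rightarrow> 'v)"

definition assertions :: "'v set \<Rightarrow> 'v assertion set" where
  "assertions A = {(\<phi>, e). \<forall>i\<in>fv \<phi>. e i \<in> A}"

text \<open>
  The world \<open>V\<^sub>\<beta>\<close> is represented by its index \<open>\<beta>\<close>.
\<close>

primrec holds_at :: "('v \<Rightarrow> 'v \<Rightarrow> bool) \<Rightarrow> 'v \<Rightarrow> 'v assertion mfm \<Rightarrow> bool" where
  "holds_at E \<beta> (Atom a) \<longleftrightarrow> sat (Vlevel E \<beta>) E (snd a) (fst a)"
| "holds_at E \<beta> Bot \<longleftrightarrow> False"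
| "holds_at E \<beta> (Imp \<phi> \<psi>) \<longleftrightarrow> (holds_at E \<beta> \<phi> \<longrightarrow> holds_at E \<beta> \<psi>)"
| "holds_at E \<beta> (Box \<phi>) \<longleftrightarrow> (\<forall>\<gamma>. Ord E \<gamma> \<and> ord_le E \<beta> \<gamma> \<longrightarrow> holds_at E \<gamma> \<phi>)"

text \<open>A substitution instance of \<open>p\<close> is \<open>map_mfm \<sigma> p\<close>, with \<open>\<sigma>\<close> mapping atoms to assertions.\<close>

definition Val :: "('v \<Rightarrow> 'v \<Rightarrow> bool) \<Rightarrow> 'v \<Rightarrow> 'v assertion set \<Rightarrow> nat mfm set" where
  "Val E \<beta> L = {p. \<forall>\<sigma>. (\<forall>n. \<sigma> n \<in> L) \<longrightarrow> holds_at E \<beta> (map_mfm \<sigma> p)}"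

end

theory Submission
  imports Defs "HOL-Library.Nat_Bijection"
begin

text \<open>
  If \<open>\<delta>\<close> is \<open>\<Sigma>\<^sub>3\<close>-correct and a type (truth pattern of finitely many assertions) were realized at some
  \<open>V\<^sub>\<gamma>\<close>, \<open>\<gamma> \<ge> \<delta>\<close>, but not cofinally often, then ``for some \<open>a\<close>, no \<open>V\<^sub>\<zeta>\<close> containing \<open>a\<close> has this type''
  would be a true \<open>\<Sigma>\<^sub>3\<close> statement; a witness \<open>a \<in> V\<^sub>\<delta>\<close> contradicts \<open>\<gamma>\<close>. Hence above \<open>\<delta>\<close> the modal truth
  of an assertion only depends on the type of the world, as in a frame with universal accessibility, and
  S5 is valid. Nothing more is valid, since S5 is complete for finite universal frames and ``the height is
  a limit plus \<open>k\<close>'' is a dial with as many values as desired, each occurring cofinally often.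

  Conversely, S5 makes every eventually true assertion true at \<open>V\<^sub>\<delta>\<close>. A true \<open>\<Sigma>\<^sub>1\<close> or \<open>\<Sigma>\<^sub>2\<close> statement is
  eventually true, which gives \<open>\<Sigma>\<^sub>2\<close>-correctness. A true \<open>\<Sigma>\<^sub>3\<close> statement is eventually true at those \<open>V\<^sub>\<gamma>\<close> that
  are \<open>\<Sigma>\<^sub>1\<close>-correct, and by Levy's argument (Skolem hull and Mostowski collapse) it suffices for this that
  \<open>V\<^sub>\<gamma>\<close> satisfies ``every well-founded relation has a collapse'' and ``all sets lie in transitive sets
  closed under pairs''. Both sentences hold at \<open>V\<^sub>\<delta>\<close>, as each instance of them is eventually true.
\<close>

section \<open>Completeness of S5 for universal frames\<close>

text \<open>\<open>E\<close> may be ill-founded, so induction or recursion along \<open>E\<close>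
  cannot be done from outside: a minimal counterexample exists only in classes that the model knows
  as sets. Every recursion (for the hierarchy, the closures, the collapse) is therefore carried out
  by elements of the model, and each comprehension has to be backed by an actual formula. The
  predicates \<open>udef\<close>, \<open>d0\<close> and \<open>pdef\<close> say that such a formula
  exists (uniformly in the domain, bounded, with parameters); they are closed under the logical
  operations, so most formulas need not be written out.

  The number 3 comes from counting quantifiers. That \<open>v\<close> is a level of the hierarchy is
  \<exists>h \<forall>x with bounded matrix, so the statement that no level containing
  \<open>a\<close> has a given type is \<forall>v \<forall>h \<exists>x, and a quantifier for
  \<open>a\<close> in front makes it Sigma 3. In the converse direction, reflection of Sigma 1
  truths by \<open>V \<gamma>\<close> has to be ensured by a single sentence evaluated at
  \<open>V \<gamma>\<close>. The two closure sentences do this without an internal truth definition;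
  since the hull is indexed by a set of codes, no cardinals enter either.\<close>

primrec universal_eval :: "('p \<Rightarrow> bool) set \<Rightarrow> ('p \<Rightarrow> bool) \<Rightarrow> 'p mfm \<Rightarrow> bool" where
  "universal_eval T w (Atom p) \<longleftrightarrow> w p"
| "universal_eval T w Bot \<longleftrightarrow> False"
| "universal_eval T w (Imp \<phi> \<psi>) \<longleftrightarrow> (universal_eval T w \<phi> \<longrightarrow> universal_eval T w \<psi>)"
| "universal_eval T w (Box \<phi>) \<longleftrightarrow> (\<forall>u\<in>T. universal_eval T u \<phi>)"

lemma prop_eval_universal_eval: "prop_eval (universal_eval T w) \<phi> \<longleftrightarrow> universal_eval T w \<phi>"
  by (induction \<phi>) auto

lemma S5_sound: "\<phi> \<in> S5 \<Longrightarrow> w \<in> T \<Longrightarrow> universal_eval T w \<phi>"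
proof (induction arbitrary: w rule: S5.induct)
  case (taut \<phi>)
  then show ?case using prop_eval_universal_eval by blast
qed auto

text \<open>The map \<open>f\<close> is a surjective bounded morphism that respects the atoms in
  \<open>A\<close>; it later cuts valuations down to the atoms of one formula.\<close>

lemma universal_eval_cong:
  assumes "\<And>w. w \<in> T \<Longrightarrow> f w \<in> T'" and "\<And>u. u \<in> T' \<Longrightarrow> \<exists>w\<in>T. u = f w"
    and "\<And>w n. w \<in> T \<Longrightarrow> n \<in> A \<Longrightarrow> f w n = w n"
  shows "set_mfm \<phi> \<subseteq> A \<Longrightarrow> w \<in> T \<Longrightarrow> universal_eval T' (f w) \<phi> \<longleftrightarrow> universal_eval T w \<phi>"
proof (induction \<phi> arbitrary: w)
  case (Box \<phi>)
  then show ?case using assms(1,2) by simp metis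
qed (use assms(3) in auto)

section \<open>Derivability and maximal consistent sets\<close>

lemma foldr_Imp_eval:
  "prop_eval v (foldr Imp l \<phi>) \<longleftrightarrow> ((\<forall>x\<in>set l. prop_eval v x) \<longrightarrow> prop_eval v \<phi>)"
  by (induction l) auto

lemma S5_foldr_MP: "foldr Imp l \<phi> \<in> S5 \<Longrightarrow> set l \<subseteq> S5 \<Longrightarrow> \<phi> \<in> S5"
  by (induction l) (auto intro: S5.MP)

text \<open>The chain of implications from the premises to \<open>\<phi>\<close> is a tautology, so
  modus ponens suffices. Hilbert-style steps become checks by truth tables.\<close>

lemma S5_conseq:
  assumes "set l \<subseteq> S5" and "\<And>v. (\<forall>x\<in>set l. prop_eval v x) \<Longrightarrow> prop_eval v \<phi>"
  shows "\<phi> \<in> S5"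
  using S5_foldr_MP[OF _ assms(1)] S5.taut[of "foldr Imp l \<phi>"] assms(2) foldr_Imp_eval by blast

text \<open>Necessitation is applied only inside \<open>S5\<close>, never to the hypotheses in
  \<Gamma>; this is what makes the deduction theorem true.\<close>

definition der :: "'p mfm set \<Rightarrow> 'p mfm \<Rightarrow> bool" where
  "der \<Gamma> \<phi> \<longleftrightarrow> (\<exists>l. set l \<subseteq> \<Gamma> \<and> foldr Imp l \<phi> \<in> S5)"

lemma der_S5: "\<phi> \<in> S5 \<Longrightarrow> der \<Gamma> \<phi>"
  unfolding der_def by (rule exI[of _ "[]"]) simp

lemma der_assm: "\<phi> \<in> \<Gamma> \<Longrightarrow> der \<Gamma> \<phi>"
  unfolding der_def by (rule exI[of _ "[\<phi>]"]) (auto intro: S5.taut)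

lemma der_conseq2:
  assumes "der \<Gamma> \<phi>" "der \<Gamma> \<psi>" and "\<And>v. prop_eval v \<phi> \<Longrightarrow> prop_eval v \<psi> \<Longrightarrow> prop_eval v \<chi>"
  shows "der \<Gamma> \<chi>"
proof -
  obtain k l where kl: "set k \<subseteq> \<Gamma>" "foldr Imp k \<phi> \<in> S5" "set l \<subseteq> \<Gamma>" "foldr Imp l \<psi> \<in> S5"
    using assms(1,2) unfolding der_def by blast
  have "foldr Imp (k @ l) \<chi> \<in> S5"
    by (rule S5_conseq[of "[foldr Imp k \<phi>, foldr Imp l \<psi>]"])
      (use kl assms(3) in \<open>auto simp: foldr_Imp_eval simp del: foldr_append\<close>)
  then show ?thesis unfolding der_def using kl by (intro exI[of _ "k @ l"]) auto
qed

lemma der_deduct: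
  assumes "der (insert \<phi> \<Gamma>) \<psi>"
  shows "der \<Gamma> (Imp \<phi> \<psi>)"
proof -
  obtain l where l: "set l \<subseteq> insert \<phi> \<Gamma>" "foldr Imp l \<psi> \<in> S5"
    using assms unfolding der_def by blast
  have "foldr Imp (filter (\<lambda>x. x \<noteq> \<phi>) l) (Imp \<phi> \<psi>) \<in> S5"
    by (rule S5_conseq[of "[foldr Imp l \<psi>]"]) (use l in \<open>auto simp: foldr_Imp_eval\<close>)
  then show ?thesis unfolding der_def using l by (intro exI[of _ "filter (\<lambda>x. x \<noteq> \<phi>) l"]) auto
qed

definition mcs :: "'p mfm set \<Rightarrow> bool" where
  "mcs \<Gamma> \<longleftrightarrow> \<not> der \<Gamma> Bot \<and> (\<forall>\<phi>. \<phi> \<notin> \<Gamma> \<longrightarrow> Imp \<phi> Bot \<in> \<Gamma>)"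

text \<open>The type of atoms is arbitrary, so Zorn's lemma replaces an enumeration of the formulas.
  A derivation uses finitely many hypotheses, which lie in one member of a chain.\<close>

lemma lindenbaum:
  assumes "\<not> der \<Gamma> Bot"
  obtains \<Delta> where "mcs \<Delta>" "\<Gamma> \<subseteq> \<Delta>"
proof -
  let ?C = "{\<Delta>. \<Gamma> \<subseteq> \<Delta> \<and> \<not> der \<Delta> Bot}"
  have "\<exists>M\<in>?C. \<forall>X\<in>?C. M \<subseteq> X \<longrightarrow> X = M"
  proof (rule subset_Zorn_nonempty)
    show "?C \<noteq> {}" using assms by blast
    fix C assume C: "C \<noteq> {}" "subset.chain ?C C"
    have "\<not> der (\<Union>C) Bot"
    proof
      assume "der (\<Union>C) Bot"
      then obtain l where l: "set l \<subseteq> \<Union>C" "foldr Imp l Bot \<in> S5" unfolding der_def by blast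
      have "finite (set l)" by simp
      then obtain X where "X \<in> C" "set l \<subseteq> X"
        using finite_subset_Union_chain[OF _ l(1) C] by blast
      then show False using l(2) C(2) unfolding der_def subset_chain_def by blast
    qed
    then show "\<Union>C \<in> ?C" using C unfolding subset_chain_def by blast
  qed
  then obtain M where "M \<in> ?C" and "\<forall>X\<in>?C. M \<subseteq> X \<longrightarrow> X = M" ..
  then have M: "\<Gamma> \<subseteq> M" "\<not> der M Bot"
    and max: "\<And>X. \<Gamma> \<subseteq> X \<Longrightarrow> \<not> der X Bot \<Longrightarrow> M \<subseteq> X \<Longrightarrow> X = M" by simp_all
  have "Imp \<phi> Bot \<in> M" if "\<phi> \<notin> M" for \<phi>
  proof (rule ccontr)
    assume "Imp \<phi> Bot \<notin> M"
    then have "der (insert (Imp \<phi> Bot) M) Bot" "der (insert \<phi> M) Bot"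
      using max[of "insert (Imp \<phi> Bot) M"] max[of "insert \<phi> M"] M(1) that by auto
    then have "der M (Imp (Imp \<phi> Bot) Bot)" "der M (Imp \<phi> Bot)" using der_deduct by blast+
    then have "der M Bot" by (rule der_conseq2) auto
    then show False using M(2) by blast
  qed
  then show ?thesis using that M unfolding mcs_def by blast
qed

lemma mcs_der: "mcs \<Gamma> \<Longrightarrow> der \<Gamma> \<phi> \<longleftrightarrow> \<phi> \<in> \<Gamma>"
proof
  assume m: "mcs \<Gamma>" and d: "der \<Gamma> \<phi>"
  show "\<phi> \<in> \<Gamma>"
  proof (rule ccontr)
    assume "\<phi> \<notin> \<Gamma>"
    then have "der \<Gamma> (Imp \<phi> Bot)" using m der_assm unfolding mcs_def by blast
    then have "der \<Gamma> Bot" using d by (rule der_conseq2) auto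
    then show False using m unfolding mcs_def by blast
  qed
qed (rule der_assm)

lemma mcs_Imp: "mcs \<Gamma> \<Longrightarrow> Imp \<phi> \<psi> \<in> \<Gamma> \<longleftrightarrow> (\<phi> \<in> \<Gamma> \<longrightarrow> \<psi> \<in> \<Gamma>)"
proof (intro iffI impI)
  assume "mcs \<Gamma>" "Imp \<phi> \<psi> \<in> \<Gamma>" "\<phi> \<in> \<Gamma>"
  then show "\<psi> \<in> \<Gamma>" using der_conseq2[of \<Gamma> "Imp \<phi> \<psi>" \<phi> \<psi>] mcs_der by auto
next
  assume m: "mcs \<Gamma>" and i: "\<phi> \<in> \<Gamma> \<longrightarrow> \<psi> \<in> \<Gamma>"
  then have "Imp \<phi> Bot \<in> \<Gamma> \<or> \<psi> \<in> \<Gamma>" unfolding mcs_def by blast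
  then show "Imp \<phi> \<psi> \<in> \<Gamma>"
    using m der_conseq2[of \<Gamma> "Imp \<phi> Bot" "Imp \<phi> Bot" "Imp \<phi> \<psi>"]
      der_conseq2[of \<Gamma> \<psi> \<psi> "Imp \<phi> \<psi>"] mcs_der by auto
qed

lemma mcs_Bot: "mcs \<Gamma> \<Longrightarrow> Bot \<notin> \<Gamma>"
  using der_assm unfolding mcs_def by blast

lemma S5_in_mcs: "mcs \<Gamma> \<Longrightarrow> \<phi> \<in> S5 \<Longrightarrow> \<phi> \<in> \<Gamma>"
  using mcs_der der_S5 by blast

lemma S5_Box_mono: "Imp \<phi> \<psi> \<in> S5 \<Longrightarrow> Imp (Box \<phi>) (Box \<psi>) \<in> S5"
  using S5.K S5.MP S5.Nec by blast

text \<open>The axiom \<open>five\<close> is the dual of the symmetry axiom. Its instance at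
  \<open>Box \<phi>\<close> gives, by contraposition, that \<open>\<not> Box \<phi>\<close> implies
  \<open>Box (\<not> Box (Box \<phi>))\<close>; \<open>four\<close> under the box removes one of the
  inner boxes.\<close>

lemma S5_negative_introspection: "Imp (Imp (Box \<phi>) Bot) (Box (Imp (Box \<phi>) Bot)) \<in> S5"
proof -
  have "Imp (Imp (Box (Box \<phi>)) Bot) (Imp (Box \<phi>) Bot) \<in> S5"
    by (rule S5_conseq[of "[Imp (Box \<phi>) (Box (Box \<phi>))]"]) (auto intro: S5.four)
  then have "Imp (Box (Imp (Box (Box \<phi>)) Bot)) (Box (Imp (Box \<phi>) Bot)) \<in> S5"
    by (rule S5_Box_mono)
  then show ?thesis
    by (intro S5_conseq[of "[Imp (Dia (Box (Box \<phi>))) (Box \<phi>),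
        Imp (Box (Imp (Box (Box \<phi>)) Bot)) (Box (Imp (Box \<phi>) Bot))]"])
      (auto intro: S5.five)
qed

lemma S5_foldr_Box: "foldr Imp l \<phi> \<in> S5 \<Longrightarrow> foldr Imp (map Box l) (Box \<phi>) \<in> S5"
proof (induction l arbitrary: \<phi> rule: rev_induct)
  case (snoc x l)
  then have "foldr Imp (map Box l) (Box (Imp x \<phi>)) \<in> S5" by simp
  then show ?case
    by (intro S5_conseq[of "[foldr Imp (map Box l) (Box (Imp x \<phi>)), Imp (Box (Imp x \<phi>)) (Imp (Box x)
        (Box \<phi>))]"])
     (auto simp: foldr_Imp_eval simp del: foldr_append intro: S5.K)
qed (auto intro: S5.Nec)

text \<open>The canonical model is restricted to the worlds seen by one maximal consistent set that
  refutes \<open>\<phi>\<close>. There all boxed formulas have constant truth value, so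
  accessibility is universal and worlds may be replaced by their valuations.\<close>

lemma S5_complete:
  fixes \<phi> :: "'p mfm"
  assumes "\<phi> \<notin> S5"
  obtains T w where "w \<in> T" "\<not> universal_eval T w \<phi>"
proof -
  have "\<not> der {Imp \<phi> Bot} Bot"
  proof
    assume "der {Imp \<phi> Bot} Bot"
    then have "der {} (Imp (Imp \<phi> Bot) Bot)" by (rule der_deduct)
    then have "Imp (Imp \<phi> Bot) Bot \<in> S5" unfolding der_def by simp
    then have "\<phi> \<in> S5" by (intro S5_conseq[of "[Imp (Imp \<phi> Bot) Bot]"]) auto
    then show False using assms by blast
  qed
  then obtain \<Gamma> where \<Gamma>: "mcs \<Gamma>" "Imp \<phi> Bot \<in> \<Gamma>" using lindenbaum by blast
  define W where "W = {\<Delta>. mcs \<Delta> \<and> (\<forall>\<psi>. Box \<psi> \<in> \<Gamma> \<longrightarrow> \<psi> \<in> \<Delta>)}"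
  define val where "val \<Delta> p \<longleftrightarrow> Atom p \<in> \<Delta>" for \<Delta> :: "'p mfm set" and p
  have \<Gamma>W: "\<Gamma> \<in> W" using \<Gamma>(1) S5_in_mcs[OF \<Gamma>(1) S5.T] mcs_Imp[OF \<Gamma>(1)] unfolding W_def by blast
  \<comment> \<open>Positive introspection (\<open>four\<close>) fixes the boxed members of \<Gamma>
    throughout \<open>W\<close>, negative introspection the boxed non-members.\<close>
  have Box_iff: "Box \<psi> \<in> \<Delta> \<longleftrightarrow> Box \<psi> \<in> \<Gamma>" if "\<Delta> \<in> W" for \<Delta> \<psi>
  proof -
    have m: "mcs \<Delta>" using that W_def by blast
    have "Box (Box \<psi>) \<in> \<Gamma>" if "Box \<psi> \<in> \<Gamma>"
      using that mcs_Imp[OF \<Gamma>(1)] S5_in_mcs[OF \<Gamma>(1) S5.four] by blast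
    moreover have "Box (Imp (Box \<psi>) Bot) \<in> \<Gamma>" if "Box \<psi> \<notin> \<Gamma>"
      using that mcs_Imp[OF \<Gamma>(1)] S5_in_mcs[OF \<Gamma>(1) S5_negative_introspection] by blast
    ultimately show ?thesis using that mcs_Imp[OF m] mcs_Bot[OF m] unfolding W_def by blast
  qed
  have Box_all: "Box \<psi> \<in> \<Gamma> \<longleftrightarrow> (\<forall>\<Delta>\<in>W. \<psi> \<in> \<Delta>)" for \<psi>
  proof
    assume all: "\<forall>\<Delta>\<in>W. \<psi> \<in> \<Delta>"
    let ?B = "{\<chi>. Box \<chi> \<in> \<Gamma>}"
    \<comment> \<open>Otherwise a maximal consistent extension would be a world of \<open>W\<close>
      that refutes \<open>\<psi>\<close>.\<close>
    have "der (insert (Imp \<psi> Bot) ?B) Bot"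
    proof (rule ccontr)
      assume "\<not> der (insert (Imp \<psi> Bot) ?B) Bot"
      then obtain \<Delta> where D: "mcs \<Delta>" "insert (Imp \<psi> Bot) ?B \<subseteq> \<Delta>" using lindenbaum by blast
      then have "\<Delta> \<in> W" unfolding W_def by blast
      then show False using all D mcs_Imp[OF D(1)] mcs_Bot[OF D(1)] by blast
    qed
    then have "der ?B (Imp (Imp \<psi> Bot) Bot)" by (rule der_deduct)
    from this this have "der ?B \<psi>" by (rule der_conseq2) auto
    then obtain l where l: "set l \<subseteq> ?B" "foldr Imp l \<psi> \<in> S5" unfolding der_def by blast
    have "der \<Gamma> (Box \<psi>)" unfolding der_def
      by (rule exI[of _ "map Box l"]) (use l S5_foldr_Box in auto)
    then show "Box \<psi> \<in> \<Gamma>" using mcs_der[OF \<Gamma>(1)] by blast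
  qed (auto simp: W_def)
  have truth: "\<Delta> \<in> W \<Longrightarrow> universal_eval (val ` W) (val \<Delta>) \<psi> \<longleftrightarrow> \<psi> \<in> \<Delta>" for \<psi> \<Delta>
  proof (induction \<psi> arbitrary: \<Delta>)
    case Bot
    then show ?case using mcs_Bot unfolding W_def by auto
  next
    case (Imp \<psi>1 \<psi>2)
    then have "mcs \<Delta>" unfolding W_def by simp
    then show ?case using Imp mcs_Imp[of \<Delta>] by simp
  next
    case (Box \<psi>)
    then show ?case using Box_iff Box_all by auto
  qed (auto simp: val_def)
  show ?thesis
    by (rule that[of "val \<Gamma>" "val ` W"]) (use \<Gamma>W truth[OF \<Gamma>W] \<Gamma> mcs_Imp[OF \<Gamma>(1)] mcs_Bot[OF \<Gamma>(1)] in
        auto)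
qed

text \<open>Only the values at the finitely many atoms of \<open>\<phi>\<close> matter; setting all
  others to false leaves finitely many valuations. Finiteness is what the dial can simulate.\<close>

lemma S5_complete_finite:
  fixes \<phi> :: "nat mfm"
  assumes "\<phi> \<notin> S5"
  obtains T w where "w \<in> T" "\<not> universal_eval T w \<phi>" "finite T"
proof -
  obtain T w where Tw: "w \<in> T" "\<not> universal_eval T w \<phi>" using S5_complete[OF assms] by blast
  define f where "f w n \<longleftrightarrow> w n \<and> n \<in> set_mfm \<phi>" for w :: "nat \<Rightarrow> bool" and n
  have fin: "finite (set_mfm \<phi>)" by (induction \<phi>) auto
  have "inj_on Collect (f ` T)" by (auto simp: inj_on_def)
  moreover have "Collect ` f ` T \<subseteq> Pow (set_mfm \<phi>)" unfolding f_def by auto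
  ultimately have "finite (f ` T)" using fin by (meson finite_Pow_iff finite_imageD finite_subset)
  moreover have "\<not> universal_eval (f ` T) (f w) \<phi>"
    using Tw universal_eval_cong[of T f "f ` T" "set_mfm \<phi>" \<phi> w] unfolding f_def by auto
  ultimately show ?thesis using that Tw(1) by blast
qed

section \<open>Definability\<close>

lemma finite_fv: "finite (fv \<phi>)"
  by (induction \<phi>) auto

lemma sat_cong: "\<forall>i\<in>fv \<phi>. e i = e' i \<Longrightarrow> sat D E e \<phi> \<longleftrightarrow> sat D E e' \<phi>"
proof (induction \<phi> arbitrary: e e')
  case (Exists x \<phi>)
  have "sat D E (e(x := a)) \<phi> \<longleftrightarrow> sat D E (e'(x := a)) \<phi>" for a
    by (rule Exists.IH) (use Exists.prems in auto)
  then show ?case by simp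
next
  case (Conj \<phi> \<psi>)
  show ?case using Conj.IH(1)[of e e'] Conj.IH(2)[of e e'] Conj.prems by simp
next
  case (Neg \<phi>)
  show ?case using Neg.IH[of e e'] Neg.prems by simp
qed auto

lemma fresh_var: "finite A \<Longrightarrow> \<exists>k::nat. k \<notin> A"
  using ex_new_if_finite infinite_UNIV_nat by blast

text \<open>Simultaneous renaming by a map \<open>f\<close> that need not be injective, hence the
  fresh bound variable. A bounded quantifier has to stay bounded, so the case
  \<open>Exists x (Conj (Mem x y) \<chi>)\<close> is treated as one step; this requires induction on
  the size.\<close>

lemma rename_fm:
  "\<exists>\<psi>. (Delta0 \<phi> \<longrightarrow> Delta0 \<psi>) \<and> (\<forall>D (E :: 'v \<Rightarrow> 'v \<Rightarrow> bool) e. sat D E e \<psi> \<longleftrightarrow> sat D E (\<lambda>n. e (f n)) \<phi>)"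
proof (induction \<phi> arbitrary: f rule: measure_induct_rule[of size])
  case (less \<phi>)
  have ex: "\<exists>k \<psi>'. k \<notin> f ` (fv \<psi> \<union> A) \<and> (Delta0 \<psi> \<longrightarrow> Delta0 \<psi>') \<and>
      (\<forall>D (E :: 'v \<Rightarrow> 'v \<Rightarrow> bool) e. sat D E e (Exists k \<psi>') \<longleftrightarrow> sat D E (\<lambda>n. e (f n)) (Exists x \<psi>))"
    if sz: "size \<psi> < size \<phi>" and "finite A" for \<psi> x A
  proof -
    obtain k where k: "k \<notin> f ` (fv \<psi> \<union> A)"
      using fresh_var[of "f ` (fv \<psi> \<union> A)"] finite_fv \<open>finite A\<close> by auto
    obtain \<psi>' where \<psi>': "Delta0 \<psi> \<longrightarrow> Delta0 \<psi>'"
      "\<forall>D (E :: 'v \<Rightarrow> 'v \<Rightarrow> bool) e. sat D E e \<psi>' \<longleftrightarrow> sat D E (\<lambda>n. e ((f(x := k)) n)) \<psi>"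
      using less[OF sz] by blast
    have "sat D E (e(k := a)) \<psi>' \<longleftrightarrow> sat D E ((\<lambda>n. e (f n))(x := a)) \<psi>"
      for D and E :: "'v \<Rightarrow> 'v \<Rightarrow> bool" and e a
      unfolding \<psi>'(2)[rule_format] by (rule sat_cong) (use k in auto)
    then have "\<forall>D (E :: 'v \<Rightarrow> 'v \<Rightarrow> bool) e. sat D E e (Exists k \<psi>') \<longleftrightarrow> sat D E (\<lambda>n. e (f n)) (Exists x \<psi>)"
      by simp
    then show ?thesis using k \<psi>'(1) by blast
  qed
  show ?case
  proof (cases \<phi>)
    case (Mem x y)
    then show ?thesis by (intro exI[of _ "Mem (f x) (f y)"]) (auto intro: Delta0.intros)
  next
    case (Eq x y)
    then show ?thesis by (intro exI[of _ "Eq (f x) (f y)"]) (auto intro: Delta0.intros)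
  next
    case (Neg \<psi>)
    then obtain \<psi>' where "Delta0 \<psi> \<longrightarrow> Delta0 \<psi>'"
      "\<forall>D (E :: 'v \<Rightarrow> 'v \<Rightarrow> bool) e. sat D E e \<psi>' \<longleftrightarrow> sat D E (\<lambda>n. e (f n)) \<psi>"
      using less[of \<psi> f] by auto
    then show ?thesis using Neg
      by (intro exI[of _ "Neg \<psi>'"]) (auto intro: Delta0.intros elim: Delta0.cases)
  next
    case (Conj \<psi> \<chi>)
    obtain \<psi>' where "Delta0 \<psi> \<longrightarrow> Delta0 \<psi>'"
      "\<forall>D (E :: 'v \<Rightarrow> 'v \<Rightarrow> bool) e. sat D E e \<psi>' \<longleftrightarrow> sat D E (\<lambda>n. e (f n)) \<psi>"
      using less[of \<psi> f] Conj by auto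
    moreover obtain \<chi>' where "Delta0 \<chi> \<longrightarrow> Delta0 \<chi>'"
      "\<forall>D (E :: 'v \<Rightarrow> 'v \<Rightarrow> bool) e. sat D E e \<chi>' \<longleftrightarrow> sat D E (\<lambda>n. e (f n)) \<chi>"
      using less[of \<chi> f] Conj by auto
    ultimately show ?thesis using Conj
      by (intro exI[of _ "Conj \<psi>' \<chi>'"]) (auto intro: Delta0.intros elim: Delta0.cases)
  next
    case ex\<phi>: (Exists x \<psi>)
    show ?thesis
    proof (cases "Delta0 \<phi>")
      case False
      have "size \<psi> < size \<phi>" using ex\<phi> by simp
      from ex[OF this, of "{}" x] obtain k \<psi>' where
        "\<forall>D (E :: 'v \<Rightarrow> 'v \<Rightarrow> bool) e. sat D E e (Exists k \<psi>') \<longleftrightarrow> sat D E (\<lambda>n. e (f n)) (Exists x \<psi>)"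
        by auto
      then show ?thesis using False ex\<phi> by blast
    next
      case True
      then obtain y \<chi> where \<chi>: "\<psi> = Conj (Mem x y) \<chi>" "Delta0 \<chi>" "x \<noteq> y"
        using ex\<phi> by (auto elim: Delta0.cases)
      have "size \<chi> < size \<phi>" using ex\<phi> \<chi> by simp
      obtain k where k: "k \<notin> f ` (fv \<chi> \<union> {y})"
      using fresh_var[of "f ` (fv \<chi> \<union> {y})"] finite_fv by auto
      obtain \<chi>' where \<chi>': "Delta0 \<chi>'"
        "\<forall>D (E :: 'v \<Rightarrow> 'v \<Rightarrow> bool) e. sat D E e \<chi>' \<longleftrightarrow> sat D E (\<lambda>n. e ((f(x := k)) n)) \<chi>"
        using less[OF \<open>size \<chi> < size \<phi>\<close>] \<chi>(2) by blast
      have "sat D E (e(k := a)) \<chi>' \<longleftrightarrow> sat D E ((\<lambda>n. e (f n))(x := a)) \<chi>"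
        for D and E :: "'v \<Rightarrow> 'v \<Rightarrow> bool" and e a
        unfolding \<chi>'(2)[rule_format] by (rule sat_cong) (use k in auto)
      then have "\<forall>D (E :: 'v \<Rightarrow> 'v \<Rightarrow> bool) e. sat D E e (Exists k (Conj (Mem k (f y)) \<chi>'))
          \<longleftrightarrow> sat D E (\<lambda>n. e (f n)) \<phi>"
        using ex\<phi> \<chi> k by simp
      moreover have "Delta0 (Exists k (Conj (Mem k (f y)) \<chi>'))"
        using k \<chi>' by (auto intro: Delta0.intros)
      ultimately show ?thesis by blast
    qed
  qed
qed

text \<open>Environments are read as streams: \<open>scons a e\<close> pushes the value of a newly bound variable, so
  that formulas can be manipulated semantically, without naming variables.\<close>

abbreviation scons :: "'v \<Rightarrow> (nat \<Rightarrow> 'v) \<Rightarrow> nat \<Rightarrow> 'v" where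
  "scons a e \<equiv> \<lambda>n. case n of 0 \<Rightarrow> a | Suc m \<Rightarrow> e m"

text \<open>One formula serves all domains \<open>D\<close>: an assertion is evaluated at different
  worlds and has to keep its meaning there.\<close>

definition udef :: "('v \<Rightarrow> 'v \<Rightarrow> bool) \<Rightarrow> ('v set \<Rightarrow> (nat \<Rightarrow> 'v) \<Rightarrow> bool) \<Rightarrow> bool" where
  "udef E P \<longleftrightarrow> (\<exists>\<phi>. \<forall>D e. P D e \<longleftrightarrow> sat D E e \<phi>)"

lemma udef_mem: "udef E (\<lambda>D e. E (e i) (e j))"
  unfolding udef_def by (intro exI[of _ "Mem i j"]) simp
lemma udef_eq: "udef E (\<lambda>D e. e i = e j)"
  unfolding udef_def by (intro exI[of _ "Eq i j"]) simp
lemma udef_neg: "udef E P \<Longrightarrow> udef E (\<lambda>D e. \<not> P D e)"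
  unfolding udef_def
proof (elim exE)
  fix \<phi> assume "\<forall>D e. P D e \<longleftrightarrow> sat D E e \<phi>"
  then show "\<exists>\<phi>. \<forall>D e. (\<not> P D e) \<longleftrightarrow> sat D E e \<phi>" by (intro exI[of _ "Neg \<phi>"]) simp
qed
lemma udef_conj: "udef E P \<Longrightarrow> udef E Q \<Longrightarrow> udef E (\<lambda>D e. P D e \<and> Q D e)"
  unfolding udef_def
proof (elim exE)
  fix \<phi> \<psi> assume "\<forall>D e. P D e \<longleftrightarrow> sat D E e \<phi>" "\<forall>D e. Q D e \<longleftrightarrow> sat D E e \<psi>"
  then show "\<exists>\<phi>. \<forall>D e. (P D e \<and> Q D e) \<longleftrightarrow> sat D E e \<phi>" by (intro exI[of _ "Conj \<phi> \<psi>"]) simp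
qed
lemma udef_rename: "udef E P \<Longrightarrow> udef E (\<lambda>D e. P D (\<lambda>n. e (f n)))"
  unfolding udef_def
proof (elim exE)
  fix \<phi> assume \<phi>: "\<forall>D e. P D e \<longleftrightarrow> sat D E e \<phi>"
  obtain \<psi> where "\<forall>D (E :: 'a \<Rightarrow> 'a \<Rightarrow> bool) e. sat D E e \<psi> \<longleftrightarrow> sat D E (\<lambda>n. e (f n)) \<phi>"
    using rename_fm by blast
  then show "\<exists>\<psi>. \<forall>D e. P D (\<lambda>n. e (f n)) \<longleftrightarrow> sat D E e \<psi>" using \<phi>
    by (intro exI[of _ \<psi>]) simp
qed
lemma udef_bex:
  assumes "udef E (\<lambda>D e. Q D (e 0) (\<lambda>n. e (Suc n)))"
  shows "udef E (\<lambda>D e. \<exists>x\<in>D. Q D x e)"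
proof -
  obtain \<phi> where \<phi>: "\<forall>D e. Q D (e 0) (\<lambda>n. e (Suc n)) \<longleftrightarrow> sat D E e \<phi>"
    using assms unfolding udef_def by blast
  \<comment> \<open>The named variable \<open>k\<close> takes over index 0 and \<open>Suc m\<close>
    goes back to \<open>m\<close>, so \<open>k\<close> must differ from the predecessor of every
    free index.\<close>
  obtain k where k: "k \<notin> Suc ` fv \<phi> \<union> (\<lambda>i. i - 1) ` fv \<phi>"
      using fresh_var[of "Suc ` fv \<phi> \<union> (\<lambda>i. i - 1) ` fv \<phi>"] finite_fv by auto
  define f where "f n = (case n of 0 \<Rightarrow> k | Suc m \<Rightarrow> m)" for n
  obtain \<psi> where \<psi>: "\<forall>D (E :: 'a \<Rightarrow> 'a \<Rightarrow> bool) e. sat D E e \<psi> \<longleftrightarrow> sat D E (\<lambda>n. e (f n)) \<phi>"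
    using rename_fm by blast
  have "sat D E (e(k := a)) \<psi> \<longleftrightarrow> Q D a e" for D e a
  proof -
    have "sat D E (\<lambda>n. (e(k := a)) (f n)) \<phi> \<longleftrightarrow> sat D E (scons a e) \<phi>"
      by (rule sat_cong) (use k in \<open>force simp: f_def split: nat.split\<close>)
    also have "\<dots> \<longleftrightarrow> Q D a e" using \<phi>[rule_format, of D "scons a e"] by simp
    finally show ?thesis using \<psi> by blast
  qed
  then show ?thesis unfolding udef_def by (intro exI[of _ "Exists k \<psi>"]) simp
qed

lemma udef_disj: "udef E P \<Longrightarrow> udef E Q \<Longrightarrow> udef E (\<lambda>D e. P D e \<or> Q D e)"
  using udef_neg[OF udef_conj[OF udef_neg udef_neg]] by (simp add: de_Morgan_conj)
lemma udef_imp: "udef E P \<Longrightarrow> udef E Q \<Longrightarrow> udef E (\<lambda>D e. P D e \<longrightarrow> Q D e)"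
  using udef_disj[OF udef_neg] by (simp only: imp_conv_disj)
lemma udef_iff: "udef E P \<Longrightarrow> udef E Q \<Longrightarrow> udef E (\<lambda>D e. P D e \<longleftrightarrow> Q D e)"
  using udef_conj[OF udef_imp udef_imp, of E P Q Q P] by (simp only: iff_conv_conj_imp)
lemma udef_ball: "udef E (\<lambda>D e. Q D (e 0) (\<lambda>n. e (Suc n))) \<Longrightarrow> udef E (\<lambda>D e. \<forall>x\<in>D. Q D x e)"
  using udef_neg[OF udef_bex[of E "\<lambda>D x e. \<not> Q D x e", OF udef_neg]] by simp
lemma udef_const: "udef E (\<lambda>D e. b)"
proof (cases b)
  case True
  have "udef E (\<lambda>D e. e 0 = e 0)" by (rule udef_eq)
  then show ?thesis using True by simp
next
  case False
  have "udef E (\<lambda>D e. \<not> e 0 = e 0)" by (intro udef_neg udef_eq)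
  then show ?thesis using False by simp
qed

text \<open>Case distinction on the truth of the last \<open>Q N\<close> reduces an arbitrary truth
  function \<open>B\<close> of \<open>N + 1\<close> arguments to two truth functions of
  \<open>N\<close> arguments.\<close>

lemma udef_boolean_combination:
  "(\<And>k. k < (N::nat) \<Longrightarrow> udef E (Q k)) \<Longrightarrow> udef E (\<lambda>D e. B (\<lambda>k. k < N \<and> Q k D e))"
proof (induction N arbitrary: B)
  case 0
  show ?case by (simp add: udef_const)
next
  case (Suc N)
  have 1: "B (\<lambda>k. k < Suc N \<and> Q k D e) \<longleftrightarrow>
     (Q N D e \<and> B ((\<lambda>k. k < N \<and> Q k D e)(N := True))) \<or> (\<not> Q N D e \<and> B ((\<lambda>k. k < N \<and> Q k D e)(N :=
         False)))" for D e
  proof -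
    have "(\<lambda>k. k < Suc N \<and> Q k D e) = (\<lambda>k. k < N \<and> Q k D e)(N := Q N D e)"
      by (auto simp: fun_eq_iff less_Suc_eq)
    then show ?thesis by (cases "Q N D e") auto
  qed
  have "udef E (\<lambda>D e. (\<lambda>b. B (b(N := c))) (\<lambda>k. k < N \<and> Q k D e))" for c
    by (rule Suc.IH) (use Suc.prems in auto)
  then show ?case unfolding 1 using Suc.prems[of N] by (intro udef_disj udef_conj udef_neg) auto
qed

lemmas udef_intros = udef_const udef_mem udef_eq udef_neg udef_conj udef_disj udef_imp udef_iff
    udef_bex udef_ball

section \<open>Bounded formulas\<close>

definition d0 :: "('v \<Rightarrow> 'v \<Rightarrow> bool) \<Rightarrow> ((nat \<Rightarrow> 'v) \<Rightarrow> bool) \<Rightarrow> bool" where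
  "d0 E P \<longleftrightarrow> (\<exists>\<phi>. Delta0 \<phi> \<and> (\<forall>e. P e \<longleftrightarrow> sat UNIV E e \<phi>))"

lemma d0_mem: "d0 E (\<lambda>e. E (e i) (e j))"
  unfolding d0_def by (intro exI[of _ "Mem i j"]) (simp add: Delta0.intros)
lemma d0_eq: "d0 E (\<lambda>e. e i = e j)"
  unfolding d0_def by (intro exI[of _ "Eq i j"]) (simp add: Delta0.intros)
lemma d0_neg: "d0 E P \<Longrightarrow> d0 E (\<lambda>e. \<not> P e)"
  unfolding d0_def
proof (elim exE conjE)
  fix \<phi> assume "Delta0 \<phi>" "\<forall>e. P e \<longleftrightarrow> sat UNIV E e \<phi>"
  then show "\<exists>\<phi>. Delta0 \<phi> \<and> (\<forall>e. (\<not> P e) \<longleftrightarrow> sat UNIV E e \<phi>)"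
    by (intro exI[of _ "Neg \<phi>"]) (simp add: Delta0.intros)
qed
lemma d0_conj: "d0 E P \<Longrightarrow> d0 E Q \<Longrightarrow> d0 E (\<lambda>e. P e \<and> Q e)"
  unfolding d0_def
proof (elim exE conjE)
  fix \<phi> \<psi> assume "Delta0 \<phi>" "\<forall>e. P e \<longleftrightarrow> sat UNIV E e \<phi>" "Delta0 \<psi>" "\<forall>e. Q e \<longleftrightarrow> sat UNIV E e \<psi>"
  then show "\<exists>\<phi>. Delta0 \<phi> \<and> (\<forall>e. (P e \<and> Q e) \<longleftrightarrow> sat UNIV E e \<phi>)"
    by (intro exI[of _ "Conj \<phi> \<psi>"]) (simp add: Delta0.intros)
qed
lemma d0_bex:
  assumes "d0 E (\<lambda>e. Q (e 0) (\<lambda>n. e (Suc n)))"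
  shows "d0 E (\<lambda>e. \<exists>x. E x (e j) \<and> Q x e)"
proof -
  obtain \<phi> where \<phi>: "Delta0 \<phi>" "\<forall>e. Q (e 0) (\<lambda>n. e (Suc n)) \<longleftrightarrow> sat UNIV E e \<phi>"
    using assms unfolding d0_def by blast
  obtain k where k: "k \<notin> insert j (Suc ` fv \<phi> \<union> (\<lambda>i. i - 1) ` fv \<phi>)"
      using fresh_var[of "insert j (Suc ` fv \<phi> \<union> (\<lambda>i. i - 1) ` fv \<phi>)"] finite_fv by auto
  define f where "f n = (case n of 0 \<Rightarrow> k | Suc m \<Rightarrow> m)" for n
  obtain \<psi> where \<psi>: "Delta0 \<psi>" "\<forall>D (E :: 'a \<Rightarrow> 'a \<Rightarrow> bool) e. sat D E e \<psi> \<longleftrightarrow> sat D E (\<lambda>n. e (f n)) \<phi>"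
    using rename_fm \<phi>(1) by blast
  have "sat UNIV E (e(k := a)) \<psi> \<longleftrightarrow> Q a e" for e a
  proof -
    have "sat UNIV E (\<lambda>n. (e(k := a)) (f n)) \<phi> \<longleftrightarrow> sat UNIV E (scons a e) \<phi>"
      by (rule sat_cong) (use k in \<open>force simp: f_def split: nat.split\<close>)
    also have "\<dots> \<longleftrightarrow> Q a e" using \<phi>(2)[rule_format, of "scons a e"] by simp
    finally show ?thesis using \<psi> by blast
  qed
  then show ?thesis unfolding d0_def using k \<psi>(1)
    by (intro exI[of _ "Exists k (Conj (Mem k j) \<psi>)"]) (auto intro: Delta0.intros)
qed

lemma d0_disj: "d0 E P \<Longrightarrow> d0 E Q \<Longrightarrow> d0 E (\<lambda>e. P e \<or> Q e)"
  using d0_neg[OF d0_conj[OF d0_neg d0_neg]] by (simp add: de_Morgan_conj)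
lemma d0_imp: "d0 E P \<Longrightarrow> d0 E Q \<Longrightarrow> d0 E (\<lambda>e. P e \<longrightarrow> Q e)"
  using d0_disj[OF d0_neg] by (simp only: imp_conv_disj)
lemma d0_iff: "d0 E P \<Longrightarrow> d0 E Q \<Longrightarrow> d0 E (\<lambda>e. P e \<longleftrightarrow> Q e)"
  using d0_conj[OF d0_imp d0_imp, of E P Q Q P] by (simp only: iff_conv_conj_imp)
lemma d0_ball: "d0 E (\<lambda>e. Q (e 0) (\<lambda>n. e (Suc n))) \<Longrightarrow> d0 E (\<lambda>e. \<forall>x. E x (e j) \<longrightarrow> Q x e)"
  using d0_neg[OF d0_bex[of E "\<lambda>x e. \<not> Q x e", OF d0_neg]] by simp
lemma d0_const: "d0 E (\<lambda>e. b)"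
proof (cases b)
  case True
  have "d0 E (\<lambda>e. e 0 = e 0)" by (rule d0_eq)
  then show ?thesis using True by simp
next
  case False
  have "d0 E (\<lambda>e. \<not> e 0 = e 0)" by (intro d0_neg d0_eq)
  then show ?thesis using False by simp
qed
lemma d0_finite_ball: "finite A \<Longrightarrow> (\<And>n. n \<in> A \<Longrightarrow> d0 E (P n)) \<Longrightarrow> d0 E (\<lambda>e. \<forall>n\<in>A. P n e)"
  by (induction A rule: finite_induct) (auto intro: d0_const d0_conj)

lemmas d0_intros = d0_const d0_mem d0_eq d0_neg d0_conj d0_disj d0_imp d0_iff d0_bex d0_ball

text \<open>Relativization to a set bounds every quantifier by the variable \<open>j\<close>. The
  map \<open>f\<close> keeps track of where the environment of \<open>\<phi>\<close> is stored while
  binders shift positions.\<close>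

lemma d0_relativized: "d0 E (\<lambda>e. sat {x. E x (e j)} E (\<lambda>i. e (f i)) \<phi>)"
proof (induction \<phi> arbitrary: j f)
  case (Exists x \<phi>)
  have *: "sat {x. E x (e j)} E (\<lambda>i. e (f i)) (Exists x \<phi>) \<longleftrightarrow>
     (\<exists>a. E a (e j) \<and> sat {x. E x (e j)} E ((\<lambda>i. e (f i))(x := a)) \<phi>)" for e
    by auto
  have **: "(\<lambda>i. e (Suc (f i)))(x := e 0) = (\<lambda>i. e ((\<lambda>i. if i = x then 0 else Suc (f i)) i))" for e
      :: "nat \<Rightarrow> 'a"
    by auto
  show ?case unfolding * by (rule d0_bex) (unfold **, rule Exists.IH)
qed (auto intro: d0_intros)

section \<open>Definability with parameters\<close>

definition interleave :: "(nat \<Rightarrow> 'v) \<Rightarrow> (nat \<Rightarrow> 'v) \<Rightarrow> nat \<Rightarrow> 'v" where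
  "interleave e p n = (if even n then e (n div 2) else p (n div 2))"

lemma interleave_simps: "interleave e p (2 * n) = e n" "interleave e p (Suc (2 * n)) = p n"
  unfolding interleave_def by auto

text \<open>Variables sit at even positions and parameters at odd ones, so infinitely many of both
  are available and two parameter lists can be merged. This is definability as the schemes of
  separation and replacement admit it.\<close>

definition pdef :: "('v \<Rightarrow> 'v \<Rightarrow> bool) \<Rightarrow> ((nat \<Rightarrow> 'v) \<Rightarrow> bool) \<Rightarrow> bool" where
  "pdef E P \<longleftrightarrow> (\<exists>Q p. udef E Q \<and> (\<forall>e. P e \<longleftrightarrow> Q UNIV (interleave e p)))"

definition pterm :: "('v \<Rightarrow> 'v \<Rightarrow> bool) \<Rightarrow> ((nat \<Rightarrow> 'v) \<Rightarrow> 'v) \<Rightarrow> bool" where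
  "pterm E t \<longleftrightarrow> pdef E (\<lambda>e. e 0 = t (\<lambda>n. e (Suc n)))"

lemma pdef_sat: "pdef E P \<longleftrightarrow> (\<exists>\<phi> p. \<forall>e. P e \<longleftrightarrow> sat UNIV E (interleave e p) \<phi>)"
proof
  assume "pdef E P"
  then obtain Q p \<phi> where "\<forall>e. P e \<longleftrightarrow> Q UNIV (interleave e p)" "\<forall>D e. Q D e \<longleftrightarrow> sat D E e \<phi>"
    unfolding pdef_def udef_def by blast
  then show "\<exists>\<phi> p. \<forall>e. P e \<longleftrightarrow> sat UNIV E (interleave e p) \<phi>" by (intro exI[of _ \<phi>] exI[of _ p]) simp
next
  assume "\<exists>\<phi> p. \<forall>e. P e \<longleftrightarrow> sat UNIV E (interleave e p) \<phi>"
  then obtain \<phi> p where "\<forall>e. P e \<longleftrightarrow> sat UNIV E (interleave e p) \<phi>" by blast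
  then show "pdef E P" unfolding pdef_def udef_def
    by (intro exI[of _ "\<lambda>D e. sat D E e \<phi>"] exI[of _ p]) auto
qed

lemma pdef_udef: "udef E Q \<Longrightarrow> pdef E (Q UNIV)"
  unfolding pdef_def
  by (rule exI[of _ "\<lambda>D e. Q D (\<lambda>n. e (2 * n))"], rule exI) (auto simp: interleave_simps udef_rename)

lemma pdef_mem_vars: "pdef E (\<lambda>e. E (e i) (e j))" and pdef_eq_vars: "pdef E (\<lambda>e. e i = e j)"
  using pdef_udef[OF udef_mem, of E i j] pdef_udef[OF udef_eq, of E i j] by simp_all

lemma pdef_neg: "pdef E P \<Longrightarrow> pdef E (\<lambda>e. \<not> P e)"
  unfolding pdef_sat
proof (elim exE)
  fix \<phi> p assume "\<forall>e. P e \<longleftrightarrow> sat UNIV E (interleave e p) \<phi>"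
  then show "\<exists>\<phi> p. \<forall>e. (\<not> P e) \<longleftrightarrow> sat UNIV E (interleave e p) \<phi>"
    by (intro exI[of _ "Neg \<phi>"] exI[of _ p]) simp
qed

lemma pdef_conj:
  assumes "pdef E P" "pdef E P'" shows "pdef E (\<lambda>e. P e \<and> P' e)"
proof -
  obtain Q p Q' p' where Q: "udef E Q" "\<forall>e. P e \<longleftrightarrow> Q UNIV (interleave e p)"
    and Q': "udef E Q'" "\<forall>e. P' e \<longleftrightarrow> Q' UNIV (interleave e p')"
    using assms unfolding pdef_def by blast
  \<comment> \<open>\<open>f\<close> and \<open>g\<close> recover the first and the second parameter
    list from the interleaved list \<open>?r\<close> and fix the variables.\<close>
  define f g where "f n = (if even n then n else Suc (2 * (2 * (n div 2))))"
    and "g n = (if even n then n else Suc (2 * Suc (2 * (n div 2))))" for n :: nat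
  let ?r = "interleave p p'"
  have "(\<lambda>n. interleave e ?r (f n)) = interleave e p" "(\<lambda>n. interleave e ?r (g n)) = interleave e
      p'" for e
    by (auto simp: fun_eq_iff interleave_def f_def g_def elim!: oddE)
  then have "P e \<and> P' e \<longleftrightarrow> Q UNIV (\<lambda>n. interleave e ?r (f n)) \<and> Q' UNIV (\<lambda>n. interleave e ?r (g n))"
      for e
    using Q Q' by simp
  then show ?thesis unfolding pdef_def using udef_conj[OF udef_rename[OF Q(1)] udef_rename[OF
      Q'(1)], of f g]
    by (intro exI[of _ "\<lambda>D e. Q D (\<lambda>n. e (f n)) \<and> Q' D (\<lambda>n. e (g n))"] exI[of _ ?r]) auto
qed

lemma pdef_ex:
  assumes "pdef E (\<lambda>e. Q (e 0) (\<lambda>n. e (Suc n)))"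
  shows "pdef E (\<lambda>e. \<exists>x. Q x e)"
proof -
  obtain R p where R: "udef E R" "\<forall>e. Q (e 0) (\<lambda>n. e (Suc n)) \<longleftrightarrow> R UNIV (interleave e p)"
    using assms unfolding pdef_def by blast
  \<comment> \<open>A pushed value shifts the variables but not the parameters: position 2m + 2 of
    the new stream is position 2m of the old one, and odd positions stay. Under \<open>scons\<close>
    every old position is then raised by one.\<close>
  define f where "f n = (if n = 0 then 0 else if even n then n - 1 else Suc n)" for n :: nat
  have f: "interleave (scons x e) p n = scons x (interleave e p) (f n)" for x e n
    by (cases n) (auto simp: interleave_def f_def split: nat.split elim!: oddE)
  have "Q x e \<longleftrightarrow> R UNIV (\<lambda>n. scons x (interleave e p) (f n))" for x e
    using R(2)[rule_format, of "scons x e"] by (simp add: f[abs_def])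
  moreover have "udef E (\<lambda>D e. \<exists>x\<in>D. R D (\<lambda>n. scons x e (f n)))"
  proof (rule udef_bex)
    have "(\<lambda>n. scons (e 0) (\<lambda>n. e (Suc n)) (f n)) = (\<lambda>n. e (f n))" for e :: "nat \<Rightarrow> 'a"
      by (auto split: nat.split)
    then show "udef E (\<lambda>D e. R D (\<lambda>n. scons (e 0) (\<lambda>n. e (Suc n)) (f n)))"
      using udef_rename[OF R(1), of f] by simp
  qed
  ultimately show ?thesis unfolding pdef_def by (intro exI[of _ "\<lambda>D e. \<exists>x\<in>D. R D (\<lambda>n. scons x e (f
      n))"] exI[of _ p]) auto
qed

lemma pdef_disj: "pdef E P \<Longrightarrow> pdef E Q \<Longrightarrow> pdef E (\<lambda>e. P e \<or> Q e)"
  using pdef_neg[OF pdef_conj[OF pdef_neg pdef_neg]] by (simp add: de_Morgan_conj)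
lemma pdef_imp: "pdef E P \<Longrightarrow> pdef E Q \<Longrightarrow> pdef E (\<lambda>e. P e \<longrightarrow> Q e)"
  using pdef_disj[OF pdef_neg] by (simp only: imp_conv_disj)
lemma pdef_iff: "pdef E P \<Longrightarrow> pdef E Q \<Longrightarrow> pdef E (\<lambda>e. P e \<longleftrightarrow> Q e)"
  using pdef_conj[OF pdef_imp pdef_imp, of E P Q Q P] by (simp only: iff_conv_conj_imp)
lemma pdef_all: "pdef E (\<lambda>e. Q (e 0) (\<lambda>n. e (Suc n))) \<Longrightarrow> pdef E (\<lambda>e. \<forall>x. Q x e)"
  using pdef_neg[OF pdef_ex[of E "\<lambda>x e. \<not> Q x e", OF pdef_neg]] by simp
lemma pdef_const: "pdef E (\<lambda>e. b)"
  using pdef_udef[OF udef_const, of E b] by simp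

lemma pterm_var: "pterm E (\<lambda>e. e i)"
  unfolding pterm_def by (rule pdef_eq_vars)

lemma pterm_if: "pterm E s \<Longrightarrow> pterm E t \<Longrightarrow> pterm E (\<lambda>e. if b then s e else t e)"
  by (cases b) auto

lemma pterm_const: "pterm E (\<lambda>e. c)"
  unfolding pterm_def pdef_def
  by (rule exI[of _ "\<lambda>D e. e 0 = e 1"], rule exI[of _ "\<lambda>_. c"]) (auto simp: udef_eq interleave_def)

lemma pdef_rename:
  assumes "pdef E P" shows "pdef E (\<lambda>e. P (\<lambda>n. e (f n)))"
proof -
  obtain Q p where Q: "udef E Q" "\<forall>e. P e \<longleftrightarrow> Q UNIV (interleave e p)"
    using assms unfolding pdef_def by blast
  define g where "g n = (if even n then 2 * f (n div 2) else n)" for n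
  have "interleave (\<lambda>n. e (f n)) p = (\<lambda>n. interleave e p (g n))" for e
    by (auto simp: fun_eq_iff interleave_def g_def)
  then show ?thesis unfolding pdef_def using Q udef_rename[OF Q(1), of g]
    by (intro exI[of _ "\<lambda>D e. Q D (\<lambda>n. e (g n))"] exI[of _ p]) auto
qed

lemma pterm_shift: "pterm E t \<Longrightarrow> pterm E (\<lambda>e. t (\<lambda>n. e (Suc n)))"
  unfolding pterm_def using pdef_rename[of E "\<lambda>e. e 0 = t (\<lambda>n. e (Suc n))" "\<lambda>n. if n = 0 then 0 else
      Suc n"]
  by simp

lemma pdef_eq: "pterm E s \<Longrightarrow> pterm E t \<Longrightarrow> pdef E (\<lambda>e. s e = t e)"
  and pdef_mem: "pterm E s \<Longrightarrow> pterm E t \<Longrightarrow> pdef E (\<lambda>e. E (s e) (t e))"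
proof -
  assume s: "pterm E s" and t: "pterm E t"
  have 1: "pdef E (\<lambda>e. e 1 = s (\<lambda>n. e (Suc (Suc n))))" "pdef E (\<lambda>e. e 0 = t (\<lambda>n. e (Suc (Suc n))))"
    using pdef_rename[OF s[unfolded pterm_def], of Suc]
      pdef_rename[OF t[unfolded pterm_def], of "\<lambda>n. if n = 0 then 0 else Suc n"] by simp_all
  have "pdef E (\<lambda>e. \<exists>x. \<exists>y. (x = s e \<and> y = t e) \<and> x = y)"
    by (intro pdef_ex pdef_conj 1[unfolded One_nat_def] pdef_eq_vars)
  then show "pdef E (\<lambda>e. s e = t e)" by simp
  have "pdef E (\<lambda>e. \<exists>x. \<exists>y. (x = s e \<and> y = t e) \<and> E x y)"
    by (intro pdef_ex pdef_conj 1[unfolded One_nat_def] pdef_mem_vars)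
  then show "pdef E (\<lambda>e. E (s e) (t e))" by simp
qed

lemma pdef_sat_terms:
  assumes "\<And>i. pterm E (\<lambda>e. t i e)"
  shows "pdef E (\<lambda>e. sat UNIV E (\<lambda>i. t i e) \<phi>)"
  using assms
proof (induction \<phi> arbitrary: t)
  case (Exists x \<phi>)
  have *: "(\<lambda>i. t i (\<lambda>n. e (Suc n)))(x := e 0) = (\<lambda>i. (\<lambda>i e. if i = x then e 0 else t i (\<lambda>n. e (Suc
      n))) i e)" for e
    by auto
  have "pdef E (\<lambda>e. \<exists>a. sat UNIV E ((\<lambda>i. t i e)(x := a)) \<phi>)"
    apply (intro pdef_ex)
    apply (unfold *)
    apply (rule Exists.IH)
    apply (intro pterm_if pterm_var pterm_shift Exists.prems)
    done
  then show ?case by simp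
qed (auto intro: pdef_mem pdef_eq pdef_neg pdef_conj)

lemma pdef_subst:
  assumes P: "pdef E P" and t: "\<And>i. pterm E (\<lambda>e. t i e)"
  shows "pdef E (\<lambda>e. P (\<lambda>i. t i e))"
proof -
  obtain \<phi> p where \<phi>: "\<forall>e. P e \<longleftrightarrow> sat UNIV E (interleave e p) \<phi>" using P unfolding pdef_sat by blast
  have "pdef E (\<lambda>e. sat UNIV E (\<lambda>i. if even i then t (i div 2) e else p (i div 2)) \<phi>)"
    by (rule pdef_sat_terms) (intro pterm_if pterm_const t)
  then show ?thesis using \<phi> by (simp add: interleave_def[abs_def])
qed

lemma pdef_relativized:
  assumes "\<And>i. pterm E (\<lambda>e. t i e)" and "pterm E m"
  shows "pdef E (\<lambda>e. sat {x. E x (m e)} E (\<lambda>i. t i e) \<phi>)"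
proof -
  obtain \<psi> where \<psi>: "\<And>e. sat {x. E x (e 0)} E (\<lambda>i. e (Suc i)) \<phi> \<longleftrightarrow> sat UNIV E e \<psi>"
    using d0_relativized[of E 0 Suc \<phi>] unfolding d0_def by blast
  have "pdef E (\<lambda>e. sat UNIV E (\<lambda>i. case_nat m t i e) \<psi>)"
    by (rule pdef_sat_terms) (use assms in \<open>simp split: nat.split\<close>)
  then show ?thesis unfolding \<psi>[symmetric] by simp
qed

text \<open>The composition rules reduce definability with terms as arguments to the case of plain
  variables. Stated for terms, definability facts can be used backwards as introduction rules at any
  nesting depth.\<close>

lemma pdef_comp1: "pdef E (\<lambda>e. P (e 0)) \<Longrightarrow> pterm E s \<Longrightarrow> pdef E (\<lambda>e. P (s e))"
  using pdef_subst[of E "\<lambda>e. P (e 0)" "\<lambda>_. s"] by simp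

lemma pdef_comp2: "pdef E (\<lambda>e. P (e 0) (e (Suc 0))) \<Longrightarrow> pterm E s \<Longrightarrow> pterm E t \<Longrightarrow> pdef E (\<lambda>e. P (s e) (t
    e))"
  using pdef_subst[of E "\<lambda>e. P (e 0) (e (Suc 0))" "\<lambda>i. if i = 0 then s else t"] by simp

lemma pdef_comp3: "pdef E (\<lambda>e. P (e 0) (e (Suc 0)) (e (Suc (Suc 0)))) \<Longrightarrow> pterm E s \<Longrightarrow> pterm E t \<Longrightarrow>
    pterm E u \<Longrightarrow> pdef E (\<lambda>e. P (s e) (t e) (u e))"
  using pdef_subst[of E "\<lambda>e. P (e 0) (e (Suc 0)) (e (Suc (Suc 0)))" "\<lambda>i. if i = 0 then s else if i =
      1 then t else u"] by simp

lemma pdef_comp4: "pdef E (\<lambda>e. P (e 0) (e (Suc 0)) (e (Suc (Suc 0))) (e (Suc (Suc (Suc 0))))) \<Longrightarrow>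
    pterm E s \<Longrightarrow> pterm E t \<Longrightarrow> pterm E u \<Longrightarrow> pterm E v \<Longrightarrow> pdef E (\<lambda>e. P (s e) (t e) (u e) (v e))"
  using pdef_subst[of E "\<lambda>e. P (e 0) (e (Suc 0)) (e (Suc (Suc 0))) (e (Suc (Suc (Suc 0))))" "\<lambda>i. if
      i = 0 then s else if i = 1 then t else if i = 2 then u else v"] by simp

lemma pterm_comp1: "pterm E (\<lambda>e. F (e 0)) \<Longrightarrow> pterm E s \<Longrightarrow> pterm E (\<lambda>e. F (s e))"
  unfolding pterm_def[of E "\<lambda>e. F (e 0)"] pterm_def[of E "\<lambda>e. F (s e)"]
  by (rule pdef_comp2[of E "\<lambda>y x. y = F x"]) (auto intro: pterm_var pterm_shift)

lemma pterm_comp2: "pterm E (\<lambda>e. F (e 0) (e (Suc 0))) \<Longrightarrow> pterm E s \<Longrightarrow> pterm E t \<Longrightarrow> pterm E (\<lambda>e. F (s e)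
    (t e))"
  unfolding pterm_def[of E "\<lambda>e. F (e 0) (e (Suc 0))"] pterm_def[of E "\<lambda>e. F (s e) (t e)"]
  by (rule pdef_comp3[of E "\<lambda>y x z. y = F x z"]) (auto intro: pterm_var pterm_shift)

lemma pterm_comp3: "pterm E (\<lambda>e. F (e 0) (e (Suc 0)) (e (Suc (Suc 0)))) \<Longrightarrow> pterm E s \<Longrightarrow> pterm E t \<Longrightarrow>
    pterm E u \<Longrightarrow> pterm E (\<lambda>e. F (s e) (t e) (u e))"
  unfolding pterm_def[of E "\<lambda>e. F (e 0) (e (Suc 0)) (e (Suc (Suc 0)))"] pterm_def[of E "\<lambda>e. F (s e)
      (t e) (u e)"]
  by (rule pdef_comp4[of E "\<lambda>y x z w. y = F x z w"]) (auto intro: pterm_var pterm_shift)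

lemma pdef_ex1: "pdef E (\<lambda>e. Q (e 0) (\<lambda>n. e (Suc n))) \<Longrightarrow> pdef E (\<lambda>e. \<exists>!x. Q x e)"
proof -
  assume Q: "pdef E (\<lambda>e. Q (e 0) (\<lambda>n. e (Suc n)))"
  have "pdef E (\<lambda>e. Q (e 0) (\<lambda>n. e (Suc (Suc n))))"
    using pdef_rename[OF Q, of "\<lambda>n. if n = 0 then 0 else Suc n"] by simp
  then have "pdef E (\<lambda>e. \<exists>x. Q x e \<and> (\<forall>y. Q y e \<longrightarrow> y = x))"
    by (intro pdef_ex pdef_conj Q pdef_all pdef_imp pdef_eq_vars)
  then show ?thesis unfolding Ex1_def .
qed

section \<open>Sets in a model of ZFC\<close>

context zfc_model begin

abbreviation ext :: "'v \<Rightarrow> 'v set" where "ext a \<equiv> {x. E x a}"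

definition small :: "'v set \<Rightarrow> bool" where "small X \<longleftrightarrow> (\<exists>a. ext a = X)"

definition mk :: "'v set \<Rightarrow> 'v" where "mk X = (THE a. ext a = X)"

lemma ext_inject: "ext a = ext b \<Longrightarrow> a = b"
  using extensionality by blast

lemma mk_ext [simp]: "mk (ext a) = a"
  unfolding mk_def by (rule the_equality) (rule refl, erule ext_inject)

lemma ext_mk: "small X \<Longrightarrow> ext (mk X) = X"
  unfolding small_def by auto

lemma E_mk: "small X \<Longrightarrow> E x (mk X) \<longleftrightarrow> x \<in> X"
  using ext_mk by blast

lemma small_ext [simp]: "small (ext a)"
  unfolding small_def by blast

lemma smallE: assumes "small X" obtains a where "X = ext a"
  using assms unfolding small_def by auto

lemmas pdef_intros = pdef_const pdef_neg pdef_conj pdef_disj pdef_imp pdef_iff pdef_ex1 pdef_ex pdef_all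
  pdef_mem pdef_eq pterm_var pterm_const

lemma small_sep:
  assumes "small X" and "pdef E (\<lambda>e. P (e 0))"
  shows "small {x\<in>X. P x}"
proof -
  obtain \<phi> p where \<phi>: "\<forall>e. P (e 0) \<longleftrightarrow> sat UNIV E (interleave e p) \<phi>"
    using assms(2) unfolding pdef_sat by blast
  obtain a where a: "ext a = X" using assms(1) small_def by blast
  \<comment> \<open>The scheme varies variable 0, which under interleaving is the position of
    \<open>e 0\<close>.\<close>
  have "(interleave p p)(0 := x) = interleave (p(0 := x)) p" for x
    by (auto simp: interleave_def fun_eq_iff)
  then have "P x \<longleftrightarrow> sat UNIV E ((interleave p p)(0 := x)) \<phi>" for x
    using \<phi>[rule_format, of "p(0 := x)"] by simp
  then show ?thesis using separation[of a "interleave p p" \<phi>] a unfolding small_def by auto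
qed

lemma small_subset:
  assumes "small X" "Y \<subseteq> X" "pdef E (\<lambda>e. e 0 \<in> Y)" shows "small Y"
proof -
  have "{x\<in>X. x \<in> Y} = Y" using assms(2) by blast
  then show ?thesis using small_sep[OF assms(1), of "\<lambda>x. x \<in> Y"] assms(3) by simp
qed

lemma small_image:
  assumes "small X" and "pterm E (\<lambda>e. F (e 0))"
  shows "small (F ` X)"
proof -
  have "pdef E (\<lambda>e. e 1 = F (e 0))"
    by (intro pdef_eq pterm_var assms)
  then obtain \<phi> p where \<phi>: "\<forall>e. e 1 = F (e 0) \<longleftrightarrow> sat UNIV E (interleave e p) \<phi>"
    unfolding pdef_sat by blast
  \<comment> \<open>Replacement reserves the variables 0 and 1, but the interleaved formula has its
    two arguments at 0 and 2; all other positions are moved up by 2 to make room.\<close>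
  define f where "f n = (if n = 0 then 0 else if n = 2 then 1 else n + 2)" for n :: nat
  obtain \<psi> where \<psi>: "\<forall>D (E :: 'v \<Rightarrow> 'v \<Rightarrow> bool) e. sat D E e \<psi> \<longleftrightarrow> sat D E (\<lambda>n. e (f n)) \<phi>"
    using rename_fm by blast
  define q where "q n = interleave p p (n - 2)" for n
  have F: "sat UNIV E (q(0 := x, 1 := y)) \<psi> \<longleftrightarrow> y = F x" for x y
  proof -
    have "(\<lambda>n. (q(0 := x, 1 := y)) (f n)) = interleave (p(0 := x, 1 := y)) p"
      by (auto simp: interleave_def f_def q_def fun_eq_iff elim!: evenE)
    then show ?thesis using \<psi> \<phi>[rule_format, of "p(0 := x, 1 := y)"] by simp
  qed
  obtain a where a: "ext a = X" using assms(1) small_def by blast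
  obtain b where "\<forall>y. E y b \<longleftrightarrow> (\<exists>x. E x a \<and> y = F x)"
    using replacement[of a q \<psi>] unfolding F by auto
  then have "ext b = F ` X" using a by auto
  then show ?thesis unfolding small_def by blast
qed

lemma small_upair: "small {x, y}"
  using pairing[of x y] unfolding small_def by auto

lemma small_singleton: "small {x}"
  using small_upair[of x x] by simp

lemma small_Union:
  assumes "small X" shows "small (\<Union>(ext ` X))"
proof -
  obtain a where a: "ext a = X" using assms small_def by blast
  obtain u where "\<forall>z. E z u \<longleftrightarrow> (\<exists>y. E y a \<and> E z y)" using union by blast
  then have "ext u = \<Union>(ext ` X)" using a by auto
  then show ?thesis unfolding small_def by blast
qed

lemma small_Un: assumes "small X" "small Y" shows "small (X \<union> Y)"
proof -
  have "\<Union>(ext ` {mk X, mk Y}) = X \<union> Y" using assms by (simp add: ext_mk)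
  then show ?thesis using small_Union[OF small_upair] by metis
qed

lemma small_insert: "small X \<Longrightarrow> small (insert x X)"
  using small_Un[OF small_singleton] by simp

lemma small_Pow: "small {z. ext z \<subseteq> ext x}"
proof -
  obtain p where "\<forall>z. E z p \<longleftrightarrow> (\<forall>u. E u z \<longrightarrow> E u x)" using powerset by blast
  then have "ext p = {z. ext z \<subseteq> ext x}" by auto
  then show ?thesis unfolding small_def by blast
qed

lemma minimal:
  assumes "small X" "X \<noteq> {}" shows "\<exists>y\<in>X. \<forall>u\<in>X. \<not> E u y"
proof -
  obtain a where "ext a = X" using assms(1) small_def by blast
  then show ?thesis using foundation assms(2) by blast
qed

lemma E_irrefl: "\<not> E x x"
  using minimal[OF small_singleton] by blast

lemma E_asym: "E x y \<Longrightarrow> \<not> E y x"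
  using minimal[OF small_upair, of x y] by blast

lemma pterm_mk:
  assumes "\<And>e. small (X e)" and "pdef E (\<lambda>e. e 0 \<in> X (\<lambda>n. e (Suc n)))"
  shows "pterm E (\<lambda>e. mk (X e))"
proof -
  have eq: "y = mk (X e) \<longleftrightarrow> (\<forall>z. E z y \<longleftrightarrow> z \<in> X e)" for y e
    using E_mk[OF assms(1)] ext_inject by blast
  have "pdef E (\<lambda>e. e 0 \<in> X (\<lambda>n. e (Suc (Suc n))))"
    using pdef_rename[OF assms(2), of "\<lambda>n. if n = 0 then 0 else Suc n"] by simp
  then have "pdef E (\<lambda>e. \<forall>z. E z (e 0) \<longleftrightarrow> z \<in> X (\<lambda>n. e (Suc n)))"
    by (intro pdef_intros)
  then show ?thesis unfolding pterm_def eq .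
qed

section \<open>Pairs\<close>

definition pr :: "'v \<Rightarrow> 'v \<Rightarrow> 'v" where "pr a b = mk {mk {a}, mk {a, b}}"

lemma is_pair_iff: "is_pair E p a b \<longleftrightarrow> p = pr a b"
proof -
  have 1: "(\<forall>u. E u z \<longleftrightarrow> u = a) \<longleftrightarrow> z = mk {a}" for z
    using E_mk[OF small_singleton] ext_inject[of z "mk {a}"] by auto
  have 2: "(\<forall>u. E u z \<longleftrightarrow> u = a \<or> u = b) \<longleftrightarrow> z = mk {a, b}" for z
    using E_mk[OF small_upair] ext_inject[of z "mk {a, b}"] by auto
  have "p = pr a b \<longleftrightarrow> (\<forall>z. E z p \<longleftrightarrow> z = mk {a} \<or> z = mk {a, b})"
    using E_mk[OF small_upair] ext_inject[of p "pr a b"] unfolding pr_def by auto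
  then show ?thesis unfolding is_pair_def 1 2 by simp
qed

lemma mk_inject: "small X \<Longrightarrow> small Y \<Longrightarrow> mk X = mk Y \<longleftrightarrow> X = Y"
  using ext_mk by metis

lemma pr_inject [simp]: "pr a b = pr c d \<longleftrightarrow> a = c \<and> b = d"
  unfolding pr_def by (simp add: mk_inject small_upair small_singleton doubleton_eq_iff) blast

lemma pdef_is_pair: "pterm E s \<Longrightarrow> pterm E t \<Longrightarrow> pterm E u \<Longrightarrow> pdef E (\<lambda>e. is_pair E (s e) (t e) (u e))"
  by (rule pdef_comp3) (unfold is_pair_def, intro pdef_intros)

lemma pterm_pr: "pterm E s \<Longrightarrow> pterm E t \<Longrightarrow> pterm E (\<lambda>e. pr (s e) (t e))"
  by (rule pterm_comp2) (unfold pterm_def is_pair_iff[symmetric], intro pdef_is_pair pdef_intros)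

lemma maps_to_iff: "maps_to E f a b \<longleftrightarrow> E (pr a b) f"
  unfolding maps_to_def is_pair_iff by blast

lemma pdef_maps_to: "pterm E s \<Longrightarrow> pterm E t \<Longrightarrow> pterm E u \<Longrightarrow> pdef E (\<lambda>e. maps_to E (s e) (t e) (u e))"
  unfolding maps_to_iff by (intro pdef_intros pterm_pr)

lemma pdef_ord_le: "pterm E s \<Longrightarrow> pterm E t \<Longrightarrow> pdef E (\<lambda>e. ord_le E (s e) (t e))"
  unfolding ord_le_def by (intro pdef_intros)

text \<open>With Kuratowski pairs, a value \<open>y\<close> lies in \<open>{x, y}\<close>, which
  lies in the pair, which lies in \<open>f\<close>; two unions over \<open>f\<close> therefore
  contain the range.\<close>

lemma small_range_rel:
  assumes "\<And>y. y \<in> X \<Longrightarrow> \<exists>x. maps_to E f x y" "pdef E (\<lambda>e. e 0 \<in> X)" shows "small X"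
proof -
  have "E y (mk {x, y})" "E (mk {x, y}) (pr x y)" for x y
    unfolding pr_def by (simp_all add: E_mk small_upair)
  then have "E y (mk {x, y}) \<and> E (mk {x, y}) (pr x y) \<and> E (pr x y) f" if "maps_to E f x y" for x y
    using that maps_to_iff by simp
  then have "X \<subseteq> \<Union>(ext ` \<Union>(ext ` ext f))"
    using assms(1) by (simp add: subset_eq) meson
  moreover have "small (\<Union>(ext ` \<Union>(ext ` ext f)))" by (intro small_Union small_ext)
  ultimately show ?thesis using assms(2) by (metis small_subset)
qed

section \<open>Well-founded recursion\<close>

text \<open>Recursion by partial approximations, all of them elements of the model. Minimality is
  assumed only for small subsets of \<open>D\<close>, and \<open>G\<close> sees the set of earlier
  values rather than the restricted function, which is enough for the hierarchy and for
  collapses.\<close>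

theorem wf_recursion:
  assumes D: "small D" and R: "pdef E (\<lambda>e. R (e 0) (e (Suc 0)))" and G: "pterm E (\<lambda>e. G (e 0))"
    and wf: "\<And>s. small s \<Longrightarrow> s \<subseteq> D \<Longrightarrow> s \<noteq> {} \<Longrightarrow> \<exists>x\<in>s. \<forall>y\<in>s. \<not> R y x"
  shows "\<exists>f. (\<forall>x\<in>D. \<exists>!y. maps_to E f x y) \<and>
     (\<forall>x\<in>D. \<forall>y. maps_to E f x y \<longrightarrow> y = G (mk {u. \<exists>v\<in>D. R v x \<and> maps_to E f v u}))"
proof -
  obtain d where d: "D = ext d" using D by (rule smallE)
  define img where "img f x = {u. \<exists>v. E v d \<and> R v x \<and> maps_to E f v u}" for f x
  have pR: "pterm E s \<Longrightarrow> pterm E t \<Longrightarrow> pdef E (\<lambda>e. R (s e) (t e))" for s t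
    by (rule pdef_comp2[OF R])
  have small_img: "small (img f x)" for f x
    by (rule small_range_rel[where f = f]) (auto simp: img_def intro!: pdef_intros pR pdef_maps_to)
  have pimg: "pterm E s \<Longrightarrow> pterm E t \<Longrightarrow> pterm E (\<lambda>e. mk (img (s e) (t e)))" for s t
    by (rule pterm_comp2, rule pterm_mk[OF small_img])
      (unfold img_def mem_Collect_eq, intro pdef_intros pR pdef_maps_to)
  \<comment> \<open>An approximation has a domain inside \<open>d\<close> that is closed under
    \<open>R\<close>-predecessors, and it obeys the recursion there. Uniqueness of values is not
    demanded; it follows from the equation.\<close>
  define app where "app f \<longleftrightarrow> (\<forall>x y. maps_to E f x y \<longrightarrow> E x d \<and> (\<forall>v. E v d \<and> R v x \<longrightarrow> (\<exists>u. maps_to E f v u))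
     \<and> y = G (mk (img f x)))" for f
  have pG: "pterm E s \<Longrightarrow> pterm E (\<lambda>e. G (s e))" for s by (rule pterm_comp1[OF G])
  have papp: "pterm E s \<Longrightarrow> pdef E (\<lambda>e. app (s e))" for s
    by (rule pdef_comp1) (unfold app_def, intro pdef_intros pR pG pimg pdef_maps_to)
  have appD: "E x d" "\<And>v. E v d \<Longrightarrow> R v x \<Longrightarrow> \<exists>u. maps_to E f v u" "y = G (mk (img f x))"
    if "app f" "maps_to E f x y" for f x y
    using that unfolding app_def by blast+
  have wf': "\<exists>x\<in>s. \<forall>y\<in>s. \<not> R y x" if "s \<subseteq> ext d" "s \<noteq> {}" "pdef E (\<lambda>e. e 0 \<in> s)" for s
    using wf small_subset[OF _ that(1,3)] that d by simp
  have uniq: "y = z" if fg: "app f" "app g" and yz: "maps_to E f x y" "maps_to E g x z" for f g x y z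
  proof (rule ccontr)
    assume "y \<noteq> z"
    let ?s = "{x. \<exists>y z. maps_to E f x y \<and> maps_to E g x z \<and> y \<noteq> z}"
    have "pdef E (\<lambda>e. e 0 \<in> ?s)" unfolding mem_Collect_eq by (intro pdef_intros pdef_maps_to)
    moreover have "?s \<subseteq> ext d" using appD(1)[OF fg(1)] by auto
    moreover have "?s \<noteq> {}" using yz \<open>y \<noteq> z\<close> by blast
    ultimately have "\<exists>x\<in>?s. \<forall>v\<in>?s. \<not> R v x" by (intro wf')
    then obtain x where "x \<in> ?s" and min: "\<forall>v\<in>?s. \<not> R v x" by (rule bexE)
    then obtain y z where *: "maps_to E f x y" "maps_to E g x z" "y \<noteq> z" by blast
    have "maps_to E f v u \<longleftrightarrow> maps_to E g v u" if v: "E v d" "R v x" for v u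
    proof -
      obtain a b where "maps_to E f v a" "maps_to E g v b"
        using appD(2)[OF fg(1) *(1) v] appD(2)[OF fg(2) *(2) v] by blast
      moreover have "v \<notin> ?s" using min v by blast
      ultimately show ?thesis by blast
    qed
    then have "img f x = img g x" unfolding img_def by blast
    then show False using appD(3)[OF fg(1) *(1)] appD(3)[OF fg(2) *(2)] *(3) by simp
  qed
  define good where "good = {x. E x d \<and> (\<exists>f y. app f \<and> maps_to E f x y)}"
  define F where "F x = (THE y. \<exists>f. app f \<and> maps_to E f x y)" for x
  have F: "F x = y" if "app f" "maps_to E f x y" for f x y
    unfolding F_def using that uniq by (intro the_equality) blast+
  have small_good: "small good"
    by (rule small_subset[of "ext d"]) (auto simp: good_def intro!: pdef_intros papp pdef_maps_to)
  then obtain gd where gd: "good = ext gd" by (rule smallE)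
  have gd_iff: "E x gd \<longleftrightarrow> x \<in> good" for x using gd by auto
  define H where "H = (\<lambda>x. pr x (F x)) ` good"
  have H: "pr x y \<in> H \<longleftrightarrow> x \<in> good \<and> y = F x" for x y
    unfolding H_def by auto
  have small_H: "small H"
  proof -
    \<comment> \<open>\<open>F\<close> is meaningful on \<open>good\<close> only; the identity
      elsewhere makes a total map with definable graph, as \<open>small_image\<close>
      requires.\<close>
    define F' where "F' x = (if x \<in> good then pr x (F x) else x)" for x
    have F': "y = F' x \<longleftrightarrow> (E x gd \<and> (\<exists>f z. app f \<and> maps_to E f x z \<and> y = pr x z)) \<or> (\<not> E x gd \<and> y =
        x)" for x y
    proof (cases "x \<in> good")
      case True
      then obtain f z where f: "app f" "maps_to E f x z" unfolding good_def by blast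
      then have "(\<exists>f z. app f \<and> maps_to E f x z \<and> y = pr x z) \<longleftrightarrow> y = pr x (F x)" using F by metis
      then show ?thesis using True unfolding F'_def gd_iff by simp
    qed (simp add: F'_def gd_iff)
    have "pterm E (\<lambda>e. F' (e 0))"
      unfolding pterm_def F' by (intro pdef_intros papp pdef_maps_to pterm_pr)
    then have "small (F' ` good)" using small_image[OF small_good] by blast
    moreover have "F' ` good = H" unfolding F'_def H_def by (rule image_cong) simp_all
    ultimately show ?thesis by simp
  qed
  define h where "h = mk H"
  have h: "maps_to E h x y \<longleftrightarrow> x \<in> good \<and> y = F x" for x y
    unfolding h_def maps_to_iff using E_mk[OF small_H] H by blast
  have closed: "v \<in> good" if x: "x \<in> good" and v: "E v d" "R v x" for v x
  proof -
    obtain f y where "app f" "maps_to E f x y" using x unfolding good_def by blast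
    from appD(2)[OF this v] \<open>app f\<close> v show ?thesis unfolding good_def by blast
  qed
  have Feq: "F x = G (mk (img h x))" if x: "x \<in> good" for x
  proof -
    obtain f y where f: "app f" "maps_to E f x y" using x unfolding good_def by blast
    have "maps_to E f v u \<longleftrightarrow> maps_to E h v u" if v: "E v d" "R v x" for v u
      using appD(2)[OF f v] closed[OF x v] F[OF f(1), of v] h by auto
    then have "img f x = img h x" unfolding img_def by blast
    then show ?thesis using appD(3)[OF f] F[OF f] by simp
  qed
  have goodd: "E x d" if "x \<in> good" for x using that unfolding good_def by blast
  have app_h: "app h" unfolding app_def h
  proof (intro allI impI conjI; elim conjE)
    show "E x d" if "x \<in> good" for x using goodd[OF that] .
    show "\<exists>u. v \<in> good \<and> u = F v" if "x \<in> good" "E v d" "R v x" for x v using closed[OF that] by blast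
    show "y = G (mk (img h x))" if "x \<in> good" "y = F x" for x y using Feq[OF that(1)] that(2) by simp
  qed
  have "good = D"
  proof (rule ccontr)
    assume "good \<noteq> D"
    then have "ext d - good \<noteq> {}" using d goodd by blast
    moreover have "pdef E (\<lambda>e. e 0 \<in> ext d - good)" unfolding gd Diff_iff mem_Collect_eq by (intro
        pdef_intros)
    \<comment> \<open>A minimal point outside \<open>good\<close> has all its predecessors in
      \<open>good\<close>, so \<open>h\<close> can be extended by one pair. No point of
      \<open>good\<close> has \<open>x\<close> as a predecessor, hence the extension leaves the old
      images unchanged.\<close>
    ultimately obtain x where x: "x \<in> ext d - good" and min: "\<forall>v\<in>ext d - good. \<not> R v x"
      using wf'[of "ext d - good"] by (meson Diff_subset)
    define h' where "h' = mk (insert (pr x (G (mk (img h x)))) H)"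
    have h': "maps_to E h' v y \<longleftrightarrow> maps_to E h v y \<or> (v = x \<and> y = G (mk (img h x)))" for v y
      unfolding h'_def h_def maps_to_iff using E_mk[OF small_H] E_mk[OF small_insert[OF small_H]] by
          auto
    have nRx: "\<not> R x v" if "v \<in> good" for v using closed[OF that, of x] x by blast
    have "\<not> R x x" using min x by blast
    then have "img h' x = img h x" unfolding img_def h' by blast
    moreover have "img h' v = img h v" if "v \<in> good" for v
      unfolding img_def h' using nRx[OF that] by blast
    moreover have "\<exists>u. maps_to E h v u" if "E v d" "R v x" for v
      using min that h by blast
    ultimately have *: "img h' x = img h x" "\<And>v. v \<in> good \<Longrightarrow> img h' v = img h v"
      "\<And>v. E v d \<Longrightarrow> R v x \<Longrightarrow> v \<in> good" by (auto simp: h)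
    have "app h'" unfolding app_def h' h
    proof (intro allI impI conjI; elim disjE conjE)
      show "E v d" if "v \<in> good" for v using goodd[OF that] .
      show "E v d" if "v = x" for v using x that by simp
      show "\<exists>u. v \<in> good \<and> u = F v \<or> v = x \<and> u = G (mk (img h x))"
        if "w \<in> good" "E v d" "R v w" for w v using closed[OF that] by blast
      show "\<exists>u. v \<in> good \<and> u = F v \<or> v = x \<and> u = G (mk (img h x))"
        if "w = x" "E v d" "R v w" for w v using *(3) that by blast
      show "y = G (mk (img h' v))" if "v \<in> good" "y = F v" for v y using Feq[OF that(1)] that *(2)
          by simp
      show "y = G (mk (img h' v))" if "v = x" "y = G (mk (img h x))" for v y using that *(1) by simp
    qed
    then have "x \<in> good" using h' x good_def by blast
    then show False using x by blast
  qed
  then have img: "{u. \<exists>v\<in>D. R v x \<and> maps_to E h v u} = img h x" for x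
    unfolding img_def d by auto
  show ?thesis
  proof (intro exI[of _ h] conjI ballI allI impI)
    show "\<exists>!y. maps_to E h x y" if "x \<in> D" for x using h that \<open>good = D\<close> by simp
    show "y = G (mk {u. \<exists>v\<in>D. R v x \<and> maps_to E h v u})" if "x \<in> D" "maps_to E h x y" for x y
      using that Feq[of x] h[of x y] unfolding img by simp
  qed
qed


section \<open>Ordinals\<close>

lemma pdef_transitive: "pterm E s \<Longrightarrow> pdef E (\<lambda>e. transitive E (s e))"
  by (rule pdef_comp1) (unfold transitive_def, intro pdef_intros)

lemma pdef_Ord: "pterm E s \<Longrightarrow> pdef E (\<lambda>e. Ord E (s e))"
  by (rule pdef_comp1) (unfold Ord_def, intro pdef_intros pdef_transitive)

lemma Ord_trans: "Ord E \<alpha> \<Longrightarrow> E \<beta> \<alpha> \<Longrightarrow> E \<gamma> \<beta> \<Longrightarrow> E \<gamma> \<alpha>"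
  unfolding Ord_def transitive_def by blast

lemma Ord_elem: "Ord E \<alpha> \<Longrightarrow> E \<beta> \<alpha> \<Longrightarrow> Ord E \<beta>"
  unfolding Ord_def transitive_def by blast

lemma OrdI: "(\<And>x y. E x \<alpha> \<Longrightarrow> E y x \<Longrightarrow> E y \<alpha>) \<Longrightarrow> (\<And>x. E x \<alpha> \<Longrightarrow> Ord E x) \<Longrightarrow> Ord E \<alpha>"
  unfolding Ord_def transitive_def by blast

text \<open>Foundation yields a least counterexample only inside a set, which separation cuts out of
  \<alpha> + 1 by a formula; hence the definability hypothesis.\<close>

lemma Ord_induct:
  assumes P: "pdef E (\<lambda>e. P (e 0))" and step: "\<And>\<alpha>. Ord E \<alpha> \<Longrightarrow> (\<And>\<beta>. E \<beta> \<alpha> \<Longrightarrow> P \<beta>) \<Longrightarrow> P \<alpha>"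
    and \<alpha>: "Ord E \<alpha>"
  shows "P \<alpha>"
proof (rule ccontr)
  assume "\<not> P \<alpha>"
  let ?X = "{\<beta>\<in>insert \<alpha> (ext \<alpha>). \<not> P \<beta>}"
  have "small ?X" by (intro small_sep small_insert small_ext pdef_neg P)
  moreover have "?X \<noteq> {}" using \<open>\<not> P \<alpha>\<close> by blast
  ultimately have "\<exists>\<beta>\<in>?X. \<forall>u\<in>?X. \<not> E u \<beta>" by (rule minimal)
  then obtain \<beta> where \<beta>: "\<beta> \<in> ?X" and min: "\<forall>u\<in>?X. \<not> E u \<beta>" by (rule bexE)
  have "Ord E \<beta>" using \<beta> \<alpha> Ord_elem by auto
  moreover have "P \<gamma>" if "E \<gamma> \<beta>" for \<gamma> using min \<beta> that Ord_trans[OF \<alpha>] by auto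
  ultimately have "P \<beta>" by (rule step)
  then show False using \<beta> by blast
qed

text \<open>Induction on \<alpha> for all \<beta>, with an inner induction on \<beta>: two
  incomparable ordinals would have the same elements.\<close>

lemma Ord_linear:
  assumes "Ord E \<alpha>" "Ord E \<beta>" shows "E \<alpha> \<beta> \<or> \<alpha> = \<beta> \<or> E \<beta> \<alpha>"
proof -
  have "\<forall>\<beta>. Ord E \<beta> \<longrightarrow> E \<alpha> \<beta> \<or> \<alpha> = \<beta> \<or> E \<beta> \<alpha>"
  proof (rule Ord_induct[OF _ _ assms(1)], intro pdef_intros pdef_Ord, intro allI impI)
    fix \<alpha> \<beta> assume \<alpha>: "Ord E \<alpha>" and IH: "\<And>\<gamma>. E \<gamma> \<alpha> \<Longrightarrow> \<forall>\<beta>. Ord E \<beta> \<longrightarrow> E \<gamma> \<beta> \<or> \<gamma> = \<beta> \<or> E \<beta> \<gamma>"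
      and \<beta>: "Ord E \<beta>"
    show "E \<alpha> \<beta> \<or> \<alpha> = \<beta> \<or> E \<beta> \<alpha>"
    proof (rule Ord_induct[OF _ _ \<beta>], intro pdef_intros)
      fix \<beta> assume \<beta>: "Ord E \<beta>" and IH2: "\<And>\<gamma>. E \<gamma> \<beta> \<Longrightarrow> E \<alpha> \<gamma> \<or> \<alpha> = \<gamma> \<or> E \<gamma> \<alpha>"
      show "E \<alpha> \<beta> \<or> \<alpha> = \<beta> \<or> E \<beta> \<alpha>"
      proof (rule ccontr)
        assume n: "\<not> (E \<alpha> \<beta> \<or> \<alpha> = \<beta> \<or> E \<beta> \<alpha>)"
        have "E \<gamma> \<alpha>" if "E \<gamma> \<beta>" for \<gamma> using IH2[OF that] n that Ord_trans[OF \<beta>] by blast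
        moreover have "E \<gamma> \<beta>" if "E \<gamma> \<alpha>" for \<gamma> using IH[OF that] \<beta> n that Ord_trans[OF \<alpha>] by blast
        ultimately show False using n extensionality[of \<alpha> \<beta>] by blast
      qed
    qed
  qed
  then show ?thesis using assms(2) by blast
qed

lemma ord_le_cases: "Ord E \<alpha> \<Longrightarrow> Ord E \<beta> \<Longrightarrow> ord_le E \<alpha> \<beta> \<or> E \<beta> \<alpha>"
  using Ord_linear unfolding ord_le_def by blast

lemma ord_le_refl: "ord_le E \<alpha> \<alpha>"
  unfolding ord_le_def by blast

lemma ord_le_trans: "Ord E \<gamma> \<Longrightarrow> ord_le E \<alpha> \<beta> \<Longrightarrow> ord_le E \<beta> \<gamma> \<Longrightarrow> ord_le E \<alpha> \<gamma>"
  unfolding ord_le_def using Ord_trans by blast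

lemma ord_le_less_trans: "Ord E \<gamma> \<Longrightarrow> ord_le E \<alpha> \<beta> \<Longrightarrow> E \<beta> \<gamma> \<Longrightarrow> E \<alpha> \<gamma>"
  unfolding ord_le_def using Ord_trans by blast

lemma less_ord_le_trans: "Ord E \<gamma> \<Longrightarrow> E \<alpha> \<beta> \<Longrightarrow> ord_le E \<beta> \<gamma> \<Longrightarrow> E \<alpha> \<gamma>"
  unfolding ord_le_def using Ord_trans by blast

lemma not_less_ord_le: "E \<beta> \<alpha> \<Longrightarrow> \<not> ord_le E \<alpha> \<beta>"
  unfolding ord_le_def using E_irrefl E_asym by blast

lemma ord_le_Ord: "Ord E \<alpha> \<Longrightarrow> ord_le E \<beta> \<alpha> \<Longrightarrow> Ord E \<beta>"
  unfolding ord_le_def using Ord_elem by blast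

lemma ord_le_antisym: "ord_le E \<alpha> \<beta> \<Longrightarrow> ord_le E \<beta> \<alpha> \<Longrightarrow> \<alpha> = \<beta>"
  unfolding ord_le_def using E_asym by blast

definition succ :: "'v \<Rightarrow> 'v" where "succ \<alpha> = mk (insert \<alpha> (ext \<alpha>))"

lemma E_succ: "E x (succ \<alpha>) \<longleftrightarrow> ord_le E x \<alpha>"
  unfolding succ_def ord_le_def using E_mk[OF small_insert[OF small_ext]] by auto

lemma pterm_succ: "pterm E s \<Longrightarrow> pterm E (\<lambda>e. succ (s e))"
  by (rule pterm_comp1) (unfold succ_def insert_iff mem_Collect_eq,
      intro pterm_mk small_insert small_ext, unfold insert_iff mem_Collect_eq, intro pdef_intros)

lemma Ord_succ: "Ord E \<alpha> \<Longrightarrow> Ord E (succ \<alpha>)"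
  by (rule OrdI) (auto simp: E_succ ord_le_def intro: Ord_elem Ord_trans)

lemma less_succ: "E \<alpha> (succ \<alpha>)"
  unfolding E_succ by (rule ord_le_refl)

lemma succ_le: "Ord E \<beta> \<Longrightarrow> E \<alpha> \<beta> \<Longrightarrow> ord_le E (succ \<alpha>) \<beta>"
  using ord_le_cases[of "succ \<alpha>" \<beta>] Ord_succ Ord_elem not_less_ord_le unfolding E_succ by blast

lemma succ_inject:
  assumes "succ \<alpha> = succ \<beta>" shows "\<alpha> = \<beta>"
  using less_succ[of \<alpha>] less_succ[of \<beta>] unfolding assms unfolding assms[symmetric]
  using assms E_succ ord_le_antisym by metis

lemma Ord_Union:
  assumes "small X" "\<And>\<alpha>. \<alpha> \<in> X \<Longrightarrow> Ord E \<alpha>" shows "Ord E (mk (\<Union>(ext ` X)))"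
proof (rule OrdI)
  note * = E_mk[OF small_Union[OF assms(1)]]
  show "Ord E x" if "E x (mk (\<Union>(ext ` X)))" for x
    using that assms(2) Ord_elem unfolding * by auto
  show "E y (mk (\<Union>(ext ` X)))" if x: "E x (mk (\<Union>(ext ` X)))" and "E y x" for x y
  proof -
    obtain \<alpha> where "\<alpha> \<in> X" "E x \<alpha>" using x unfolding * by blast
    then have "E y \<alpha>" using Ord_trans[OF assms(2)] \<open>E y x\<close> by blast
    then show ?thesis unfolding * using \<open>\<alpha> \<in> X\<close> by blast
  qed
qed

lemma Ord_bound:
  assumes "small X" "\<And>\<alpha>. \<alpha> \<in> X \<Longrightarrow> Ord E \<alpha>" obtains \<beta> where "Ord E \<beta>" "\<And>\<alpha>. \<alpha> \<in> X \<Longrightarrow> E \<alpha> \<beta>"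
proof
  let ?s = "mk (\<Union>(ext ` X))"
  show "Ord E (succ ?s)" using Ord_succ[OF Ord_Union[OF assms]] .
  fix \<alpha> assume \<alpha>: "\<alpha> \<in> X"
  show "E \<alpha> (succ ?s)" unfolding E_succ
  proof (rule ccontr)
    assume "\<not> ord_le E \<alpha> ?s"
    then have "E ?s \<alpha>" using ord_le_cases[OF assms(2)[OF \<alpha>] Ord_Union[OF assms]] by blast
    then have "E ?s ?s" using \<alpha> E_mk[OF small_Union[OF assms(1)], of ?s] by blast
    then show False using E_irrefl by blast
  qed
qed

definition limit :: "'v \<Rightarrow> bool" where
  "limit \<kappa> \<longleftrightarrow> Ord E \<kappa> \<and> (\<exists>x. E x \<kappa>) \<and> (\<forall>x. E x \<kappa> \<longrightarrow> E (succ x) \<kappa>)"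

lemma exists_limit: "\<exists>\<kappa>. limit \<kappa>"
proof -
  obtain w z where z: "E z w" "\<And>u. \<not> E u z"
    and w: "\<And>x. E x w \<Longrightarrow> \<exists>s. E s w \<and> (\<forall>u. E u s \<longleftrightarrow> E u x \<or> u = x)"
    using infinity by blast
  \<comment> \<open>The inductive set \<open>w\<close> may have elements that are no ordinals and
    may have gaps; the ordinals in \<open>w\<close> below which there is no gap form an initial
    segment closed under \<open>succ\<close>.\<close>
  let ?O = "{\<alpha>\<in>ext w. Ord E \<alpha> \<and> (\<forall>\<beta>. E \<beta> \<alpha> \<longrightarrow> E \<beta> w)}"
  have small_O: "small ?O" by (intro small_sep small_ext pdef_intros pdef_Ord)
  have O: "E x (mk ?O) \<longleftrightarrow> E x w \<and> Ord E x \<and> (\<forall>\<beta>. E \<beta> x \<longrightarrow> E \<beta> w)" for x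
    using E_mk[OF small_O] by simp
  have "Ord E (mk ?O)"
  proof (rule OrdI)
    show "Ord E x" if "E x (mk ?O)" for x using that O by blast
    show "E y (mk ?O)" if "E x (mk ?O)" "E y x" for x y using that Ord_elem Ord_trans unfolding O by
        blast
  qed
  moreover have "Ord E z" by (rule OrdI) (use z in auto)
  then have "E z (mk ?O)" unfolding O using z by blast
  moreover have "E (succ x) (mk ?O)" if x: "E x (mk ?O)" for x
  proof -
    obtain s where s: "E s w" "\<forall>u. E u s \<longleftrightarrow> E u x \<or> u = x" using w x O by blast
    have "s = succ x" by (rule extensionality) (use s E_succ in \<open>auto simp: ord_le_def\<close>)
    then show ?thesis using x s Ord_succ unfolding O by blast
  qed
  ultimately have "limit (mk ?O)" unfolding limit_def by blast
  then show ?thesis ..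
qed

text \<open>The set is the union of a chain of length \<open>\<omega>\<close> starting with \<open>x\<close>.\<close>

lemma closing_off:
  assumes \<Phi>: "pterm E (\<lambda>e. \<Phi> (e 0))"
  shows "\<exists>A. (\<forall>a. E a x \<longrightarrow> E a A) \<and>
    (\<forall>a b. E a A \<longrightarrow> E b A \<longrightarrow> (\<exists>u. E a u \<and> E b u \<and> (\<forall>z. E z u \<or> E z (\<Phi> u) \<longrightarrow> E z A)))"
proof -
  obtain \<kappa> where lim: "limit \<kappa>" using exists_limit by blast
  have p\<Phi>: "pterm E s \<Longrightarrow> pterm E (\<lambda>e. \<Phi> (s e))" for s by (rule pterm_comp1[OF \<Phi>])
  \<comment> \<open>\<open>s\<close> will be the set of earlier stages, so a stage collects the
    elements of \<open>x\<close>, of every earlier \<open>u\<close> and of every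
    \<open>\<Phi> u\<close>.\<close>
  define S where "S s = {z. E z x \<or> (\<exists>u. E u s \<and> (E z u \<or> E z (\<Phi> u)))}" for s
  define G where "G s = mk (S s)" for s
  have small_S: "small (S s)" for s
  proof -
    have "small (ext x \<union> (\<Union>(ext ` ext s) \<union> \<Union>(ext ` \<Phi> ` ext s)))"
      by (intro small_Un small_Union small_ext small_image \<Phi>)
    moreover have "ext x \<union> (\<Union>(ext ` ext s) \<union> \<Union>(ext ` \<Phi> ` ext s)) = S s"
      unfolding S_def by (intro set_eqI) auto
    ultimately show ?thesis by simp
  qed
  have pG: "pterm E (\<lambda>e. G (e 0))"
    unfolding G_def by (intro pterm_mk small_S) (unfold S_def mem_Collect_eq, intro pdef_intros p\<Phi>)
  have wf: "\<exists>x\<in>s. \<forall>y\<in>s. \<not> E y x" if "small s" "s \<subseteq> ext \<kappa>" "s \<noteq> {}" for s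
    using minimal that by simp
  obtain f where f: "(\<forall>n\<in>ext \<kappa>. \<exists>!y. maps_to E f n y) \<and>
      (\<forall>n\<in>ext \<kappa>. \<forall>y. maps_to E f n y \<longrightarrow> y = G (mk {u. \<exists>v\<in>ext \<kappa>. E v n \<and> maps_to E f v u}))"
    using wf_recursion[of "ext \<kappa>" "\<lambda>x y. E x y" G, OF small_ext pdef_mem_vars pG wf] by (rule exE)
  have f1: "\<exists>!y. maps_to E f n y" if "E n \<kappa>" for n using f that by simp
  have f2: "y = G (mk {u. \<exists>v\<in>ext \<kappa>. E v n \<and> maps_to E f v u})" if "E n \<kappa>" "maps_to E f n y" for n y
    using f that by simp
  have E_val: "E z y \<longleftrightarrow> E z x \<or> (\<exists>v u. E v n \<and> maps_to E f v u \<and> (E z u \<or> E z (\<Phi> u)))"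
    if n: "E n \<kappa>" "maps_to E f n y" for n y z
  proof -
    have "small {u. \<exists>v\<in>ext \<kappa>. E v n \<and> maps_to E f v u}"
      by (rule small_range_rel[where f = f]) (auto simp: Bex_def intro!: pdef_intros pdef_maps_to)
    note * = E_mk[OF this]
    have EG: "E z (G s) \<longleftrightarrow> E z x \<or> (\<exists>u. E u s \<and> (E z u \<or> E z (\<Phi> u)))" for s
      using E_mk[OF small_S, of z s] by (simp add: G_def S_def)
    have "E z y \<longleftrightarrow> E z x \<or> (\<exists>u. (\<exists>v\<in>ext \<kappa>. E v n \<and> maps_to E f v u) \<and> (E z u \<or> E z (\<Phi> u)))"
      unfolding f2[OF n] EG * mem_Collect_eq ..
    moreover have "E v \<kappa>" if "E v n" for v using Ord_trans[OF _ n(1) that] lim unfolding limit_def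
        by blast
    ultimately show ?thesis by auto
  qed
  have small_A: "small (\<Union>(ext ` {u. \<exists>n. E n \<kappa> \<and> maps_to E f n u}))"
    by (rule small_Union, rule small_range_rel[where f = f]) (auto intro!: pdef_intros pdef_maps_to)
  define A where "A = mk (\<Union>(ext ` {u. \<exists>n. E n \<kappa> \<and> maps_to E f n u}))"
  have A: "E z A \<longleftrightarrow> (\<exists>n u. E n \<kappa> \<and> maps_to E f n u \<and> E z u)" for z
    unfolding A_def using E_mk[OF small_A] by auto
  show ?thesis
  proof (rule exI[of _ A], intro conjI allI impI)
    obtain n where "E n \<kappa>" using lim unfolding limit_def by blast
    moreover obtain u where "maps_to E f n u" using f1[OF \<open>E n \<kappa>\<close>] by blast
    ultimately show "E a A" if "E a x" for a using that E_val[of n u a] unfolding A by blast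
    fix a b assume "E a A" "E b A"
    then obtain n u m v where n: "E n \<kappa>" "maps_to E f n u" "E a u" and m: "E m \<kappa>" "maps_to E f m v"
        "E b v"
      unfolding A by blast
    have grow: "E z v" if "ord_le E n m" "E n \<kappa>" "E m \<kappa>" "maps_to E f n u" "maps_to E f m v" "E z u"
        for n m u v z
    proof (cases "n = m")
      case True
      then show ?thesis using that f1[of m] by blast
    next
      case False
      then show ?thesis using that E_val[of m v z] unfolding ord_le_def by blast
    qed
    obtain k w where k: "E k \<kappa>" "maps_to E f k w" "E a w" "E b w"
    proof (cases "ord_le E n m")
      case True
      then show ?thesis using that[of m v] grow[of n m u v a] n m by blast
    next
      case False
      have "Ord E n" "Ord E m" using n(1) m(1) lim Ord_elem unfolding limit_def by blast+
      then have "ord_le E m n" using False ord_le_cases[of n m] unfolding ord_le_def by blast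
      then show ?thesis using that[of n u] grow[of m n v u b] n m by blast
    qed
    \<comment> \<open>Both elements lie in the stage \<open>w\<close> at \<open>k\<close>; the stage
      after it absorbs \<open>w\<close> and \<open>\<Phi> w\<close>, which is why a limit length
      suffices.\<close>
    have sk: "E (succ k) \<kappa>" using lim k(1) unfolding limit_def by blast
    then obtain y where y: "maps_to E f (succ k) y" using f1 by blast
    have "E z A" if "E z w \<or> E z (\<Phi> w)" for z
    proof -
      have "E z y" using E_val[OF sk y, of z] that k(2) less_succ[of k] by blast
      then show ?thesis using sk y unfolding A by blast
    qed
    then show "\<exists>u. E a u \<and> E b u \<and> (\<forall>z. E z u \<or> E z (\<Phi> u) \<longrightarrow> E z A)" using k by blast
  qed
qed

lemma transitive_superset:
  obtains t where "E x t" "transitive E t"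
proof -
  have "pterm E (\<lambda>e. mk (\<Union>(ext ` ext (e 0))))"
    by (intro pterm_mk small_Union small_ext) (auto simp: Bex_def intro!: pdef_intros)
  from closing_off[OF this, of "mk {x}"]
  obtain A where A: "(\<forall>a. E a (mk {x}) \<longrightarrow> E a A) \<and>
    (\<forall>a b. E a A \<longrightarrow> E b A \<longrightarrow> (\<exists>u. E a u \<and> E b u \<and> (\<forall>z. E z u \<or> E z (mk (\<Union>(ext ` ext u))) \<longrightarrow> E z A)))"
    by (rule exE)
  note A = A[THEN conjunct1, rule_format] A[THEN conjunct2, rule_format]
  have U: "E z (mk (\<Union>(ext ` ext u))) \<longleftrightarrow> (\<exists>y. E y u \<and> E z y)" for z u
    using E_mk[OF small_Union[OF small_ext]] by auto
  have "E x A" using A(1) E_mk[OF small_singleton] by blast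
  moreover have "transitive E A" unfolding transitive_def using A(2) U by blast
  ultimately show ?thesis by (rule that)
qed

definition pair_closed :: "'v \<Rightarrow> bool" where
  "pair_closed W \<longleftrightarrow> (\<forall>a b. E a W \<and> E b W \<longrightarrow> E (pr a b) W)"

lemma small_pairs: "small {p. \<exists>a b. E a u \<and> E b u \<and> p = pr a b}"
proof -
  have Pow: "E z (mk {z. ext z \<subseteq> ext y}) \<longleftrightarrow> (\<forall>v. E v z \<longrightarrow> E v y)" for z y
    using E_mk[OF small_Pow, of z y] by auto
  define Q where "Q = mk {z. ext z \<subseteq> ext u}"
  have "E (pr a b) (mk {z. ext z \<subseteq> ext Q})" if "E a u" "E b u" for a b
  proof -
    have "E (mk {a}) Q" "E (mk {a, b}) Q" unfolding Q_def Pow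
      using that by (auto simp: E_mk[OF small_upair] E_mk[OF small_singleton])
    then show ?thesis unfolding Pow pr_def using E_mk[OF small_upair] by auto
  qed
  then have "{p. \<exists>a b. E a u \<and> E b u \<and> p = pr a b} \<subseteq> ext (mk {z. ext z \<subseteq> ext Q})" by auto
  then show ?thesis
    by (rule small_subset[OF small_ext]) (unfold mem_Collect_eq, intro pdef_intros pterm_pr)
qed

text \<open>Pairs are the reason why \<open>closing_off\<close> supplies one \<open>u\<close> for
  two elements: \<open>a\<close> and \<open>b\<close> have to lie in a common stage before
  \<open>pr a b\<close> is added.\<close>

lemma pair_closed_superset:
  obtains W where "E x W" "\<And>a. E a w \<Longrightarrow> E a W" "transitive E W" "pair_closed W"
proof -
  define S where "S u = {z. (\<exists>y. E y u \<and> E z y) \<or> (\<exists>a b. E a u \<and> E b u \<and> z = pr a b)}" for u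
  have small_S: "small (S u)" for u
  proof -
    have "small (\<Union>(ext ` ext u) \<union> {p. \<exists>a b. E a u \<and> E b u \<and> p = pr a b})"
      by (intro small_Un small_Union small_ext small_pairs)
    moreover have "\<Union>(ext ` ext u) \<union> {p. \<exists>a b. E a u \<and> E b u \<and> p = pr a b} = S u"
      unfolding S_def by (intro set_eqI) auto
    ultimately show ?thesis by simp
  qed
  have "pterm E (\<lambda>e. mk (S (e 0)))"
    by (intro pterm_mk small_S) (unfold S_def mem_Collect_eq, intro pdef_intros pterm_pr)
  from closing_off[OF this, of "mk (insert x (ext w))"]
  obtain A where A: "(\<forall>a. E a (mk (insert x (ext w))) \<longrightarrow> E a A) \<and>
    (\<forall>a b. E a A \<longrightarrow> E b A \<longrightarrow> (\<exists>u. E a u \<and> E b u \<and> (\<forall>z. E z u \<or> E z (mk (S u)) \<longrightarrow> E z A)))"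
    by (rule exE)
  note A = A[THEN conjunct1, rule_format] A[THEN conjunct2, rule_format]
  have U: "E z (mk (S u)) \<longleftrightarrow> (\<exists>y. E y u \<and> E z y) \<or> (\<exists>a b. E a u \<and> E b u \<and> z = pr a b)" for z u
    using E_mk[OF small_S] unfolding S_def by simp
  show ?thesis
  proof (rule that)
    show "E x A" "\<And>a. E a w \<Longrightarrow> E a A" using A(1) E_mk[OF small_insert[OF small_ext]] by auto
    show "transitive E A" unfolding transitive_def using A(2) U by blast
    show "pair_closed A" unfolding pair_closed_def using A(2) U by blast
  qed
qed

lemma limit_above:
  assumes "Ord E \<alpha>" obtains \<kappa> where "limit \<kappa>" "E \<alpha> \<kappa>"
proof -
  have im: "small (succ ` ext u)" for u by (intro small_image small_ext pterm_succ pterm_var)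
  have "pterm E (\<lambda>e. mk (succ ` ext (e 0)))"
    by (intro pterm_mk im, unfold image_iff Bex_def mem_Collect_eq, intro pdef_intros pterm_succ)
  from closing_off[OF this, of "succ \<alpha>"]
  obtain A where A: "(\<forall>a. E a (succ \<alpha>) \<longrightarrow> E a A) \<and>
    (\<forall>a b. E a A \<longrightarrow> E b A \<longrightarrow> (\<exists>u. E a u \<and> E b u \<and> (\<forall>z. E z u \<or> E z (mk (succ ` ext u)) \<longrightarrow> E z A)))"
    by (rule exE)
  note A = A[THEN conjunct1, rule_format] A[THEN conjunct2, rule_format]
  have im': "E (succ a) (mk (succ ` ext u))" if "E a u" for a u
    unfolding E_mk[OF im] by (rule imageI) (use that in simp)
  have succ_A: "E (succ a) A" if "E a A" for a using A(2)[OF that that] im' by blast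
  \<comment> \<open>\<open>A\<close> is closed under \<open>succ\<close> but need not consist of
    ordinals; the union of its ordinals is an ordinal, and closed under \<open>succ\<close> as
    well.\<close>
  let ?O = "{\<beta>\<in>ext A. Ord E \<beta>}"
  have small_O: "small ?O" by (intro small_sep small_ext pdef_Ord pdef_intros)
  define l where "l = mk (\<Union>(ext ` ?O))"
  have l: "E x l \<longleftrightarrow> (\<exists>\<beta>. E \<beta> A \<and> Ord E \<beta> \<and> E x \<beta>)" for x
    unfolding l_def using E_mk[OF small_Union[OF small_O]] by auto
  have "Ord E l" unfolding l_def by (rule Ord_Union[OF small_O]) simp
  moreover have "E \<alpha> l"
    using l[of \<alpha>] A(1)[OF less_succ] succ_A[of \<alpha>] less_succ[of \<alpha>] Ord_succ[OF assms] by blast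
  moreover have "E (succ x) l" if x: "E x l" for x
  proof -
    obtain \<beta> where \<beta>: "E \<beta> A" "Ord E \<beta>" "E x \<beta>" using x l by blast
    then have "E (succ x) (succ \<beta>)" unfolding E_succ using succ_le by blast
    then show ?thesis using l[of "succ x"] succ_A[OF \<beta>(1)] Ord_succ[OF \<beta>(2)] by blast
  qed
  ultimately show ?thesis using that[of l] unfolding limit_def by blast
qed

lemma least_Ord:
  assumes "pdef E (\<lambda>e. P (e 0))" "Ord E \<alpha>" "P \<alpha>"
  shows "\<exists>!\<beta>. Ord E \<beta> \<and> P \<beta> \<and> (\<forall>\<gamma>. E \<gamma> \<beta> \<longrightarrow> \<not> P \<gamma>)"
proof -
  have "\<exists>\<beta>. Ord E \<beta> \<and> P \<beta> \<and> (\<forall>\<gamma>. E \<gamma> \<beta> \<longrightarrow> \<not> P \<gamma>)"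
  proof (rule ccontr)
    assume n: "\<not> ?thesis"
    have "\<not> P \<alpha>" using assms(2)
      by (rule Ord_induct[of "\<lambda>x. \<not> P x", OF pdef_neg[OF assms(1)], rotated]) (use n in blast)
    then show False using assms(3) by blast
  qed
  moreover have "\<beta> = \<gamma>" if "Ord E \<beta>" "P \<beta>" "\<forall>\<gamma>. E \<gamma> \<beta> \<longrightarrow> \<not> P \<gamma>" "Ord E \<gamma>" "P \<gamma>" "\<forall>\<beta>. E \<beta> \<gamma> \<longrightarrow> \<not> P \<beta>"
      for \<beta> \<gamma>
    using Ord_linear[OF that(1,4)] that by blast
  ultimately show ?thesis by blast
qed

section \<open>The cumulative hierarchy\<close>

lemma pdef_is_Vset: "pterm E s \<Longrightarrow> pterm E t \<Longrightarrow> pdef E (\<lambda>e. is_Vset E (s e) (t e))"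
  by (rule pdef_comp2) (unfold is_Vset_def, intro pdef_intros pdef_maps_to pdef_ord_le)

lemma is_Vset_exists:
  assumes \<beta>: "Ord E \<beta>" shows "\<exists>v. is_Vset E \<beta> v"
proof -
  define S where "S s = {x. \<exists>u. E u s \<and> (\<forall>z. E z x \<longrightarrow> E z u)}" for s
  have small_S: "small (S s)" for s
  proof -
    have "pterm E (\<lambda>e. mk {z. ext z \<subseteq> ext (e 0)})"
      by (intro pterm_mk small_Pow) (auto simp: subset_eq intro!: pdef_intros)
    then have "small (\<Union>(ext ` (\<lambda>u. mk {z. ext z \<subseteq> ext u}) ` ext s))"
      by (intro small_Union small_image small_ext)
    moreover have "\<Union>(ext ` (\<lambda>u. mk {z. ext z \<subseteq> ext u}) ` ext s) = S s"
      unfolding S_def by (intro set_eqI) (auto simp: E_mk[OF small_Pow])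
    ultimately show ?thesis by simp
  qed
  have pS: "pterm E (\<lambda>e. mk (S (e 0)))"
    by (intro pterm_mk small_S) (unfold S_def mem_Collect_eq, intro pdef_intros)
  have wf: "\<exists>x\<in>s. \<forall>y\<in>s. \<not> E y x" if "small s" "s \<subseteq> ext (succ \<beta>)" "s \<noteq> {}" for s
    using minimal that by simp
  obtain f where f: "(\<forall>n\<in>ext (succ \<beta>). \<exists>!y. maps_to E f n y) \<and>
      (\<forall>n\<in>ext (succ \<beta>). \<forall>y. maps_to E f n y \<longrightarrow> y = mk (S (mk {u. \<exists>v\<in>ext (succ \<beta>). E v n \<and> maps_to E f
          v u})))"
    using wf_recursion[of "ext (succ \<beta>)" "\<lambda>x y. E x y" "\<lambda>s. mk (S s)", OF small_ext pdef_mem_vars pS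
        wf] by (rule exE)
  have f1: "\<exists>!y. maps_to E f n y" if "E n (succ \<beta>)" for n using f that by simp
  have f2: "y = mk (S (mk {u. \<exists>v\<in>ext (succ \<beta>). E v n \<and> maps_to E f v u}))" if "E n (succ \<beta>)"
      "maps_to E f n y" for n y
    using f that by simp
  have "E x w \<longleftrightarrow> (\<exists>\<xi> u. E \<xi> \<gamma> \<and> maps_to E f \<xi> u \<and> (\<forall>z. E z x \<longrightarrow> E z u))"
    if "ord_le E \<gamma> \<beta>" "maps_to E f \<gamma> w" for \<gamma> w x
  proof -
    have EG: "E x (mk (S s)) \<longleftrightarrow> (\<exists>u. E u s \<and> (\<forall>z. E z x \<longrightarrow> E z u))" for x s
      using E_mk[OF small_S, of x s] by (simp add: S_def)
    have *: "small {u. \<exists>v\<in>ext (succ \<beta>). E v \<gamma> \<and> maps_to E f v u}"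
      by (rule small_range_rel[where f = f]) (auto simp: Bex_def intro!: pdef_intros pdef_maps_to)
    have g: "E \<gamma> (succ \<beta>)" using that E_succ by blast
    have "E x w \<longleftrightarrow> (\<exists>u. (\<exists>v\<in>ext (succ \<beta>). E v \<gamma> \<and> maps_to E f v u) \<and> (\<forall>z. E z x \<longrightarrow> E z u))"
      unfolding f2[OF g that(2)] EG E_mk[OF *] mem_Collect_eq ..
    moreover have "E v (succ \<beta>)" if "E v \<gamma>" for v
      using less_ord_le_trans[OF \<beta> that \<open>ord_le E \<gamma> \<beta>\<close>] unfolding E_succ ord_le_def by blast
    ultimately show ?thesis by auto
  qed
  moreover have "\<exists>!w. maps_to E f \<gamma> w" if "ord_le E \<gamma> \<beta>" for \<gamma> using f1 that E_succ by blast
  moreover obtain v where "maps_to E f \<beta> v" using calculation(2)[OF ord_le_refl] by blast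
  ultimately show ?thesis unfolding is_Vset_def by blast
qed

lemma is_Vset_unique:
  assumes \<beta>: "Ord E \<beta>" and "is_Vset E \<beta> v" "is_Vset E \<beta> w" shows "v = w"
proof (rule ccontr)
  assume "v \<noteq> w"
  obtain f where f: "\<And>\<gamma>. ord_le E \<gamma> \<beta> \<Longrightarrow> \<exists>!w. maps_to E f \<gamma> w"
    "\<And>\<gamma> w x. ord_le E \<gamma> \<beta> \<Longrightarrow> maps_to E f \<gamma> w \<Longrightarrow> E x w \<longleftrightarrow> (\<exists>\<xi> u. E \<xi> \<gamma> \<and> maps_to E f \<xi> u \<and> (\<forall>z. E z x \<longrightarrow>
        E z u))"
    "maps_to E f \<beta> v" using assms(2) unfolding is_Vset_def by blast
  obtain g where g: "\<And>\<gamma>. ord_le E \<gamma> \<beta> \<Longrightarrow> \<exists>!w. maps_to E g \<gamma> w"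
    "\<And>\<gamma> w x. ord_le E \<gamma> \<beta> \<Longrightarrow> maps_to E g \<gamma> w \<Longrightarrow> E x w \<longleftrightarrow> (\<exists>\<xi> u. E \<xi> \<gamma> \<and> maps_to E g \<xi> u \<and> (\<forall>z. E z x \<longrightarrow>
        E z u))"
    "maps_to E g \<beta> w" using assms(3) unfolding is_Vset_def by blast
  let ?P = "\<lambda>\<gamma>. ord_le E \<gamma> \<beta> \<longrightarrow> (\<forall>v w. maps_to E f \<gamma> v \<and> maps_to E g \<gamma> w \<longrightarrow> v = w)"
  have step: "?P \<gamma>" if IH: "\<And>\<xi>. E \<xi> \<gamma> \<Longrightarrow> ?P \<xi>" for \<gamma>
  proof (intro impI allI, elim conjE)
    fix v w assume \<gamma>: "ord_le E \<gamma> \<beta>" and vw: "maps_to E f \<gamma> v" "maps_to E g \<gamma> w"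
    have "maps_to E f \<xi> u \<longleftrightarrow> maps_to E g \<xi> u" if "E \<xi> \<gamma>" for \<xi> u
      using IH[OF that] f(1)[of \<xi>] g(1)[of \<xi>] less_ord_le_trans[OF \<beta> that \<gamma>] ord_le_def by metis
    then have "E x v \<longleftrightarrow> E x w" for x unfolding f(2)[OF \<gamma> vw(1)] g(2)[OF \<gamma> vw(2)] by blast
    then show "v = w" by (intro extensionality allI)
  qed
  have "?P \<beta>"
  proof (rule Ord_induct[where P = ?P, OF _ _ \<beta>])
    show "pdef E (\<lambda>e. ?P (e 0))" by (intro pdef_intros pdef_maps_to pdef_ord_le)
    show "?P \<gamma>" if "\<And>\<xi>. E \<xi> \<gamma> \<Longrightarrow> ?P \<xi>" for \<gamma> by (rule step[OF that])
  qed
  then show False using f(3) g(3) \<open>v \<noteq> w\<close> ord_le_refl by blast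
qed

text \<open>The value at non-ordinals is a dummy that makes \<open>V\<close> a total function with
  definable graph, so that it can be used as a term.\<close>

definition V :: "'v \<Rightarrow> 'v" where
  "V \<beta> = (if Ord E \<beta> then THE v. is_Vset E \<beta> v else \<beta>)"

lemma is_Vset_iff: "Ord E \<beta> \<Longrightarrow> is_Vset E \<beta> v \<longleftrightarrow> v = V \<beta>"
  unfolding V_def using is_Vset_exists is_Vset_unique the_equality[of "is_Vset E \<beta>"] by metis

lemma pterm_V: "pterm E s \<Longrightarrow> pterm E (\<lambda>e. V (s e))"
proof (rule pterm_comp1[where F = V])
  have "y = V x \<longleftrightarrow> (Ord E x \<and> is_Vset E x y) \<or> (\<not> Ord E x \<and> y = x)" for x y
    using is_Vset_iff[of x y] by (cases "Ord E x") (auto simp: V_def)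
  then show "pterm E (\<lambda>e. V (e 0))"
    unfolding pterm_def by (simp only:) (intro pdef_intros pdef_Ord pdef_is_Vset)
qed

text \<open>The witness \<open>f\<close> for \<beta> also witnesses every smaller \<xi>, so its
  values below \<beta> are the \<open>V \<xi>\<close>.\<close>

lemma E_V:
  assumes \<beta>: "Ord E \<beta>" shows "E x (V \<beta>) \<longleftrightarrow> (\<exists>\<xi>. E \<xi> \<beta> \<and> (\<forall>z. E z x \<longrightarrow> E z (V \<xi>)))"
proof -
  have "is_Vset E \<beta> (V \<beta>)" using is_Vset_iff[OF \<beta>] by blast
  then obtain f where f: "\<And>\<gamma>. ord_le E \<gamma> \<beta> \<Longrightarrow> \<exists>!w. maps_to E f \<gamma> w"
    "\<And>\<gamma> w x. ord_le E \<gamma> \<beta> \<Longrightarrow> maps_to E f \<gamma> w \<Longrightarrow> E x w \<longleftrightarrow> (\<exists>\<xi> u. E \<xi> \<gamma> \<and> maps_to E f \<xi> u \<and> (\<forall>z. E z x \<longrightarrow>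
        E z u))"
    "maps_to E f \<beta> (V \<beta>)" unfolding is_Vset_def by blast
  have fV: "maps_to E f \<xi> u \<longleftrightarrow> u = V \<xi>" if \<xi>: "E \<xi> \<beta>" for \<xi> u
  proof -
    have le: "ord_le E \<gamma> \<beta>" if "ord_le E \<gamma> \<xi>" for \<gamma>
      using ord_le_less_trans[OF \<beta> that \<xi>] unfolding ord_le_def by blast
    have "is_Vset E \<xi> u" if "maps_to E f \<xi> u" for u
      unfolding is_Vset_def using f(1,2) le that by (intro exI[of _ f]) blast
    then have "maps_to E f \<xi> u \<Longrightarrow> u = V \<xi>" for u using is_Vset_iff[OF Ord_elem[OF \<beta> \<xi>]] by blast
    then show ?thesis using f(1)[OF le[OF ord_le_refl]] by metis
  qed
  show ?thesis using f(2)[OF ord_le_refl f(3), of x] fV by metis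
qed

lemma Vlevel_eq: "Ord E \<beta> \<Longrightarrow> Vlevel E \<beta> = ext (V \<beta>)"
  unfolding Vlevel_def using is_Vset_iff by simp

lemma V_mono: "Ord E \<beta> \<Longrightarrow> ord_le E \<alpha> \<beta> \<Longrightarrow> E x (V \<alpha>) \<Longrightarrow> E x (V \<beta>)"
proof -
  assume \<beta>: "Ord E \<beta>" and le: "ord_le E \<alpha> \<beta>" and "E x (V \<alpha>)"
  then obtain \<xi> where "E \<xi> \<alpha>" "\<forall>z. E z x \<longrightarrow> E z (V \<xi>)" using E_V[OF ord_le_Ord[OF \<beta> le]] by blast
  then show "E x (V \<beta>)" using E_V[OF \<beta>] less_ord_le_trans[OF \<beta> _ le] by blast
qed

lemma V_subset: "Ord E \<beta> \<Longrightarrow> E x (V \<beta>) \<Longrightarrow> (\<And>z. E z y \<Longrightarrow> E z x) \<Longrightarrow> E y (V \<beta>)"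
  unfolding E_V by blast

lemma V_transitive: "Ord E \<beta> \<Longrightarrow> E x (V \<beta>) \<Longrightarrow> E y x \<Longrightarrow> E y (V \<beta>)"
  using E_V[of \<beta> x] V_mono[of \<beta>] unfolding ord_le_def by blast

lemma V_mem: "Ord E \<beta> \<Longrightarrow> E \<xi> \<beta> \<Longrightarrow> E (V \<xi>) (V \<beta>)"
  using E_V[of \<beta> "V \<xi>"] by blast

lemma V_subset_iff: "Ord E \<alpha> \<Longrightarrow> Ord E \<beta> \<Longrightarrow> (\<forall>x. E x (V \<alpha>) \<longrightarrow> E x (V \<beta>)) \<longleftrightarrow> ord_le E \<alpha> \<beta>"
  using V_mono[of \<beta> \<alpha>] ord_le_cases[of \<alpha> \<beta>] V_mem[of \<alpha> \<beta>] E_irrefl by blast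

lemma V_mem_iff: "Ord E \<alpha> \<Longrightarrow> Ord E \<beta> \<Longrightarrow> E (V \<alpha>) (V \<beta>) \<longleftrightarrow> E \<alpha> \<beta>"
  using V_mem[of \<beta> \<alpha>] ord_le_cases[of \<beta> \<alpha>] V_mono[of \<alpha> \<beta> "V \<alpha>"] E_irrefl by blast

text \<open>A minimal element without rank in a transitive set around \<open>x\<close> has only
  elements with rank. Replacement collects their least levels, and a bound \<beta> for these puts
  the element itself into \<open>V (succ \<beta>)\<close>.\<close>

lemma in_some_V: "\<exists>\<alpha>. Ord E \<alpha> \<and> E x (V \<alpha>)"
proof (rule ccontr)
  assume n: "\<not> ?thesis"
  obtain t where t: "E x t" "transitive E t" by (rule transitive_superset)
  let ?X = "{y\<in>ext t. \<not> (\<exists>\<alpha>. Ord E \<alpha> \<and> E y (V \<alpha>))}"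
  have "small ?X" by (intro small_sep small_ext pdef_intros pdef_Ord pterm_V)
  moreover have "?X \<noteq> {}" using n t by blast
  ultimately have "\<exists>y\<in>?X. \<forall>u\<in>?X. \<not> E u y" by (rule minimal)
  then obtain y where y: "y \<in> ?X" and min: "\<forall>u\<in>?X. \<not> E u y" by (rule bexE)
  have ex: "\<exists>\<alpha>. Ord E \<alpha> \<and> E z (V \<alpha>)" if "E z y" for z
    using that y min t(2) unfolding transitive_def by blast
  define C where "C z \<alpha> \<longleftrightarrow> Ord E \<alpha> \<and> E z (V \<alpha>) \<and> (\<forall>\<beta>. E \<beta> \<alpha> \<longrightarrow> \<not> E z (V \<beta>))" for z \<alpha>
  define r where "r z = (if \<exists>!\<alpha>. C z \<alpha> then THE \<alpha>. C z \<alpha> else z)" for z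
  have r: "C z (r z)" if "E z y" for z
  proof -
    obtain \<alpha> where \<alpha>: "Ord E \<alpha>" "E z (V \<alpha>)" using ex[OF \<open>E z y\<close>] by blast
    have "\<exists>!\<alpha>. C z \<alpha>" unfolding C_def
      by (rule least_Ord[of "\<lambda>\<alpha>. E z (V \<alpha>)", OF _ \<alpha>]) (intro pdef_intros pterm_V)
    then show ?thesis unfolding r_def using theI'[of "C z"] by simp
  qed
  have "\<alpha> = r z \<longleftrightarrow> ((\<exists>!\<alpha>. C z \<alpha>) \<and> C z \<alpha>) \<or> (\<not> (\<exists>!\<alpha>. C z \<alpha>) \<and> \<alpha> = z)" for \<alpha> z
  proof (cases "\<exists>!\<alpha>. C z \<alpha>")
    case True
    then show ?thesis unfolding r_def using theI'[OF True] by auto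
  qed (simp add: r_def)
  then have "pterm E (\<lambda>e. r (e 0))"
    unfolding pterm_def by (simp only:) (unfold C_def, intro pdef_intros pdef_Ord pterm_V)
  then have "small (r ` ext y)" by (intro small_image small_ext)
  then obtain \<beta> where \<beta>: "Ord E \<beta>" "\<And>\<alpha>. \<alpha> \<in> r ` ext y \<Longrightarrow> E \<alpha> \<beta>"
    by (rule Ord_bound) (use r C_def in auto)
  have "E z (V \<beta>)" if "E z y" for z
    using r[OF that] \<beta>(2)[of "r z"] that V_mono[OF \<beta>(1), of "r z"] unfolding ord_le_def unfolding
        C_def by blast
  then have "E y (V (succ \<beta>))" using E_V[OF Ord_succ[OF \<beta>(1)], of y] less_succ by blast
  then show False using y Ord_succ[OF \<beta>(1)] by blast
qed

lemma finite_in_some_V: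
  assumes "finite X" shows "\<exists>\<alpha>. Ord E \<alpha> \<and> (\<forall>x\<in>X. E x (V \<alpha>))"
  using assms
proof induction
  case empty
  then show ?case using exists_limit unfolding limit_def by blast
next
  case (insert x X)
  then obtain \<alpha> \<beta> where "Ord E \<alpha>" "\<forall>x\<in>X. E x (V \<alpha>)" "Ord E \<beta>" "E x (V \<beta>)" using in_some_V[of x] by blast
  then show ?case using V_mono[of \<alpha> \<beta>] V_mono[of \<beta> \<alpha>] ord_le_cases[of \<alpha> \<beta>] unfolding ord_le_def by blast
qed

text \<open>The required index is the least ordinal above all \<xi> with \<open>V \<xi>\<close> in
  \<open>h\<close>. It is obtained by separation, since these \<xi> are below any \<alpha> with
  \<open>h\<close> in \<open>V \<alpha>\<close>.\<close>

lemma level_of_levels: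
  assumes H: "\<And>w. E w h \<Longrightarrow> \<exists>\<xi>. Ord E \<xi> \<and> w = V \<xi>"
  shows "\<exists>\<zeta>. Ord E \<zeta> \<and> (\<forall>x. E x (V \<zeta>) \<longleftrightarrow> (\<exists>w. E w h \<and> (\<forall>z. E z x \<longrightarrow> E z w)))"
proof -
  obtain \<alpha> where \<alpha>: "Ord E \<alpha>" "E h (V \<alpha>)" using in_some_V by blast
  let ?Z = "{\<eta>\<in>ext \<alpha>. \<exists>\<xi>. E \<xi> \<alpha> \<and> E (V \<xi>) h \<and> ord_le E \<eta> \<xi>}"
  have small_Z: "small ?Z" by (intro small_sep small_ext pdef_intros pterm_V pdef_ord_le)
  have Z: "E \<eta> (mk ?Z) \<longleftrightarrow> E \<eta> \<alpha> \<and> (\<exists>\<xi>. E \<xi> \<alpha> \<and> E (V \<xi>) h \<and> ord_le E \<eta> \<xi>)" for \<eta>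
    using E_mk[OF small_Z] by simp
  have Zord: "Ord E (mk ?Z)"
  proof (rule OrdI)
    show "Ord E \<eta>" if "E \<eta> (mk ?Z)" for \<eta> using that Ord_elem[OF \<alpha>(1)] unfolding Z by blast
    fix \<eta> \<zeta> assume \<eta>: "E \<eta> (mk ?Z)" "E \<zeta> \<eta>"
    then obtain \<xi> where \<xi>: "E \<xi> \<alpha>" "E (V \<xi>) h" "ord_le E \<eta> \<xi>" unfolding Z by blast
    then have "ord_le E \<zeta> \<xi>" using less_ord_le_trans[OF Ord_elem[OF \<alpha>(1) \<xi>(1)] \<eta>(2)] unfolding
        ord_le_def by blast
    then show "E \<zeta> (mk ?Z)" using \<eta> \<xi> Ord_trans[OF \<alpha>(1)] unfolding Z by blast
  qed
  have "E x (V (mk ?Z)) \<longleftrightarrow> (\<exists>w. E w h \<and> (\<forall>z. E z x \<longrightarrow> E z w))" for x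
  proof
    assume "E x (V (mk ?Z))"
    then obtain \<eta> \<xi> where "E \<xi> \<alpha>" "E (V \<xi>) h" "ord_le E \<eta> \<xi>" "\<forall>z. E z x \<longrightarrow> E z (V \<eta>)"
      unfolding E_V[OF Zord] Z by blast
    then show "\<exists>w. E w h \<and> (\<forall>z. E z x \<longrightarrow> E z w)"
      using V_mono[OF Ord_elem[OF \<alpha>(1)]] by blast
  next
    assume "\<exists>w. E w h \<and> (\<forall>z. E z x \<longrightarrow> E z w)"
    then obtain \<xi> where \<xi>: "Ord E \<xi>" "E (V \<xi>) h" "\<forall>z. E z x \<longrightarrow> E z (V \<xi>)" using H by blast
    then have "E (V \<xi>) (V \<alpha>)" using V_transitive[OF \<alpha>] by blast
    then have "E \<xi> \<alpha>" using V_mem_iff[OF \<xi>(1) \<alpha>(1)] by blast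
    then have "E \<xi> (mk ?Z)" unfolding Z using \<xi> ord_le_refl by blast
    then show "E x (V (mk ?Z))" unfolding E_V[OF Zord] using \<xi>(3) by blast
  qed
  then show ?thesis using Zord by blast
qed

end

section \<open>Absoluteness\<close>

definition transitive_class :: "('v \<Rightarrow> 'v \<Rightarrow> bool) \<Rightarrow> 'v set \<Rightarrow> bool" where
  "transitive_class E D \<longleftrightarrow> (\<forall>x\<in>D. \<forall>y. E y x \<longrightarrow> y \<in> D)"

lemma Delta0_absolute:
  assumes "Delta0 \<phi>" "transitive_class E D" "\<forall>i\<in>fv \<phi>. e i \<in> D"
  shows "sat D E e \<phi> \<longleftrightarrow> sat UNIV E e \<phi>"
  using assms(1,3)
proof (induction arbitrary: e)
  case (5 \<phi> x y)
  have "sat D E (e(x := a)) \<phi> \<longleftrightarrow> sat UNIV E (e(x := a)) \<phi>" if "a \<in> D" for a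
    by (rule 5(3)) (use 5(4) that in auto)
  moreover have "a \<in> D" if "E a (e y)" for a
    using that assms(2) 5(2,4) unfolding transitive_class_def by auto
  ultimately show ?case using 5(2) by auto
qed auto

lemma Delta0_absolute2:
  assumes "Delta0 \<phi>" "transitive_class E D" "transitive_class E D'" "D \<subseteq> D'" "\<forall>i\<in>fv \<phi>. e i \<in> D"
  shows "sat D E e \<phi> \<longleftrightarrow> sat D' E e \<phi>"
proof -
  have "\<forall>i\<in>fv \<phi>. e i \<in> D'" using assms by blast
  then show ?thesis using Delta0_absolute[of \<phi> E] assms by blast
qed

lemma Sigma_0_Delta0: "Sigma_fm 0 \<phi> \<Longrightarrow> Delta0 \<phi>"
  by (erule Sigma_fm.cases) simp_all

lemma Pi_0_Delta0: "Pi_fm 0 \<phi> \<Longrightarrow> Delta0 \<phi>"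
  by (erule Pi_fm.cases) simp_all

text \<open>A Sigma formula of level \<open>n + 1\<close> is a block of existential quantifiers in
  front of a Pi formula of level \<open>n\<close>. This induction keeps the level fixed and avoids
  the mutual predicate.\<close>

lemma Sigma_Suc_induct [consumes 1, case_names Pi Exists]:
  assumes "Sigma_fm (Suc n) \<phi>" and "\<And>\<psi>. Pi_fm n \<psi> \<Longrightarrow> P \<psi>" and "\<And>\<psi> x. P \<psi> \<Longrightarrow> P (Exists x \<psi>)"
  shows "P \<phi>"
proof -
  have "Sigma_fm m \<phi> \<Longrightarrow> m = Suc n \<longrightarrow> P \<phi>" and "Pi_fm k \<psi> \<Longrightarrow> True" for m k \<psi>
    by (induction rule: Sigma_fm_Pi_fm.inducts) (use assms(2,3) in auto)
  then show ?thesis using assms(1) by blast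
qed

lemma Pi_Suc_induct [consumes 1, case_names Sigma Forall]:
  assumes "Pi_fm (Suc n) \<phi>" and "\<And>\<psi>. Sigma_fm n \<psi> \<Longrightarrow> P \<psi>" and "\<And>\<psi> x. P \<psi> \<Longrightarrow> P (Forall x \<psi>)"
  shows "P \<phi>"
proof -
  have "Sigma_fm k \<psi> \<Longrightarrow> True" and "Pi_fm m \<phi> \<Longrightarrow> m = Suc n \<longrightarrow> P \<phi>" for m k \<psi>
    by (induction rule: Sigma_fm_Pi_fm.inducts) (use assms(2,3) in auto)
  then show ?thesis using assms(1) by blast
qed

text \<open>\<open>Neg \<phi>\<close> itself need not have the shape of a Pi formula; the negation
  is pushed through the leading quantifiers instead.\<close>

lemma Sigma_dual:
  "Sigma_fm n \<phi> \<Longrightarrow> \<exists>\<psi>. Pi_fm n \<psi> \<and> fv \<psi> = fv \<phi> \<and> (\<forall>D (E :: 'v \<Rightarrow> 'v \<Rightarrow> bool) e. sat D E e \<psi> \<longleftrightarrow> \<not> sat D E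
      e \<phi>)"
  and Pi_dual:
  "Pi_fm n \<phi> \<Longrightarrow> \<exists>\<psi>. Sigma_fm n \<psi> \<and> fv \<psi> = fv \<phi> \<and> (\<forall>D (E :: 'v \<Rightarrow> 'v \<Rightarrow> bool) e. sat D E e \<psi> \<longleftrightarrow> \<not> sat D E
      e \<phi>)"
proof (induction rule: Sigma_fm_Pi_fm.inducts)
  case (1 \<phi>)
  then show ?case by (intro exI[of _ "Neg \<phi>"]) (simp add: Delta0.intros Sigma_fm_Pi_fm.intros)
next
  case (2 \<phi>)
  then show ?case by (intro exI[of _ "Neg \<phi>"]) (simp add: Delta0.intros Sigma_fm_Pi_fm.intros)
next
  case (3 n \<phi>)
  then show ?case using Sigma_fm_Pi_fm.intros(5) by blast
next
  case (4 n \<phi> x)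
  then obtain \<psi> where \<psi>: "Pi_fm (Suc n) \<psi>" "fv \<psi> = fv \<phi>"
    "\<forall>D (E :: 'v \<Rightarrow> 'v \<Rightarrow> bool) e. sat D E e \<psi> \<longleftrightarrow> \<not> sat D E e \<phi>" by blast
  then show ?case by (intro exI[of _ "Forall x \<psi>"]) (simp add: Sigma_fm_Pi_fm.intros)
next
  case (5 n \<phi>)
  then show ?case using Sigma_fm_Pi_fm.intros(3) by blast
next
  case (6 n \<phi> x)
  then obtain \<psi> where \<psi>: "Sigma_fm (Suc n) \<psi>" "fv \<psi> = fv \<phi>"
    "\<forall>D (E :: 'v \<Rightarrow> 'v \<Rightarrow> bool) e. sat D E e \<psi> \<longleftrightarrow> \<not> sat D E e \<phi>" by blast
  then show ?case by (intro exI[of _ "Exists x \<psi>"]) (simp add: Sigma_fm_Pi_fm.intros)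
qed

lemma Sigma1_upward:
  assumes "Sigma_fm 1 \<phi>" "transitive_class E D" "transitive_class E D'" "D \<subseteq> D'"
    "\<forall>i\<in>fv \<phi>. e i \<in> D" "sat D E e \<phi>"
  shows "sat D' E e \<phi>"
  using assms(1)[unfolded One_nat_def] assms(5,6)
proof (induction arbitrary: e rule: Sigma_Suc_induct)
  case (Pi \<psi>)
  then show ?case using Delta0_absolute2[OF Pi_0_Delta0 assms(2,3,4)] by blast
next
  case (Exists \<psi> x)
  then obtain a where "a \<in> D" "sat D E (e(x := a)) \<psi>" by auto
  moreover have "\<forall>i\<in>fv \<psi>. (e(x := a)) i \<in> D" using Exists.prems(1) \<open>a \<in> D\<close> by auto
  ultimately have "sat D' E (e(x := a)) \<psi>" using Exists.IH[of "e(x := a)"] by blast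
  then show ?case using assms(4) \<open>a \<in> D\<close> by auto
qed

lemma Pi_downward:
  assumes "\<And>\<psi> e. Sigma_fm n \<psi> \<Longrightarrow> \<forall>i\<in>fv \<psi>. e i \<in> D \<Longrightarrow> sat UNIV E e \<psi> \<Longrightarrow> sat D E e \<psi>"
    and "Pi_fm (Suc n) \<phi>" "\<forall>i\<in>fv \<phi>. e i \<in> D" "sat UNIV E e \<phi>"
  shows "sat D E e \<phi>"
  using assms(2-4)
proof (induction arbitrary: e rule: Pi_Suc_induct)
  case (Forall \<psi> x)
  have "sat D E (e(x := a)) \<psi>" if "a \<in> D" for a
  proof (rule Forall.IH)
    show "\<forall>i\<in>fv \<psi>. (e(x := a)) i \<in> D" using Forall.prems(1) that by auto
    show "sat UNIV E (e(x := a)) \<psi>" using Forall.prems(2) by simp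
  qed
  then show ?case by simp
qed (use assms(1) in blast)

definition correct :: "nat \<Rightarrow> ('v \<Rightarrow> 'v \<Rightarrow> bool) \<Rightarrow> 'v set \<Rightarrow> bool" where
  "correct n E D \<longleftrightarrow>
     (\<forall>\<phi> e. Sigma_fm n \<phi> \<and> (\<forall>i\<in>fv \<phi>. e i \<in> D) \<longrightarrow> (sat D E e \<phi> \<longleftrightarrow> sat UNIV E e \<phi>))"

lemma correct_Pi:
  fixes E :: "'v \<Rightarrow> 'v \<Rightarrow> bool"
  assumes "correct n E D" "Pi_fm n \<phi>" "\<forall>i\<in>fv \<phi>. e i \<in> D"
  shows "sat D E e \<phi> \<longleftrightarrow> sat UNIV E e \<phi>"
proof -
  obtain \<psi> where "Sigma_fm n \<psi>" "fv \<psi> = fv \<phi>" "\<forall>D (E :: 'v \<Rightarrow> 'v \<Rightarrow> bool) e. sat D E e \<psi> \<longleftrightarrow> \<not> sat D E e \<phi>"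
    using Pi_dual[OF assms(2)] by blast
  then show ?thesis using assms(1,3) unfolding correct_def by metis
qed

lemma correct_Sigma_Suc_upward:
  assumes "correct n E D" "Sigma_fm (Suc n) \<phi>" "\<forall>i\<in>fv \<phi>. e i \<in> D" "sat D E e \<phi>"
  shows "sat UNIV E e \<phi>"
  using assms(2-4)
proof (induction arbitrary: e rule: Sigma_Suc_induct)
  case (Pi \<psi>)
  then show ?case using correct_Pi[OF assms(1)] by blast
next
  case (Exists \<psi> x)
  then obtain a where "a \<in> D" "sat D E (e(x := a)) \<psi>" by auto
  moreover have "\<forall>i\<in>fv \<psi>. (e(x := a)) i \<in> D" using Exists.prems(1) \<open>a \<in> D\<close> by auto
  ultimately have "sat UNIV E (e(x := a)) \<psi>" using Exists.IH[of "e(x := a)"] by blast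
  then show ?case by auto
qed

text \<open>The isomorphism is given as a relation, because the collapse of the hull will arise in
  this form.\<close>

lemma sat_iso:
  assumes "\<And>x. x \<in> H \<Longrightarrow> \<exists>y\<in>N. r x y" "\<And>y. y \<in> N \<Longrightarrow> \<exists>x\<in>H. r x y"
    and "\<And>x y x' y'. r x y \<Longrightarrow> r x' y' \<Longrightarrow> (x = x' \<longleftrightarrow> y = y') \<and> (E x x' \<longleftrightarrow> E y y')"
  shows "(\<And>i. r (e i) (e' i)) \<Longrightarrow> sat H E e \<phi> \<longleftrightarrow> sat N E e' \<phi>"
proof (induction \<phi> arbitrary: e e')
  case (Exists x \<phi>)
  have step: "sat H E (e(x := a)) \<phi> \<longleftrightarrow> sat N E (e'(x := b)) \<phi>" if "r a b" for a b
    by (rule Exists.IH) (use Exists.prems that in auto)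
  show ?case
  proof
    assume "sat H E e (Exists x \<phi>)"
    then obtain a where "a \<in> H" "sat H E (e(x := a)) \<phi>" by auto
    moreover obtain b where "b \<in> N" "r a b" using assms(1) \<open>a \<in> H\<close> by blast
    ultimately show "sat N E e' (Exists x \<phi>)" using step by auto
  next
    assume "sat N E e' (Exists x \<phi>)"
    then obtain b where "b \<in> N" "sat N E (e'(x := b)) \<phi>" by auto
    moreover obtain a where "a \<in> H" "r a b" using assms(2) \<open>b \<in> N\<close> by blast
    ultimately show "sat H E e (Exists x \<phi>)" using step by auto
  qed
next
  case (Mem x y)
  then show ?case using assms(3)[of "e x" "e' x" "e y" "e' y"] by simp
next
  case (Eq x y)
  then show ?case using assms(3)[of "e x" "e' x" "e y" "e' y"] by simp
next
  case (Neg \<phi>)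
  show ?case using Neg.IH[OF Neg.prems] by simp
next
  case (Conj \<phi> \<psi>)
  have "sat H E e \<phi> \<longleftrightarrow> sat N E e' \<phi>" "sat H E e \<psi> \<longleftrightarrow> sat N E e' \<psi>"
    by (rule Conj.IH(1)[OF Conj.prems], rule Conj.IH(2)[OF Conj.prems])
  then show ?case by simp
qed

context zfc_model begin

lemma transitive_class_V: "Ord E \<beta> \<Longrightarrow> transitive_class E (ext (V \<beta>))"
  unfolding transitive_class_def using V_transitive by simp

lemma Ord_max:
  assumes "Ord E \<alpha>" "Ord E \<beta>" obtains \<gamma> where "Ord E \<gamma>" "ord_le E \<alpha> \<gamma>" "ord_le E \<beta> \<gamma>"
proof (cases "ord_le E \<alpha> \<beta>")
  case True
  then show ?thesis using that[OF assms(2)] ord_le_refl by blast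
next
  case False
  then have "ord_le E \<beta> \<alpha>" using ord_le_cases[OF assms] unfolding ord_le_def by blast
  then show ?thesis using that[OF assms(1)] ord_le_refl by blast
qed

text \<open>Finitely many witnesses and parameters lie in some \<open>V \<alpha>\<close> and remain
  available above it. \<open>Q\<close> singles out the levels to which Pi truths of level
  \<open>n\<close> descend: all of them for \<open>n\<close> up to 1, the reflecting ones for
  \<open>n = 2\<close>.\<close>

lemma eventually_sat_Sigma_Suc:
  assumes base: "\<And>\<psi> e \<gamma>. Pi_fm n \<psi> \<Longrightarrow> sat UNIV E e \<psi> \<Longrightarrow> Ord E \<gamma> \<Longrightarrow> Q \<gamma> \<Longrightarrow> \<forall>i\<in>fv \<psi>. E (e i) (V \<gamma>) \<Longrightarrow>
     sat (ext (V \<gamma>)) E e \<psi>"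
    and "Sigma_fm (Suc n) \<phi>" "sat UNIV E e \<phi>"
  shows "\<exists>\<alpha>. Ord E \<alpha> \<and> (\<forall>\<gamma>. Ord E \<gamma> \<longrightarrow> ord_le E \<alpha> \<gamma> \<longrightarrow> Q \<gamma> \<longrightarrow> sat (ext (V \<gamma>)) E e \<phi>)"
  using assms(2,3)
proof (induction arbitrary: e rule: Sigma_Suc_induct)
  case (Pi \<psi>)
  obtain \<alpha> where \<alpha>: "Ord E \<alpha>" "\<forall>x\<in>e ` fv \<psi>. E x (V \<alpha>)"
    using finite_in_some_V[of "e ` fv \<psi>"] finite_fv[of \<psi>] by auto
  have "sat (ext (V \<gamma>)) E e \<psi>" if "Ord E \<gamma>" "ord_le E \<alpha> \<gamma>" "Q \<gamma>" for \<gamma>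
    by (rule base[OF Pi that(1,3)]) (use V_mono[OF that(1,2)] \<alpha>(2) in blast)
  then show ?case using \<alpha>(1) by blast
next
  case (Exists \<psi> x)
  then obtain a where a: "sat UNIV E (e(x := a)) \<psi>" by auto
  obtain \<alpha> where \<alpha>: "Ord E \<alpha>" "\<forall>\<gamma>. Ord E \<gamma> \<longrightarrow> ord_le E \<alpha> \<gamma> \<longrightarrow> Q \<gamma> \<longrightarrow> sat (ext (V \<gamma>)) E (e(x := a)) \<psi>"
    using Exists.IH[OF a] by blast
  obtain \<beta> where \<beta>: "Ord E \<beta>" "E a (V \<beta>)" using in_some_V by blast
  obtain \<mu> where \<mu>: "Ord E \<mu>" "ord_le E \<alpha> \<mu>" "ord_le E \<beta> \<mu>" using Ord_max[OF \<alpha>(1) \<beta>(1)] .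
  have "sat (ext (V \<gamma>)) E e (Exists x \<psi>)" if g: "Ord E \<gamma>" "ord_le E \<mu> \<gamma>" "Q \<gamma>" for \<gamma>
  proof -
    have "ord_le E \<alpha> \<gamma>" "ord_le E \<beta> \<gamma>" using ord_le_trans[OF g(1) _ g(2)] \<mu> by blast+
    then have "sat (ext (V \<gamma>)) E (e(x := a)) \<psi>" "E a (V \<gamma>)" using \<alpha> g V_mono[OF g(1) _ \<beta>(2)] by blast+
    then show ?thesis by auto
  qed
  then show ?case using \<mu>(1) by blast
qed

end

section \<open>Skolem hulls\<close>

primrec existential_subformulas :: "fm \<Rightarrow> (nat \<times> fm) set" where
  "existential_subformulas (Mem x y) = {}"
| "existential_subformulas (Eq x y) = {}"
| "existential_subformulas (Neg \<phi>) = existential_subformulas \<phi>"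
| "existential_subformulas (Conj \<phi> \<psi>) = existential_subformulas \<phi> \<union> existential_subformulas \<psi>"
| "existential_subformulas (Exists x \<phi>) = insert (x, \<phi>) (existential_subformulas \<phi>)"

lemma finite_existential_subformulas: "finite (existential_subformulas \<phi>)"
  by (induction \<phi>) auto

text \<open>Only the existential subformulas of the formula at hand need witnesses. With a finite
  \<open>F\<close>, finitely many Skolem functions suffice and no truth predicate is needed.\<close>

lemma Tarski_Vaught:
  assumes "H \<subseteq> M" and TV: "\<And>x \<psi> e. (x, \<psi>) \<in> F \<Longrightarrow> \<forall>i. e i \<in> H \<Longrightarrow> sat M E e (Exists x \<psi>) \<Longrightarrow>
    \<exists>h\<in>H. sat M E (e(x := h)) \<psi>"
  shows "existential_subformulas \<phi> \<subseteq> F \<Longrightarrow> \<forall>i. e i \<in> H \<Longrightarrow> sat H E e \<phi> \<longleftrightarrow> sat M E e \<phi>"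
proof (induction \<phi> arbitrary: e)
  case (Exists x \<phi>)
  have IH: "sat H E (e(x := h)) \<phi> \<longleftrightarrow> sat M E (e(x := h)) \<phi>" if "h \<in> H" for h
    by (rule Exists.IH) (use Exists.prems that in auto)
  show ?case
  proof
    assume "sat H E e (Exists x \<phi>)"
    then show "sat M E e (Exists x \<phi>)" using IH assms(1) by auto
  next
    assume "sat M E e (Exists x \<phi>)"
    then obtain h where "h \<in> H" "sat M E (e(x := h)) \<phi>" using TV[of x \<phi> e] Exists.prems by auto
    then show "sat H E e (Exists x \<phi>)" using IH by auto
  qed
qed auto

lemma pterm_ite:
  assumes "pdef E P" "pterm E s" "pterm E t" shows "pterm E (\<lambda>e. if P e then s e else t e)"
proof -
  have eq: "y = (if P e then s e else t e) \<longleftrightarrow> (P e \<and> y = s e) \<or> (\<not> P e \<and> y = t e)" for y e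
    by auto
  show ?thesis unfolding pterm_def eq
    by (intro pdef_disj pdef_conj pdef_neg pdef_rename[OF assms(1), of Suc] assms(2,3)[unfolded
        pterm_def])
qed

context zfc_model begin

definition pfst :: "'v \<Rightarrow> 'v" where "pfst p = (if \<exists>a b. p = pr a b then THE a. \<exists>b. p = pr a b else p)"
definition psnd :: "'v \<Rightarrow> 'v" where "psnd p = (if \<exists>a b. p = pr a b then THE b. \<exists>a. p = pr a b else p)"

lemma pfst_pr [simp]: "pfst (pr a b) = a" and psnd_pr [simp]: "psnd (pr a b) = b"
  unfolding pfst_def psnd_def by auto

lemma pterm_pfst: "pterm E s \<Longrightarrow> pterm E (\<lambda>e. pfst (s e))"
proof (rule pterm_comp1[where F = pfst])
  have "y = pfst p \<longleftrightarrow> (\<exists>b. p = pr y b) \<or> (\<not> (\<exists>a b. p = pr a b) \<and> y = p)" for y p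
  proof (cases "\<exists>a b. p = pr a b")
    case False
    then show ?thesis unfolding pfst_def by auto
  qed auto
  then show "pterm E (\<lambda>e. pfst (e 0))" unfolding pterm_def by (simp only:) (intro pdef_intros pterm_pr)
qed

lemma pterm_psnd: "pterm E s \<Longrightarrow> pterm E (\<lambda>e. psnd (s e))"
proof (rule pterm_comp1[where F = psnd])
  have "y = psnd p \<longleftrightarrow> (\<exists>b. p = pr b y) \<or> (\<not> (\<exists>a b. p = pr a b) \<and> y = p)" for y p
  proof (cases "\<exists>a b. p = pr a b")
    case False
    then show ?thesis unfolding psnd_def by auto
  qed auto
  then show "pterm E (\<lambda>e. psnd (e 0))" unfolding pterm_def by (simp only:) (intro pdef_intros pterm_pr)
qed

text \<open>\<open>a\<close> is read as a tuple of nested pairs with entry 0 outermost on the right,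
  so one element of the hull can carry a finite environment.\<close>

definition proj :: "nat \<Rightarrow> 'v \<Rightarrow> 'v" where "proj i a = psnd ((pfst ^^ i) a)"

lemma proj_pr: "proj 0 (pr a b) = b" "proj (Suc i) (pr a b) = proj i a"
  unfolding proj_def by (simp_all add: funpow_swap1 del: funpow.simps(2) add: funpow_Suc_right)

lemma pterm_proj: "pterm E s \<Longrightarrow> pterm E (\<lambda>e. proj i (s e))"
proof -
  assume s: "pterm E s"
  have "pterm E (\<lambda>e. (pfst ^^ i) (s e))" by (induction i) (simp_all add: s pterm_pfst)
  then show ?thesis unfolding proj_def by (rule pterm_psnd)
qed

text \<open>The axiom of choice is stated for disjoint families, so each nonempty subset
  \<open>s\<close> of \<open>M\<close> is replaced by the set \<open>t s\<close> of pairs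
  \<open>pr s y\<close> with \<open>y\<close> in \<open>s\<close>.\<close>

lemma choice_function:
  obtains ch where "pterm E (\<lambda>e. ch (e 0))"
    and "\<And>s x. (\<And>y. E y s \<Longrightarrow> E y M) \<Longrightarrow> E x s \<Longrightarrow> E (ch s) s"
proof -
  define t where "t s = mk (pr s ` ext s)" for s
  have small_t: "small (pr s ` ext s)" for s by (intro small_image small_ext pterm_pr pterm_const
      pterm_var)
  have t: "E z (t s) \<longleftrightarrow> (\<exists>y. E y s \<and> z = pr s y)" for z s
    unfolding t_def E_mk[OF small_t] by auto
  have pt: "pterm E (\<lambda>e. t (e 0))" unfolding t_def
    by (intro pterm_mk small_t, unfold image_iff Bex_def mem_Collect_eq, intro pdef_intros pterm_pr)
  let ?S = "{s\<in>{z. ext z \<subseteq> ext M}. \<exists>x. E x s}"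
  have small_S: "small ?S" by (rule small_sep[OF small_Pow]) (intro pdef_intros)
  define a where "a = mk (t ` ?S)"
  have "E x (mk (t ` ?S)) \<longleftrightarrow> x \<in> t ` ?S" for x by (rule E_mk[OF small_image[OF small_S pt]])
  then have a: "E x a \<longleftrightarrow> (\<exists>s. (\<forall>y. E y s \<longrightarrow> E y M) \<and> (\<exists>y. E y s) \<and> x = t s)" for x
    unfolding a_def by auto
  have "\<exists>c. \<forall>x. E x a \<longrightarrow> (\<exists>!y. E y x \<and> E y c)"
  proof (rule choice)
    show "\<forall>x. E x a \<longrightarrow> (\<exists>y. E y x)" unfolding a using t by auto
    show "\<forall>x y z. E x a \<and> E y a \<and> E z x \<and> E z y \<longrightarrow> x = y" unfolding a by (auto simp: t)
  qed
  then obtain c where c: "\<And>x. E x a \<Longrightarrow> \<exists>!y. E y x \<and> E y c" by blast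
  define P where "P s y \<longleftrightarrow> E y s \<and> E (pr s y) c" for s y
  define ch where "ch s = (if \<exists>!y. P s y then THE y. P s y else s)" for s
  show ?thesis
  proof (rule that)
    have "y = ch s \<longleftrightarrow> ((\<exists>!y. P s y) \<and> P s y) \<or> (\<not> (\<exists>!y. P s y) \<and> y = s)" for y s
    proof (cases "\<exists>!y. P s y")
      case True
      then show ?thesis unfolding ch_def using theI'[OF True] by auto
    qed (simp add: ch_def)
    then show "pterm E (\<lambda>e. ch (e 0))"
      unfolding pterm_def by (simp only:) (unfold P_def, intro pdef_intros pterm_pr)
    fix s x assume s: "\<And>y. E y s \<Longrightarrow> E y M" "E x s"
    then have "E (t s) a" unfolding a by blast
    then have "\<exists>!z. E z (t s) \<and> E z c" by (rule c)
    then obtain z where z: "E z (t s)" "E z c" and uniq: "\<And>z'. E z' (t s) \<Longrightarrow> E z' c \<Longrightarrow> z' = z"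
      by (elim ex1E) blast
    obtain y where y: "E y s" "z = pr s y" using z(1) unfolding t by blast
    have ex1: "\<exists>!y. P s y"
    proof (rule ex1I[of _ y])
      show "P s y" unfolding P_def using y z(2) by simp
      fix y' assume "P s y'"
      then have "E (pr s y') (t s)" "E (pr s y') c" unfolding t P_def by blast+
      then show "y' = y" using uniq[of "pr s y'"] y(2) by simp
    qed
    have "P s (ch s)" unfolding ch_def using theI'[OF ex1] ex1 by (simp only: if_True)
    then show "E (ch s) s" unfolding P_def ..
  qed
qed

lemma empty_in_transitive:
  assumes "transitive E W" "E x W" shows "\<exists>z. E z W \<and> (\<forall>u. \<not> E u z)"
proof -
  have "ext W \<noteq> {}" using assms(2) by auto
  with small_ext have "\<exists>y\<in>ext W. \<forall>u\<in>ext W. \<not> E u y" by (rule minimal)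
  then obtain y where y: "y \<in> ext W" "\<forall>u\<in>ext W. \<not> E u y" by (rule bexE)
  have "\<not> E u y" for u using assms(1) y unfolding transitive_def by auto
  then show ?thesis using y(1) by auto
qed

lemma pr_nonempty: "\<exists>u. E u (pr a b)"
  unfolding pr_def using E_mk[OF small_upair] by blast

text \<open>The tags start with the empty set and pair the previous tag with itself; they are
  different because pairs are nonempty and \<open>pr\<close> is injective.\<close>

lemma distinct_tags:
  assumes "pair_closed W" "transitive E W" "E x W"
  obtains \<tau> :: "nat \<Rightarrow> 'v" where "\<And>i. E (\<tau> i) W" "inj \<tau>"
proof -
  obtain z where z: "E z W" "\<forall>u. \<not> E u z" using empty_in_transitive[OF assms(2,3)] by blast
  define \<tau> where "\<tau> = rec_nat z (\<lambda>_ t. pr t t)"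
  have \<tau>: "\<tau> 0 = z" "\<tau> (Suc n) = pr (\<tau> n) (\<tau> n)" for n unfolding \<tau>_def by simp_all
  have "E (\<tau> i) W" for i by (induction i) (use z assms(1) \<tau> in \<open>auto simp: pair_closed_def\<close>)
  moreover have nz: "pr a b \<noteq> z" for a b using z(2) pr_nonempty[of a b] by metis
  have "\<tau> m = \<tau> n \<Longrightarrow> m = n" for m n
  proof (induction m arbitrary: n)
    case 0
    then show ?case using nz \<tau> by (cases n) metis+
  next
    case (Suc m)
    then show ?case using nz \<tau> by (cases n) auto
  qed
  then have "inj \<tau>" by (rule injI)
  ultimately show ?thesis by (rule that)
qed

text \<open>Finitely many Skolem functions and pairing are merged into one operation selected by a
  tag, so that the hull needs a single generation rule. With offset \<open>k = 1\<close> the tag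
  \<open>\<tau> 0\<close> stays free for the codes of generators.\<close>

lemma tagged_operations:
  assumes "inj (\<tau> :: nat \<Rightarrow> 'v)" and "\<And>p. p \<in> set L \<Longrightarrow> pterm E (\<lambda>e. sk p (e 0))"
  shows "\<exists>f. pterm E (\<lambda>e. f (e 0) (e (Suc 0)) (e (Suc (Suc 0)))) \<and>
    (\<forall>i<length L. \<forall>a b. f (\<tau> (i + k)) a b = sk (L ! i) a) \<and>
    (\<forall>t a b. f t a b = pr a b \<or> (\<exists>p\<in>set L. f t a b = sk p a)) \<and>
    (\<forall>t a b. (\<forall>i<length L. t \<noteq> \<tau> (i + k)) \<longrightarrow> f t a b = pr a b)"
  using assms(2)
proof (induction L arbitrary: k)
  case Nil
  show ?case by (rule exI[of _ "\<lambda>t a b. pr a b"]) (simp add: pterm_pr pterm_var)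
next
  case (Cons p L)
  then obtain f where f: "pterm E (\<lambda>e. f (e 0) (e (Suc 0)) (e (Suc (Suc 0))))"
    "\<forall>i<length L. \<forall>a b. f (\<tau> (i + Suc k)) a b = sk (L ! i) a"
    "\<forall>t a b. f t a b = pr a b \<or> (\<exists>p\<in>set L. f t a b = sk p a)"
    "\<forall>t a b. (\<forall>i<length L. t \<noteq> \<tau> (i + Suc k)) \<longrightarrow> f t a b = pr a b"
    using Cons.IH[of "Suc k"] by auto
  define g where "g t a b = (if t = \<tau> k then sk p a else f t a b)" for t a b
  have "pterm E (\<lambda>e. g (e 0) (e (Suc 0)) (e (Suc (Suc 0))))" unfolding g_def
    by (intro pterm_ite pdef_eq pterm_var pterm_const f(1) pterm_comp1[OF Cons.prems]) simp
  moreover have "g (\<tau> (i + k)) a b = sk ((p # L) ! i) a" if "i < length (p # L)" for i a b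
  proof (cases i)
    case (Suc j)
    then have "\<tau> (i + k) \<noteq> \<tau> k" using injD[OF assms(1)] by fastforce
    then show ?thesis using f(2) Suc that unfolding g_def by simp
  qed (simp add: g_def)
  moreover have "g t a b = pr a b \<or> (\<exists>q\<in>set (p # L). g t a b = sk q a)" for t a b
    using f(3) unfolding g_def by auto
  moreover have "g t a b = pr a b" if "\<forall>i<length (p # L). t \<noteq> \<tau> (i + k)" for t a b
  proof -
    have "t \<noteq> \<tau> k" using that by force
    moreover have "t \<noteq> \<tau> (i + Suc k)" if "i < length L" for i
      using \<open>\<forall>i<length (p # L). t \<noteq> \<tau> (i + k)\<close>[rule_format, of "Suc i"] that by simp
    ultimately show ?thesis using f(4) unfolding g_def by simp
  qed
  ultimately show ?case by (intro exI[of _ g]) simp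
qed

text \<open>The hull is indexed by codes in \<open>W\<close>: \<open>pr z a\<close> is a code of \<open>a \<in> W\<close>, and \<open>pr t (pr w\<^sub>1 w\<^sub>2)\<close> is a
  code of \<open>f t a b\<close> if \<open>w\<^sub>1\<close>, \<open>w\<^sub>2\<close> are codes of \<open>a\<close>, \<open>b\<close>. This bounds its size without cardinals.\<close>

lemma coded_hull:
  assumes f: "pterm E (\<lambda>e. f (e 0) (e (Suc 0)) (e (Suc (Suc 0))))"
    and W: "pair_closed W" and z: "E z W" and WM: "\<And>x. E x W \<Longrightarrow> E x M"
    and fM: "\<And>t a b. E a M \<Longrightarrow> E b M \<Longrightarrow> E (f t a b) M"
  obtains C where "\<And>w h. maps_to E C w h \<Longrightarrow> E w W \<and> E h M"
    and "\<And>w h h'. maps_to E C w h \<Longrightarrow> maps_to E C w h' \<Longrightarrow> h' = h"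
    and "\<And>a. E a W \<Longrightarrow> maps_to E C (pr z a) a"
    and "\<And>t w1 a w2 b. E t W \<Longrightarrow> t \<noteq> z \<Longrightarrow> maps_to E C w1 a \<Longrightarrow> maps_to E C w2 b \<Longrightarrow>
      maps_to E C (pr t (pr w1 w2)) (f t a b)"
proof -
  have pf: "pterm E s \<Longrightarrow> pterm E t \<Longrightarrow> pterm E u \<Longrightarrow> pterm E (\<lambda>e. f (s e) (t e) (u e))" for s t u
    by (rule pterm_comp3[OF f])
  \<comment> \<open>\<open>C\<close> will be the least closed relation, obtained as an intersection
    inside a set of pairs; rule induction and inversion are then derived from minimality.\<close>
  define closed where "closed S \<longleftrightarrow> (\<forall>a. E a W \<longrightarrow> maps_to E S (pr z a) a) \<and>
    (\<forall>t w1 a w2 b. E t W \<and> t \<noteq> z \<and> E w1 W \<and> E a M \<and> E w2 W \<and> E b M \<and> maps_to E S w1 a \<and> maps_to E S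
        w2 b \<longrightarrow>
      maps_to E S (pr t (pr w1 w2)) (f t a b))" for S
  have pclosed: "pterm E s \<Longrightarrow> pdef E (\<lambda>e. closed (s e))" for s
    by (rule pdef_comp1) (unfold closed_def, intro pdef_intros pdef_maps_to pterm_pr pf)
  have prW: "E (pr a b) W" if "E a W" "E b W" for a b using W that unfolding pair_closed_def by blast
  let ?C = "{p\<in>{p. \<exists>a b. E a M \<and> E b M \<and> p = pr a b}. (\<exists>w h. p = pr w h \<and> E w W \<and> E h M) \<and> (\<forall>S.
      closed S \<longrightarrow> E p S)}"
  have small_C: "small ?C" by (rule small_sep[OF small_pairs]) (intro pdef_intros pclosed pterm_pr)
  define C where "C = mk ?C"
  have C: "maps_to E C w h \<longleftrightarrow> E w W \<and> E h M \<and> (\<forall>S. closed S \<longrightarrow> maps_to E S w h)" for w h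
    unfolding C_def maps_to_iff E_mk[OF small_C] using WM by auto
  have base: "maps_to E C (pr z a) a" if "E a W" for a
    unfolding C using prW[OF z that] WM[OF that] that by (simp add: closed_def)
  have step: "maps_to E C (pr t (pr w1 w2)) (f t a b)"
    if "E t W" "t \<noteq> z" "maps_to E C w1 a" "maps_to E C w2 b" for t w1 a w2 b
  proof -
    have *: "E w1 W" "E w2 W" "E a M" "E b M" using that unfolding C by auto
    have "maps_to E S (pr t (pr w1 w2)) (f t a b)" if S: "closed S" for S
    proof -
      have "maps_to E S w1 a" "maps_to E S w2 b" using \<open>maps_to E C w1 a\<close> \<open>maps_to E C w2 b\<close> S
          unfolding C by auto
      then show ?thesis using S * \<open>E t W\<close> \<open>t \<noteq> z\<close> unfolding closed_def by blast
    qed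
    moreover have "E (pr t (pr w1 w2)) W" using prW that(1) * by blast
    ultimately show ?thesis unfolding C using fM * by blast
  qed
  have induct: "Q w h"
    if Q: "pdef E (\<lambda>e. Q (e 0) (e (Suc 0)))" and Qbase: "\<And>a. E a W \<Longrightarrow> Q (pr z a) a"
    and Qstep: "\<And>t w1 a w2 b. E t W \<Longrightarrow> t \<noteq> z \<Longrightarrow> maps_to E C w1 a \<Longrightarrow> maps_to E C w2 b \<Longrightarrow> Q w1 a \<Longrightarrow> Q w2 b
      \<Longrightarrow> Q (pr t (pr w1 w2)) (f t a b)"
    and wh: "maps_to E C w h" for Q w h
  proof -
    let ?S = "{p\<in>ext C. \<exists>w h. p = pr w h \<and> Q w h}"
    have pQ: "pterm E s \<Longrightarrow> pterm E t \<Longrightarrow> pdef E (\<lambda>e. Q (s e) (t e))" for s t by (rule pdef_comp2[OF Q])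
    have small_S: "small ?S" by (rule small_sep[OF small_ext]) (intro pdef_intros pQ pterm_pr)
    have S: "maps_to E (mk ?S) w h \<longleftrightarrow> maps_to E C w h \<and> Q w h" for w h
      unfolding maps_to_iff E_mk[OF small_S] by auto
    have "closed (mk ?S)" unfolding closed_def S using base step Qbase Qstep by simp
    then have "maps_to E (mk ?S) w h" using wh unfolding C by blast
    then show ?thesis unfolding S by blast
  qed
  have inv: "(\<exists>a. w = pr z a \<and> h = a) \<or>
     (\<exists>t w1 a w2 b. t \<noteq> z \<and> w = pr t (pr w1 w2) \<and> h = f t a b \<and> maps_to E C w1 a \<and> maps_to E C w2 b)"
    (is "?I w h") if "maps_to E C w h" for w h
  proof (rule induct[of ?I, OF _ _ _ that])
    show "pdef E (\<lambda>e. ?I (e 0) (e (Suc 0)))" by (intro pdef_intros pdef_maps_to pterm_pr pf)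
    show "?I (pr z a) a" for a by simp
    show "?I (pr t (pr w1 w2)) (f t a b)" if "t \<noteq> z" "maps_to E C w1 a" "maps_to E C w2 b" for t w1
        a w2 b
      using that by blast
  qed
  \<comment> \<open>A code determines its element: the tag in it tells which rule produced it, and
    \<open>z\<close> is never the tag of an operation.\<close>
  have func: "\<forall>h'. maps_to E C w h' \<longrightarrow> h' = h" if "maps_to E C w h" for w h
  proof (rule induct[of "\<lambda>w h. \<forall>h'. maps_to E C w h' \<longrightarrow> h' = h", OF _ _ _ that])
    show "pdef E (\<lambda>e. \<forall>h'. maps_to E C (e 0) h' \<longrightarrow> h' = e (Suc 0))" by (intro pdef_intros pdef_maps_to)
    show "\<forall>h'. maps_to E C (pr z a) h' \<longrightarrow> h' = a" for a
    proof (intro allI impI)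
      fix h' assume "maps_to E C (pr z a) h'"
      from inv[OF this] show "h' = a" by auto
    qed
    fix t w1 a w2 b assume *: "t \<noteq> z" "\<forall>h'. maps_to E C w1 h' \<longrightarrow> h' = a" "\<forall>h'. maps_to E C w2 h' \<longrightarrow> h'
        = b"
    show "\<forall>h'. maps_to E C (pr t (pr w1 w2)) h' \<longrightarrow> h' = f t a b"
    proof (intro allI impI)
      fix h' assume "maps_to E C (pr t (pr w1 w2)) h'"
      from inv[OF this] show "h' = f t a b" using * by auto
    qed
  qed
  show ?thesis
  proof (rule that[of C])
    show "E w W \<and> E h M" if "maps_to E C w h" for w h using that unfolding C by blast
    show "h' = h" if "maps_to E C w h" "maps_to E C w h'" for w h h' using func that by blast
  qed (rule base step; assumption)+
qed

text \<open>The hull comes as a partial function \<open>C\<close> from codes in \<open>W\<close>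
  onto it. So it can be described by subsets of \<open>W\<close>, however large \<open>M\<close>
  is.\<close>

lemma lowenheim_skolem:
  assumes M: "pair_closed M" and W: "transitive E W" "pair_closed W" "E x0 W" and WM: "\<And>x. E x W \<Longrightarrow> E
      x M"
    and F: "finite F"
  obtains C where "\<And>w h. maps_to E C w h \<Longrightarrow> E w W \<and> E h M"
    and "\<And>w h h'. maps_to E C w h \<Longrightarrow> maps_to E C w h' \<Longrightarrow> h' = h"
    and "\<And>a. E a W \<Longrightarrow> \<exists>w. maps_to E C w a"
    and "\<And>x \<psi> e. (x, \<psi>) \<in> F \<Longrightarrow> \<forall>i. \<exists>w. maps_to E C w (e i) \<Longrightarrow> sat (ext M) E e (Exists x \<psi>) \<Longrightarrow>
      \<exists>h. (\<exists>w. maps_to E C w h) \<and> sat (ext M) E (e(x := h)) \<psi>"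
proof -
  obtain \<tau> :: "nat \<Rightarrow> 'v" where \<tau>: "\<And>i. E (\<tau> i) W" "inj \<tau>" using distinct_tags[OF W(2,1,3)] by blast
  obtain ch where ch: "pterm E (\<lambda>e. ch (e 0))" "\<And>s x. (\<And>y. E y s \<Longrightarrow> E y M) \<Longrightarrow> E x s \<Longrightarrow> E (ch s) s"
    using choice_function[of M] by blast
  \<comment> \<open>The argument \<open>a\<close> codes the environment as a tuple, so each Skolem
    function is unary.\<close>
  define sol where "sol p a = {m\<in>ext M. sat (ext M) E ((\<lambda>j. proj j a)(fst p := m)) (snd p)}" for p a
  have psat: "pdef E (\<lambda>e. sat (ext M) E ((\<lambda>j. proj j (s e))(x := t e)) \<psi>)" if "pterm E s" "pterm E
      t" for s t x \<psi>
  proof -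
    have *: "(\<lambda>j. proj j (s e))(x := t e) = (\<lambda>j. if j = x then t e else proj j (s e))" for e by auto
    show ?thesis unfolding * by (intro pdef_relativized pterm_if pterm_proj pterm_const that)
  qed
  have small_sol: "small (sol p a)" for p a
    unfolding sol_def by (rule small_sep[OF small_ext]) (intro psat pterm_const pterm_var)
  \<comment> \<open>Without a solution the argument is returned, which keeps \<open>sk\<close>
    inside \<open>M\<close>.\<close>
  define sk where "sk p a = (if \<exists>m. m \<in> sol p a then ch (mk (sol p a)) else a)" for p a
  have psk: "pterm E (\<lambda>e. sk p (e 0))" for p
  proof -
    have "pterm E (\<lambda>e. mk (sol p (e 0)))"
      by (intro pterm_mk small_sol) (unfold sol_def mem_Collect_eq, intro pdef_intros psat)
    then have "pterm E (\<lambda>e. ch (mk (sol p (e 0))))" by (rule pterm_comp1[OF ch(1)])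
    moreover have "pdef E (\<lambda>e. \<exists>m. m \<in> sol p (e 0))" unfolding sol_def mem_Collect_eq by (intro
        pdef_intros psat)
    ultimately show ?thesis unfolding sk_def by (intro pterm_ite pterm_var)
  qed
  have sk_sol: "sk p a \<in> sol p a" if "m \<in> sol p a" for p a m
  proof -
    have "E (ch (mk (sol p a))) (mk (sol p a))"
    proof (rule ch(2))
      show "E y M" if "E y (mk (sol p a))" for y using that[unfolded E_mk[OF small_sol]] unfolding
          sol_def by simp
      show "E m (mk (sol p a))" unfolding E_mk[OF small_sol] by (rule that)
    qed
    then show ?thesis using that unfolding E_mk[OF small_sol] sk_def by auto
  qed
  have sk_M: "E (sk p a) M" if "E a M" for p a
  proof (cases "\<exists>m. m \<in> sol p a")
    case True
    then show ?thesis using sk_sol[of _ p a] unfolding sol_def by blast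
  qed (use that sk_def in simp)
  obtain L where L: "set L = F" using finite_list[OF F] by blast
  obtain f where f: "pterm E (\<lambda>e. f (e 0) (e (Suc 0)) (e (Suc (Suc 0))))"
    "\<forall>i<length L. \<forall>a b. f (\<tau> (i + 1)) a b = sk (L ! i) a"
    "\<forall>t a b. f t a b = pr a b \<or> (\<exists>p\<in>set L. f t a b = sk p a)"
    "\<forall>t a b. (\<forall>i<length L. t \<noteq> \<tau> (i + 1)) \<longrightarrow> f t a b = pr a b"
    using tagged_operations[OF \<tau>(2), of L sk 1] psk by blast
  have fM: "E (f t a b) M" if "E a M" "E b M" for t a b
  proof -
    consider "f t a b = pr a b" | p where "f t a b = sk p a" using f(3) by blast
    then show ?thesis using sk_M[OF that(1)] M that unfolding pair_closed_def by cases auto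
  qed
  obtain C where C: "\<And>w h. maps_to E C w h \<Longrightarrow> E w W \<and> E h M"
    "\<And>w h h'. maps_to E C w h \<Longrightarrow> maps_to E C w h' \<Longrightarrow> h' = h"
    "\<And>a. E a W \<Longrightarrow> maps_to E C (pr (\<tau> 0) a) a"
    "\<And>t w1 a w2 b. E t W \<Longrightarrow> t \<noteq> \<tau> 0 \<Longrightarrow> maps_to E C w1 a \<Longrightarrow> maps_to E C w2 b \<Longrightarrow>
      maps_to E C (pr t (pr w1 w2)) (f t a b)"
    using coded_hull[of f W "\<tau> 0" M, OF f(1) W(2) \<tau>(1) WM fM] by blast
  have \<tau>0: "\<tau> (Suc i) \<noteq> \<tau> 0" for i using injD[OF \<tau>(2), of "Suc i" 0] by auto
  have H_f: "\<exists>w. maps_to E C w (f (\<tau> (Suc i)) a b)" if "maps_to E C v a" "maps_to E C w b" for i a b v w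
    using C(4)[OF \<tau>(1) \<tau>0 that] by blast
  have H_pr: "\<exists>w. maps_to E C w (pr a b)" if "maps_to E C v a" "maps_to E C w b" for a b v w
  proof -
    \<comment> \<open>This tag comes after those of the Skolem functions, so the operation is
      pairing.\<close>
    have "\<forall>i<length L. \<tau> (Suc (length L)) \<noteq> \<tau> (i + 1)" using injD[OF \<tau>(2)] by fastforce
    then show ?thesis using H_f[OF that, of "length L"] f(4) by simp
  qed
  \<comment> \<open>An initial segment of the environment is coded; \<open>n\<close> will exceed
    every free variable.\<close>
  have code: "\<exists>a w. maps_to E C w a \<and> (\<forall>i<n. proj i a = e i)" if "\<forall>i. \<exists>w. maps_to E C w (e i)" for e n
    using that
  proof (induction n arbitrary: e)
    case 0
    then have "\<exists>w. maps_to E C w (e 0)" by blast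
    then show ?case by auto
  next
    case (Suc n)
    then obtain a w where a: "maps_to E C w a" "\<forall>i<n. proj i a = e (Suc i)"
      using Suc.IH[of "\<lambda>i. e (Suc i)"] by blast
    obtain v where "maps_to E C v (e 0)" using Suc.prems by blast
    then obtain u where "maps_to E C u (pr a (e 0))" using H_pr a(1) by blast
    moreover have "\<forall>i<Suc n. proj i (pr a (e 0)) = e i"
      using a(2) by (auto simp: less_Suc_eq_0_disj proj_pr)
    ultimately show ?case by blast
  qed
  show ?thesis
  proof (rule that[of C])
    show "\<exists>w. maps_to E C w a" if "E a W" for a using C(3)[OF that] by blast
    fix x \<psi> e assume p: "(x, \<psi>) \<in> F" and e: "\<forall>i. \<exists>w. maps_to E C w (e i)" and "sat (ext M) E e
        (Exists x \<psi>)"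
    then obtain m where m: "E m M" "sat (ext M) E (e(x := m)) \<psi>" by auto
    obtain n where n: "\<forall>i\<in>fv \<psi>. i < n" using finite_nat_set_iff_bounded finite_fv by blast
    obtain a w where a: "maps_to E C w a" "\<forall>i<n. proj i a = e i" using code[OF e, of n] by blast
    have eq: "sat (ext M) E ((\<lambda>j. proj j a)(x := h)) \<psi> \<longleftrightarrow> sat (ext M) E (e(x := h)) \<psi>" for h
      by (rule sat_cong) (use n a(2) in auto)
    have "m \<in> sol (x, \<psi>) a" unfolding sol_def using m eq by simp
    then have h: "sk (x, \<psi>) a \<in> sol (x, \<psi>) a" by (rule sk_sol)
    obtain i where i: "i < length L" "L ! i = (x, \<psi>)" using p L by (metis in_set_conv_nth)
    have "\<exists>w. maps_to E C w (f (\<tau> (Suc i)) a a)" using H_f a(1) by blast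
    then have "\<exists>w. maps_to E C w (sk (x, \<psi>) a)" using f(2) i by simp
    moreover have "sat (ext M) E (e(x := sk (x, \<psi>) a)) \<psi>" using h eq unfolding sol_def by simp
    ultimately show "\<exists>h. (\<exists>w. maps_to E C w h) \<and> sat (ext M) E (e(x := h)) \<psi>" by blast
  qed (fact C)+
qed


section \<open>Levy's reflection of Sigma 1 statements\<close>

definition wf_rel :: "'v \<Rightarrow> 'v \<Rightarrow> bool" where
  "wf_rel d R \<longleftrightarrow> (\<forall>s. (\<forall>x. E x s \<longrightarrow> E x d) \<and> (\<exists>x. E x s) \<longrightarrow> (\<exists>x. E x s \<and> (\<forall>y. E y s \<longrightarrow> \<not> maps_to E R y x)))"

text \<open>The transitive set \<open>r\<close> contains the values of the collapse \<open>\<pi>\<close>; it bounds all quantifiers.\<close>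

definition collapse :: "'v \<Rightarrow> 'v \<Rightarrow> 'v \<Rightarrow> 'v \<Rightarrow> bool" where
  "collapse \<pi> r d R \<longleftrightarrow> transitive E r \<and> (\<forall>x. E x d \<longrightarrow> (\<exists>y. E y r \<and> maps_to E \<pi> x y)) \<and>
     (\<forall>x. E x d \<longrightarrow> (\<forall>y. E y r \<longrightarrow> maps_to E \<pi> x y \<longrightarrow>
        (\<forall>u. E u r \<longrightarrow> (E u y \<longleftrightarrow> (\<exists>v. E v d \<and> maps_to E R v x \<and> maps_to E \<pi> v u)))))"

lemma collapse_exists:
  assumes "wf_rel d R" shows "\<exists>\<pi> r. collapse \<pi> r d R"
proof -
  have wf: "\<exists>x\<in>s. \<forall>y\<in>s. \<not> maps_to E R y x" if s: "small s" "s \<subseteq> ext d" "s \<noteq> {}" for s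
  proof -
    obtain a where a: "s = ext a" using s(1) by (rule smallE)
    then have "(\<forall>x. E x a \<longrightarrow> E x d) \<and> (\<exists>x. E x a)" using s(2,3) by auto
    then show ?thesis using assms unfolding wf_rel_def a by simp
  qed
  have pR: "pdef E (\<lambda>e. maps_to E R (e 0) (e (Suc 0)))" by (intro pdef_maps_to pdef_intros)
  obtain \<pi> where \<pi>: "(\<forall>x\<in>ext d. \<exists>!y. maps_to E \<pi> x y) \<and>
     (\<forall>x\<in>ext d. \<forall>y. maps_to E \<pi> x y \<longrightarrow> y = mk {u. \<exists>v\<in>ext d. maps_to E R v x \<and> maps_to E \<pi> v u})"
    using wf_recursion[of "ext d" "\<lambda>x y. maps_to E R x y" "\<lambda>x. x", OF small_ext pR pterm_var wf] by
        (rule exE)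
  have small: "small {u. \<exists>v\<in>ext d. maps_to E R v x \<and> maps_to E \<pi> v u}" for x
    by (rule small_range_rel[where f = \<pi>]) (auto simp: Bex_def intro!: pdef_intros pdef_maps_to)
  have "E u y \<longleftrightarrow> (\<exists>v. E v d \<and> maps_to E R v x \<and> maps_to E \<pi> v u)" if "E x d" "maps_to E \<pi> x y" for x y u
  proof -
    have y: "y = mk {u. \<exists>v\<in>ext d. maps_to E R v x \<and> maps_to E \<pi> v u}" using \<pi> that by simp
    show ?thesis unfolding y E_mk[OF small] by simp
  qed
  note val = this
  have ex: "\<exists>y. maps_to E \<pi> x y" if "E x d" for x using \<pi> that by blast
  have small_r: "small {y. \<exists>x. E x d \<and> maps_to E \<pi> x y}"
    by (rule small_range_rel[where f = \<pi>]) (auto intro!: pdef_intros pdef_maps_to)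
  define r where "r = mk {y. \<exists>x. E x d \<and> maps_to E \<pi> x y}"
  have r: "E y r \<longleftrightarrow> (\<exists>x. E x d \<and> maps_to E \<pi> x y)" for y unfolding r_def E_mk[OF small_r] by simp
  have "transitive E r" unfolding transitive_def r using val by blast
  moreover have "\<exists>y. E y r \<and> maps_to E \<pi> x y" if "E x d" for x using ex[OF that] that r by blast
  ultimately show ?thesis unfolding collapse_def using val by blast
qed

definition collapse_closed :: "'v set \<Rightarrow> bool" where
  "collapse_closed D \<longleftrightarrow> (\<forall>d\<in>D. \<forall>R\<in>D. wf_rel d R \<longrightarrow> (\<exists>\<pi>\<in>D. \<exists>r\<in>D. collapse \<pi> r d R))"

definition pairs_closed :: "'v set \<Rightarrow> bool" where
  "pairs_closed D \<longleftrightarrow> (\<forall>x\<in>D. \<forall>w\<in>D. \<exists>W\<in>D. E x W \<and> (\<forall>a. E a w \<longrightarrow> E a W) \<and> transitive E W \<and> pair_closed W)"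

lemma pairs_closed_finite:
  assumes "pairs_closed D" "x0 \<in> D" "finite X" "X \<subseteq> D"
  shows "\<exists>W\<in>D. E x0 W \<and> (\<forall>x\<in>X. E x W) \<and> transitive E W \<and> pair_closed W"
  using assms(3,4)
proof (induction X rule: finite_induct)
  case empty
  then show ?case using assms(1,2) unfolding pairs_closed_def by blast
next
  case (insert x X)
  then obtain W where W: "W \<in> D" "E x0 W" "\<forall>x\<in>X. E x W" by auto
  moreover have "x \<in> D" using insert by simp
  ultimately obtain W' where "W' \<in> D" "E x W'" "\<forall>a. E a W \<longrightarrow> E a W'" "transitive E W'" "pair_closed W'"
    using assms(1) unfolding pairs_closed_def by meson
  then show ?case using W by auto
qed

text \<open>A witnessing level may lie far outside \<open>D\<close>, but a hull in it that contains
  the parameters is described by relations \<open>d\<close> and \<open>R\<close> on codes, and these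
  are subsets of an element \<open>W\<close> of \<open>D\<close>. The collapse found in
  \<open>D\<close> yields a transitive model of \<open>\<phi>\<close>, and it fixes the parameters
  because \<open>W\<close> is transitive.\<close>

theorem Levy_reflection:
  assumes D: "transitive_class E D" "\<And>x y. x \<in> D \<Longrightarrow> (\<forall>z. E z y \<longrightarrow> E z x) \<Longrightarrow> y \<in> D" "x0 \<in> D"
    and closed: "collapse_closed D" "pairs_closed D"
    and \<phi>: "Sigma_fm 1 \<phi>" "\<forall>i\<in>fv \<phi>. e i \<in> D" "sat UNIV E e \<phi>"
  shows "sat D E e \<phi>"
proof -
  obtain W where W: "W \<in> D" "E x0 W" "\<forall>x\<in>e ` fv \<phi>. E x W" "transitive E W" "pair_closed W"
    using pairs_closed_finite[OF closed(2) D(3), of "e ` fv \<phi>"] \<phi>(2) finite_fv by blast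
  \<comment> \<open>Tarski-Vaught needs all values of the environment in the hull; \<open>x0\<close>
    fills the irrelevant variables.\<close>
  define e' where "e' i = (if i \<in> fv \<phi> then e i else x0)" for i
  have e': "E (e' i) W" for i unfolding e'_def using W by simp
  have e'_sat: "sat A E e' \<phi> \<longleftrightarrow> sat A E e \<phi>" for A by (rule sat_cong) (simp add: e'_def)
  obtain \<alpha> where \<alpha>: "Ord E \<alpha>" "\<And>\<gamma>. Ord E \<gamma> \<Longrightarrow> ord_le E \<alpha> \<gamma> \<Longrightarrow> sat (ext (V \<gamma>)) E e' \<phi>"
  proof -
    have "sat (ext (V \<gamma>)) E e \<psi>" if "Pi_fm 0 \<psi>" "sat UNIV E e \<psi>" "Ord E \<gamma>" "\<forall>i\<in>fv \<psi>. E (e i) (V \<gamma>)"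
        for \<psi> e \<gamma>
      using Delta0_absolute[OF Pi_0_Delta0[OF that(1)] transitive_class_V[OF that(3)]] that by simp
    then show ?thesis
      using eventually_sat_Sigma_Suc[of 0 "\<lambda>_. True" \<phi> e'] \<phi>(1,3) e'_sat that by auto
  qed
  obtain \<beta> where \<beta>: "Ord E \<beta>" "E W (V \<beta>)" using in_some_V by blast
  obtain \<gamma> where \<gamma>: "Ord E \<gamma>" "ord_le E \<alpha> \<gamma>" "ord_le E \<beta> \<gamma>" using Ord_max[OF \<alpha>(1) \<beta>(1)] .
  have WV: "E x (V \<gamma>)" if "E x W" for x
    using V_transitive[OF \<gamma>(1) V_mono[OF \<gamma>(1,3) \<beta>(2)] that] .
  \<comment> \<open>Pairs are added to the level so that the operations of the hull stay inside
    \<open>M\<close>; Sigma 1 truth goes up to \<open>M\<close>.\<close>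
  obtain M where M: "\<And>x. E x (V \<gamma>) \<Longrightarrow> E x M" "transitive E M" "pair_closed M"
    using pair_closed_superset[of x0 "V \<gamma>"] by metis
  have tM: "transitive_class E (ext M)" using M(2) unfolding transitive_def transitive_class_def by simp
  have satM: "sat (ext M) E e' \<phi>"
    by (rule Sigma1_upward[OF \<phi>(1) transitive_class_V[OF \<gamma>(1)] tM _ _ \<alpha>(2)[OF \<gamma>(1,2)]]) (use M(1) WV
        e' in auto)
  \<comment> \<open>\<open>\<chi>\<close> says that some element belongs to exactly one of the
    variables 0 and 1. Adding its subformulas to \<open>F\<close> makes the hull
    extensional.\<close>
  define \<chi> where "\<chi> = Exists 2 (Conj (Neg (Conj (Mem 2 0) (Mem 2 1))) (Neg (Conj (Neg (Mem 2 0))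
      (Neg (Mem 2 1)))))"
  define F where "F = existential_subformulas \<phi> \<union> existential_subformulas \<chi>"
  have "finite F" unfolding F_def by (intro finite_UnI finite_existential_subformulas)
  then obtain C where C: "\<And>w h. maps_to E C w h \<Longrightarrow> E w W \<and> E h M"
    "\<And>w h h'. maps_to E C w h \<Longrightarrow> maps_to E C w h' \<Longrightarrow> h' = h"
    "\<And>a. E a W \<Longrightarrow> \<exists>w. maps_to E C w a"
    "\<And>x \<psi> e. (x, \<psi>) \<in> F \<Longrightarrow> \<forall>i. \<exists>w. maps_to E C w (e i) \<Longrightarrow> sat (ext M) E e (Exists x \<psi>) \<Longrightarrow>
      \<exists>h. (\<exists>w. maps_to E C w h) \<and> sat (ext M) E (e(x := h)) \<psi>"
    using lowenheim_skolem[of M W x0 F, OF M(3) W(4,5,2)] M(1) WV by blast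
  define H where "H = {h. \<exists>w. maps_to E C w h}"
  have HM: "H \<subseteq> ext M" unfolding H_def using C(1) by auto
  have TV: "\<exists>h\<in>H. sat (ext M) E (e(x := h)) \<psi>"
    if "(x, \<psi>) \<in> F" "\<forall>i. e i \<in> H" "sat (ext M) E e (Exists x \<psi>)" for x \<psi> e
    using C(4)[OF that(1) _ that(3)] that(2) unfolding H_def by auto
  have WH: "a \<in> H" if "E a W" for a unfolding H_def using C(3)[OF that] by simp
  have satH: "sat H E e' \<phi>"
    using Tarski_Vaught[OF HM TV, of F \<phi> e'] satM WH[OF e'] unfolding F_def by blast
  have H_ext: "\<exists>u\<in>H. E u a \<longleftrightarrow> \<not> E u b" if ab: "a \<in> H" "b \<in> H" "a \<noteq> b" for a b
  proof -
    obtain u where u: "E u a \<longleftrightarrow> \<not> E u b" using extensionality[of a b] ab(3) by blast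
    have "E u M" using u ab(1,2) HM M(2) unfolding transitive_def by blast
    then have "sat (ext M) E (\<lambda>i. if i = 0 then a else b) \<chi>" unfolding \<chi>_def using u by auto
    then have "sat H E (\<lambda>i. if i = 0 then a else b) \<chi>"
      using Tarski_Vaught[OF HM TV, of F \<chi> "\<lambda>i. if i = 0 then a else b"] ab unfolding F_def by simp
    then show ?thesis unfolding \<chi>_def by auto
  qed
  let ?d = "{w\<in>ext W. \<exists>h. maps_to E C w h}"
  have small_d: "small ?d" by (rule small_sep[OF small_ext]) (intro pdef_intros pdef_maps_to)
  define d where "d = mk ?d"
  have d: "E w d \<longleftrightarrow> (\<exists>h. maps_to E C w h)" for w unfolding d_def E_mk[OF small_d] using C(1) by blast
  \<comment> \<open>An element may have several codes, so \<open>R\<close> on \<open>d\<close> need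
    not be extensional; codes of equal elements collapse to the same value, which
    \<open>r_fun\<close> confirms.\<close>
  let ?R = "{p\<in>ext W. \<exists>v w a b. p = pr v w \<and> maps_to E C v a \<and> maps_to E C w b \<and> E a b}"
  have small_R: "small ?R" by (rule small_sep[OF small_ext]) (intro pdef_intros pdef_maps_to pterm_pr)
  define R where "R = mk ?R"
  have R: "maps_to E R v w \<longleftrightarrow> (\<exists>a b. maps_to E C v a \<and> maps_to E C w b \<and> E a b)" for v w
    unfolding R_def maps_to_iff[of "mk ?R"] E_mk[OF small_R] using C(1) W(5) unfolding
        pair_closed_def by auto
  have "d \<in> D" by (rule D(2)[OF W(1)]) (use d C(1) in blast)
  moreover have "R \<in> D" by (rule D(2)[OF W(1)]) (unfold R_def E_mk[OF small_R], blast)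
  moreover have "wf_rel d R" unfolding wf_rel_def
  proof (intro allI impI, elim conjE exE)
    fix s x assume s: "\<forall>x. E x s \<longrightarrow> E x d" and x: "E x s"
    let ?X = "{h\<in>ext M. \<exists>w. E w s \<and> maps_to E C w h}"
    have "small ?X" by (rule small_sep[OF small_ext]) (intro pdef_intros pdef_maps_to)
    moreover obtain h where "maps_to E C x h" using s x d by blast
    then have "?X \<noteq> {}" using x C(1) by blast
    ultimately have "\<exists>y\<in>?X. \<forall>u\<in>?X. \<not> E u y" by (rule minimal)
    then obtain h where h: "h \<in> ?X" and min: "\<forall>u\<in>?X. \<not> E u h" by (rule bexE)
    obtain w where w: "E w s" "maps_to E C w h" using h by blast
    have "\<not> maps_to E R v w" if "E v s" for v
    proof
      assume "maps_to E R v w"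
      then obtain a b where "maps_to E C v a" "maps_to E C w b" "E a b" unfolding R by blast
      then show False using C(2)[OF w(2)] min that C(1) by blast
    qed
    then show "\<exists>x. E x s \<and> (\<forall>y. E y s \<longrightarrow> \<not> maps_to E R y x)" using w(1) by blast
  qed
  ultimately obtain \<pi> N' where "N' \<in> D" and \<pi>: "collapse \<pi> N' d R"
    using closed(1) unfolding collapse_closed_def by blast
  have N': "E u N'" if "E u y" "E y N'" for u y using \<pi> that unfolding collapse_def transitive_def
      by blast
  define r where "r x y \<longleftrightarrow> E y N' \<and> (\<exists>w. maps_to E C w x \<and> maps_to E \<pi> w y)" for x y
  have pr_def': "pterm E s \<Longrightarrow> pterm E t \<Longrightarrow> pdef E (\<lambda>e. r (s e) (t e))" for s t
    by (rule pdef_comp2) (unfold r_def, intro pdef_intros pdef_maps_to)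
  have r_ex: "\<exists>y. r x y" if "x \<in> H" for x
    using that \<pi> unfolding H_def r_def collapse_def d by blast
  have rH: "x \<in> H" if "r x y" for x y using that unfolding H_def r_def by blast
  \<comment> \<open>This is the recursion of the collapse, transported from codes to elements of the
    hull. It drives the proofs of functionality, injectivity and the identity on
    \<open>W\<close>.\<close>
  have r_mem: "E u y \<longleftrightarrow> (\<exists>a. E a x \<and> r a u)" if xy: "r x y" for x y u
  proof (cases "E u N'")
    case True
    obtain w where w: "E y N'" "maps_to E C w x" "maps_to E \<pi> w y" using xy unfolding r_def by blast
    have "E w d" using w(2) d by blast
    then have "E u y \<longleftrightarrow> (\<exists>v. E v d \<and> maps_to E R v w \<and> maps_to E \<pi> v u)"
      using \<pi> w True unfolding collapse_def by blast
    also have "\<dots> \<longleftrightarrow> (\<exists>v a. maps_to E C v a \<and> E a x \<and> maps_to E \<pi> v u)"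
      unfolding d R using C(2)[OF w(2)] w(2) by blast
    also have "\<dots> \<longleftrightarrow> (\<exists>a. E a x \<and> r a u)" unfolding r_def using True by blast
    finally show ?thesis .
  next
    case False
    then show ?thesis using xy N' unfolding r_def by blast
  qed
  have r_fun: "y = y'" if "r x y" "r x y'" for x y y'
    by (rule extensionality) (simp add: r_mem[OF that(1)] r_mem[OF that(2)])
  \<comment> \<open>Let a minimal \<open>a\<close> share its value with some \<open>b\<close>, and
    let \<open>u\<close> in the hull separate them. The value of \<open>u\<close> also comes from an
    element of the other set, and minimality identifies that element with \<open>u\<close>.\<close>
  have r_inj: "x = x'" if "r x y" "r x' y" for x x' y
  proof (rule ccontr)
    assume "x \<noteq> x'"
    let ?X = "{x\<in>ext M. \<exists>x' y. r x y \<and> r x' y \<and> x \<noteq> x'}"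
    have "small ?X" by (rule small_sep[OF small_ext]) (intro pdef_intros pr_def')
    moreover have "?X \<noteq> {}" using that \<open>x \<noteq> x'\<close> rH[OF that(1)] HM by auto
    ultimately have "\<exists>y\<in>?X. \<forall>u\<in>?X. \<not> E u y" by (rule minimal)
    then obtain a where a: "a \<in> ?X" and min: "\<forall>u\<in>?X. \<not> E u a" by (rule bexE)
    obtain b y where b: "r a y" "r b y" "a \<noteq> b" using a by blast
    have uniq: "t = t'" if "E t a" "r t u" "r t' u" for t t' u
      using min that rH[OF that(2)] HM by blast
    obtain u where u: "u \<in> H" "E u a \<longleftrightarrow> \<not> E u b" using H_ext[OF rH[OF b(1)] rH[OF b(2)] b(3)] by blast
    obtain v where v: "r u v" using r_ex[OF u(1)] by blast
    show False
    proof (cases "E u a")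
      case True
      then have "E v y" using r_mem[OF b(1)] v by blast
      then obtain t where "E t b" "r t v" using r_mem[OF b(2)] by blast
      then show False using uniq[OF True v] u(2) True by blast
    next
      case False
      then have "E v y" using r_mem[OF b(2)] v u(2) by blast
      then obtain t where "E t a" "r t v" using r_mem[OF b(1)] by blast
      then show False using uniq[OF _ _ v] False by blast
    qed
  qed
  \<comment> \<open>Minimal counterexample again: \<open>W\<close> is transitive, so all elements of
    \<open>b\<close> are in the hull and fixed.\<close>
  have r_id: "r a a" if "E a W" for a
  proof (rule ccontr)
    assume "\<not> r a a"
    let ?X = "{x\<in>ext W. \<not> r x x}"
    have "small ?X" by (rule small_sep[OF small_ext]) (intro pdef_intros pr_def')
    moreover have "?X \<noteq> {}" using that \<open>\<not> r a a\<close> by auto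
    ultimately have "\<exists>y\<in>?X. \<forall>u\<in>?X. \<not> E u y" by (rule minimal)
    then obtain b where b: "b \<in> ?X" and min: "\<forall>u\<in>?X. \<not> E u b" by (rule bexE)
    obtain y where y: "r b y" using r_ex[OF WH] b by blast
    have id: "r u u" if "E u b" for u using min b W(4) that unfolding transitive_def by blast
    have "E u y \<longleftrightarrow> E u b" for u unfolding r_mem[OF y] using id r_fun by metis
    then have "y = b" by (intro extensionality allI)
    then show False using y b by simp
  qed
  define N where "N = {y. \<exists>x. r x y}"
  have ND: "N \<subseteq> D" unfolding N_def r_def using D(1) \<open>N' \<in> D\<close> unfolding transitive_class_def by blast
  have tN: "transitive_class E N" unfolding transitive_class_def N_def using r_mem by blast
  have "sat H E e' \<phi> \<longleftrightarrow> sat N E e' \<phi>"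
  proof (rule sat_iso[of H N r])
    show "\<exists>y\<in>N. r x y" if "x \<in> H" for x using r_ex[OF that] unfolding N_def by blast
    show "\<exists>x\<in>H. r x y" if "y \<in> N" for y using that rH unfolding N_def by blast
    show "r (e' i) (e' i)" for i by (rule r_id[OF e'])
    show "(x = x' \<longleftrightarrow> y = y') \<and> (E x x' \<longleftrightarrow> E y y')" if r: "r x y" "r x' y'" for x y x' y'
    proof -
      have "x = x' \<longleftrightarrow> y = y'" using r r_fun r_inj by blast
      moreover have "E x x' \<longleftrightarrow> E y y'" unfolding r_mem[OF r(2)] using r(1) r_inj by blast
      ultimately show ?thesis ..
    qed
  qed
  then have "sat N E e' \<phi>" using satH by blast
  then have "sat D E e' \<phi>"
    by (rule Sigma1_upward[OF \<phi>(1) tN D(1) ND, rotated]) (use r_id[OF e'] N_def in blast)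
  then show ?thesis using e'_sat by blast
qed

end

section \<open>The maximality principle implies correctness\<close>

context zfc_model begin

text \<open>\<open>is_pair\<close> quantifies over all sets; the bounded form says that
  \<open>p\<close> contains \<open>{a}\<close> and \<open>{a, b}\<close> and nothing else.\<close>

lemma d0_is_pair: "d0 E (\<lambda>e. is_pair E (e i) (e j) (e k))"
proof -
  define S where "S z a b \<longleftrightarrow> E a z \<and> E b z \<and> (\<forall>u. E u z \<longrightarrow> u = a \<or> u = b)" for z a b
  have S: "S z a b \<longleftrightarrow> z = mk {a, b}" for z a b
    using E_mk[OF small_upair, of _ a b] extensionality[of z "mk {a, b}"] unfolding S_def by auto
  have "is_pair E p a b \<longleftrightarrow> (\<exists>z. E z p \<and> S z a a) \<and> (\<exists>z. E z p \<and> S z a b) \<and> (\<forall>z. E z p \<longrightarrow> S z a a \<or> S z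
      a b)" for p a b
  proof -
    have "(\<exists>z. E z p \<and> z = mk {a}) \<and> (\<exists>z. E z p \<and> z = mk {a, b}) \<and> (\<forall>z. E z p \<longrightarrow> z = mk {a} \<or> z = mk
        {a, b}) \<longleftrightarrow>
      (\<forall>z. E z p \<longleftrightarrow> z = mk {a} \<or> z = mk {a, b})" by blast
    also have "\<dots> \<longleftrightarrow> p = pr a b"
      using E_mk[OF small_upair, of _ "mk {a}" "mk {a, b}"] extensionality[of p "pr a b"] unfolding
          pr_def by auto
    finally show ?thesis unfolding is_pair_iff S by simp
  qed
  then show ?thesis unfolding S_def by (simp only:) (intro d0_intros)
qed

lemma d0_maps_to: "d0 E (\<lambda>e. maps_to E (e i) (e j) (e k))"
  unfolding maps_to_def by (intro d0_intros d0_is_pair)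

lemma d0_transitive: "d0 E (\<lambda>e. transitive E (e i))"
proof -
  have "transitive E x \<longleftrightarrow> (\<forall>y. E y x \<longrightarrow> (\<forall>z. E z y \<longrightarrow> E z x))" for x unfolding transitive_def by blast
  then show ?thesis by (simp only:) (intro d0_intros)
qed

lemma d0_collapse: "d0 E (\<lambda>e. collapse (e i) (e j) (e k) (e l))"
  unfolding collapse_def by (intro d0_intros d0_maps_to d0_transitive)

lemma d0_pairs:
  "d0 E (\<lambda>e. E (e i) (e j) \<and> (\<forall>a. E a (e k) \<longrightarrow> E a (e j)) \<and> transitive E (e j) \<and> pair_closed (e j))"
proof -
  have "pair_closed W \<longleftrightarrow> (\<forall>a. E a W \<longrightarrow> (\<forall>b. E b W \<longrightarrow> (\<exists>p. E p W \<and> is_pair E p a b)))" for W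
    unfolding pair_closed_def is_pair_iff by blast
  then show ?thesis by (simp only:) (intro d0_intros d0_transitive d0_is_pair)
qed

text \<open>The conjunct \<open>True\<close> gives the existential the shape that
  \<open>d0_bex\<close> matches.\<close>

lemma d0_minimal:
  "d0 E (\<lambda>e. (\<forall>x. E x (e i) \<longrightarrow> E x (e j)) \<and> (\<exists>x. E x (e i) \<and> True) \<longrightarrow>
     (\<exists>x. E x (e i) \<and> (\<forall>y. E y (e i) \<longrightarrow> \<not> maps_to E (e k) y x)))"
  by (intro d0_intros d0_maps_to)

lemma V_subset_closed: "Ord E \<gamma> \<Longrightarrow> x \<in> ext (V \<gamma>) \<Longrightarrow> (\<forall>z. E z y \<longrightarrow> E z x) \<Longrightarrow> y \<in> ext (V \<gamma>)"
  using V_subset by blast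

lemma d0_formula:
  assumes "d0 E P"
  shows "\<exists>\<phi>. Delta0 \<phi> \<and> (\<forall>D e. transitive_class E D \<longrightarrow> (\<forall>i. e i \<in> D) \<longrightarrow> (sat D E e \<phi> \<longleftrightarrow> P e))"
proof -
  obtain \<phi> where "Delta0 \<phi>" "\<And>e. P e \<longleftrightarrow> sat UNIV E e \<phi>" using assms unfolding d0_def by blast
  then show ?thesis using Delta0_absolute[of \<phi> E] by (intro exI[of _ \<phi>]) simp
qed

lemma transitive_class_UNIV: "transitive_class E UNIV"
  unfolding transitive_class_def by simp

text \<open>Each instance of the two closure properties is a true Sigma 1 statement about parameters
  in \<open>D\<close>, witnessed by \<open>collapse_exists\<close> and
  \<open>pair_closed_superset\<close>.\<close>

lemma correct_1_closed:
  assumes c1: "correct 1 E D" and D: "transitive_class E D"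
  shows "collapse_closed D" "pairs_closed D"
proof -
  obtain \<phi> where \<phi>: "Delta0 \<phi>" "\<forall>D e. transitive_class E D \<longrightarrow> (\<forall>i. e i \<in> D) \<longrightarrow> (sat D E e \<phi> \<longleftrightarrow> collapse
      (e 0) (e 1) (e 2) (e 3))"
    using d0_formula[OF d0_collapse[of 0 1 2 3]] by (elim exE conjE)
  have S: "Sigma_fm 1 (Exists 0 (Exists 1 \<phi>))" using \<phi>(1) by (simp add: Sigma_fm_Pi_fm.intros)
  show "collapse_closed D" unfolding collapse_closed_def
  proof (intro ballI impI)
    fix d R assume dR: "d \<in> D" "R \<in> D" "wf_rel d R"
    let ?e = "\<lambda>i::nat. if i = 2 then d else R"
    obtain \<pi> r where "collapse \<pi> r d R" using collapse_exists[OF dR(3)] by blast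
    then have "sat UNIV E ?e (Exists 0 (Exists 1 \<phi>))" using \<phi>(2) transitive_class_UNIV by auto
    then have "sat D E ?e (Exists 0 (Exists 1 \<phi>))"
      by (rule iffD2[OF c1[unfolded correct_def, rule_format], rotated]) (use S dR in simp)
    then obtain \<pi> r where "\<pi> \<in> D" "r \<in> D" "sat D E (?e(0 := \<pi>, 1 := r)) \<phi>" by auto
    moreover from this have "collapse \<pi> r d R" using \<phi>(2)[rule_format, OF D, of "?e(0 := \<pi>, 1 :=
        r)"] dR by simp
    ultimately show "\<exists>\<pi>\<in>D. \<exists>r\<in>D. collapse \<pi> r d R" by blast
  qed
  let ?P = "\<lambda>x W w. E x W \<and> (\<forall>a. E a w \<longrightarrow> E a W) \<and> transitive E W \<and> pair_closed W"
  obtain \<psi> where \<psi>: "Delta0 \<psi>" "\<forall>D e. transitive_class E D \<longrightarrow> (\<forall>i. e i \<in> D) \<longrightarrow> (sat D E e \<psi> \<longleftrightarrow> ?P (e 1)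
      (e 0) (e 2))"
    using d0_formula[OF d0_pairs[of 1 0 2]] by (elim exE conjE)
  have S: "Sigma_fm 1 (Exists 0 \<psi>)" using \<psi>(1) by (simp add: Sigma_fm_Pi_fm.intros)
  show "pairs_closed D" unfolding pairs_closed_def
  proof (intro ballI)
    fix x w assume xw: "x \<in> D" "w \<in> D"
    let ?e = "\<lambda>i::nat. if i = 1 then x else w"
    obtain W where "E x W" "\<And>a. E a w \<Longrightarrow> E a W" "transitive E W" "pair_closed W"
      using pair_closed_superset[of x w] by metis
    then have "sat UNIV E (?e(0 := W)) \<psi>" using \<psi>(2) transitive_class_UNIV by simp
    then have "sat UNIV E ?e (Exists 0 \<psi>)" by auto
    then have "sat D E ?e (Exists 0 \<psi>)"
      by (rule iffD2[OF c1[unfolded correct_def, rule_format], rotated]) (use S xw in simp)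
    then obtain W where "W \<in> D" "sat D E (?e(0 := W)) \<psi>" by auto
    moreover from this have "?P x W w" using \<psi>(2)[rule_format, OF D, of "?e(0 := W)"] xw by simp
    ultimately show "\<exists>W\<in>D. ?P x W w" by blast
  qed
qed

lemma reflecting_formula:
  "\<exists>\<phi>. \<forall>\<gamma> e. Ord E \<gamma> \<longrightarrow> (\<forall>i. E (e i) (V \<gamma>)) \<longrightarrow>
     (sat (ext (V \<gamma>)) E e \<phi> \<longleftrightarrow> collapse_closed (ext (V \<gamma>)) \<and> pairs_closed (ext (V \<gamma>)))"
proof -
  define M where "M s d R \<longleftrightarrow> (\<forall>x. E x s \<longrightarrow> E x d) \<and> (\<exists>x. E x s \<and> True) \<longrightarrow>
     (\<exists>x. E x s \<and> (\<forall>y. E y s \<longrightarrow> \<not> maps_to E R y x))" for s d R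
  have dM: "d0 E (\<lambda>e. M (e 0) (e 2) (e 3))" unfolding M_def by (rule d0_minimal)
  obtain \<mu> where \<mu>: "Delta0 \<mu>" "\<forall>D e. transitive_class E D \<longrightarrow> (\<forall>i. e i \<in> D) \<longrightarrow> (sat D E e \<mu> \<longleftrightarrow> M (e 0)
      (e 2) (e 3))"
    using d0_formula[OF dM] by (elim exE conjE)
  obtain \<phi> where \<phi>: "Delta0 \<phi>" "\<forall>D e. transitive_class E D \<longrightarrow> (\<forall>i. e i \<in> D) \<longrightarrow> (sat D E e \<phi> \<longleftrightarrow> collapse
      (e 0) (e 1) (e 2) (e 3))"
    using d0_formula[OF d0_collapse[of 0 1 2 3]] by (elim exE conjE)
  define P where "P x W w \<longleftrightarrow> E x W \<and> (\<forall>a. E a w \<longrightarrow> E a W) \<and> transitive E W \<and> pair_closed W" for x W w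
  obtain \<psi> where \<psi>: "Delta0 \<psi>" "\<forall>D e. transitive_class E D \<longrightarrow> (\<forall>i. e i \<in> D) \<longrightarrow> (sat D E e \<psi> \<longleftrightarrow> P (e 1)
      (e 0) (e 2))"
    using d0_formula[OF d0_pairs[of 1 0 2, folded P_def]] by (elim exE conjE)
  let ?\<rho> = "Conj (Forall 2 (Forall 3 (Neg (Conj (Forall 0 \<mu>) (Neg (Exists 0 (Exists 1 \<phi>)))))))
      (Forall 1 (Forall 2 (Exists 0 \<psi>)))"
  have "sat (ext (V \<gamma>)) E e ?\<rho> \<longleftrightarrow> collapse_closed (ext (V \<gamma>)) \<and> pairs_closed (ext (V \<gamma>))"
    if \<gamma>: "Ord E \<gamma>" and e: "\<forall>i. E (e i) (V \<gamma>)" for \<gamma> e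
  proof -
    define D where "D = ext (V \<gamma>)"
    note t = transitive_class_V[OF \<gamma>, folded D_def]
    have eD: "e i \<in> D" for i using e unfolding D_def by simp
    \<comment> \<open>A level contains all subsets of its elements, so it is right about
      well-foundedness.\<close>
    have "(\<forall>s\<in>D. M s d R) \<longleftrightarrow> wf_rel d R" if "d \<in> D" for d R
    proof -
      have "s \<in> D" if "\<forall>x. E x s \<longrightarrow> E x d" for s
        using V_subset_closed[OF \<gamma>, of d s] \<open>d \<in> D\<close> that unfolding D_def by blast
      then show ?thesis unfolding M_def wf_rel_def by auto
    qed
    then have "sat D E e ?\<rho> \<longleftrightarrow> collapse_closed D \<and> pairs_closed D"
      unfolding collapse_closed_def pairs_closed_def P_def[symmetric] by (simp add: \<mu>(2) \<phi>(2) \<psi>(2) t eD)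
    then show ?thesis unfolding D_def .
  qed
  then show ?thesis by blast
qed

text \<open>Correctness is climbed level by level: the upward half follows from the level below (at
  first from absoluteness), the downward half is \<open>MP\<close> applied to an eventually true
  assertion.\<close>

theorem maximality_imp_correct:
  assumes \<delta>: "Ord E \<delta>"
    and MP: "\<And>\<phi> e \<alpha>. \<forall>i\<in>fv \<phi>. E (e i) (V \<delta>) \<Longrightarrow> Ord E \<alpha> \<Longrightarrow>
      (\<And>\<gamma>. Ord E \<gamma> \<Longrightarrow> ord_le E \<alpha> \<gamma> \<Longrightarrow> sat (ext (V \<gamma>)) E e \<phi>) \<Longrightarrow> sat (ext (V \<delta>)) E e \<phi>"
  shows "correct 3 E (ext (V \<delta>))"
proof -
  define D where "D = ext (V \<delta>)"
  have D: "transitive_class E D" unfolding D_def by (rule transitive_class_V[OF \<delta>])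
  obtain \<alpha>0 x0 where \<alpha>0: "Ord E \<alpha>0" "E x0 (V \<alpha>0)" using in_some_V by blast
  \<comment> \<open>Existence of a set is eventually true, so \<open>V \<delta>\<close> is not
    empty; \<open>c\<close> later serves as default parameter.\<close>
  have "sat (ext (V \<delta>)) E e (Exists 0 (Eq 0 0))" for e
    by (rule MP[OF _ \<alpha>0(1)]) (use V_mono[OF _ _ \<alpha>0(2)] in auto)
  then obtain c where c: "c \<in> D" unfolding D_def by auto
  have up: "y \<in> ext (V \<gamma>)" if "Ord E \<gamma>" "ord_le E \<delta> \<gamma>" "y \<in> D" for \<gamma> y
    using V_mono[OF that(1,2)] that(3) unfolding D_def by blast
  have c1: "correct 1 E D" unfolding correct_def
  proof (intro allI impI, elim conjE)
    fix \<phi> e assume \<phi>: "Sigma_fm 1 \<phi>" "\<forall>i\<in>fv \<phi>. e i \<in> D"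
    show "sat D E e \<phi> \<longleftrightarrow> sat UNIV E e \<phi>"
    proof
      assume "sat D E e \<phi>"
      from Sigma1_upward[OF \<phi>(1) D _ _ \<phi>(2) this] show "sat UNIV E e \<phi>"
        by (simp add: transitive_class_def)
    next
      assume "sat UNIV E e \<phi>"
      have "sat (ext (V \<gamma>)) E e \<psi>" if "Pi_fm 0 \<psi>" "sat UNIV E e \<psi>" "Ord E \<gamma>" "\<forall>i\<in>fv \<psi>. E (e i) (V
          \<gamma>)" for \<psi> e \<gamma>
        using Delta0_absolute[OF Pi_0_Delta0[OF that(1)] transitive_class_V[OF that(3)]] that by simp
      then obtain \<alpha> where "Ord E \<alpha>" "\<forall>\<gamma>. Ord E \<gamma> \<longrightarrow> ord_le E \<alpha> \<gamma> \<longrightarrow> sat (ext (V \<gamma>)) E e \<phi>"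
        using eventually_sat_Sigma_Suc[of 0 "\<lambda>_. True" \<phi> e] \<phi>(1) \<open>sat UNIV E e \<phi>\<close> by auto
      then show "sat D E e \<phi>" unfolding D_def using MP[of \<phi> e \<alpha>] \<phi>(2) unfolding D_def by simp
    qed
  qed
  have closed: "collapse_closed D" "pairs_closed D" using correct_1_closed[OF c1 D] by blast+
  have c2: "correct 2 E D" unfolding correct_def
  proof (intro allI impI, elim conjE)
    fix \<phi> e assume \<phi>: "Sigma_fm 2 \<phi>" "\<forall>i\<in>fv \<phi>. e i \<in> D"
    have \<phi>2: "Sigma_fm (Suc 1) \<phi>" using \<phi>(1) by (simp add: numeral_2_eq_2)
    show "sat D E e \<phi> \<longleftrightarrow> sat UNIV E e \<phi>"
    proof
      assume "sat D E e \<phi>"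
      then show "sat UNIV E e \<phi>" by (rule correct_Sigma_Suc_upward[OF c1 \<phi>2 \<phi>(2)])
    next
      assume "sat UNIV E e \<phi>"
      have base: "sat (ext (V \<gamma>)) E e \<psi>"
        if \<psi>: "Pi_fm 1 \<psi>" "sat UNIV E e \<psi>" "Ord E \<gamma>" True "\<forall>i\<in>fv \<psi>. E (e i) (V \<gamma>)" for \<psi> e \<gamma>
      proof (rule Pi_downward[of 0])
        show "Pi_fm (Suc 0) \<psi>" "\<forall>i\<in>fv \<psi>. e i \<in> ext (V \<gamma>)" "sat UNIV E e \<psi>" using \<psi> by simp_all
        show "sat (ext (V \<gamma>)) E e \<chi>" if "Sigma_fm 0 \<chi>" "\<forall>i\<in>fv \<chi>. e i \<in> ext (V \<gamma>)" "sat UNIV E e \<chi>"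
            for \<chi> e
          using Delta0_absolute[OF Sigma_0_Delta0[OF that(1)] transitive_class_V[OF \<psi>(3)] that(2)]
              that(3) by blast
      qed
      have "\<exists>\<alpha>. Ord E \<alpha> \<and> (\<forall>\<gamma>. Ord E \<gamma> \<longrightarrow> ord_le E \<alpha> \<gamma> \<longrightarrow> True \<longrightarrow> sat (ext (V \<gamma>)) E e \<phi>)"
        by (rule eventually_sat_Sigma_Suc[of 1 "\<lambda>_. True", OF _ \<phi>2 \<open>sat UNIV E e \<phi>\<close>]) (rule base)
      then obtain \<alpha> where "Ord E \<alpha>" "\<And>\<gamma>. Ord E \<gamma> \<Longrightarrow> ord_le E \<alpha> \<gamma> \<Longrightarrow> sat (ext (V \<gamma>)) E e \<phi>" by blast
      then show "sat D E e \<phi>" unfolding D_def using MP[of \<phi> e \<alpha>] \<phi>(2) unfolding D_def by simp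
    qed
  qed
  show ?thesis unfolding correct_def D_def[symmetric]
  proof (intro allI impI, elim conjE)
    fix \<phi> e assume \<phi>: "Sigma_fm 3 \<phi>" "\<forall>i\<in>fv \<phi>. e i \<in> D"
    have \<phi>3: "Sigma_fm (Suc 2) \<phi>" using \<phi>(1) by (simp add: eval_nat_numeral)
    show "sat D E e \<phi> \<longleftrightarrow> sat UNIV E e \<phi>"
    proof
      assume "sat D E e \<phi>"
      then show "sat UNIV E e \<phi>" by (rule correct_Sigma_Suc_upward[OF c2 \<phi>3 \<phi>(2)])
    next
      assume sat: "sat UNIV E e \<phi>"
      \<comment> \<open>\<open>c\<close> is listed because Levy's argument needs an element of the
        level to start from.\<close>
      let ?Q = "\<lambda>\<gamma>. E c (V \<gamma>) \<and> collapse_closed (ext (V \<gamma>)) \<and> pairs_closed (ext (V \<gamma>))"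
      have base: "sat (ext (V \<gamma>)) E e \<psi>"
        if \<psi>: "Pi_fm 2 \<psi>" "sat UNIV E e \<psi>" "Ord E \<gamma>" "?Q \<gamma>" "\<forall>i\<in>fv \<psi>. E (e i) (V \<gamma>)" for \<psi> e \<gamma>
      proof (rule Pi_downward[of 1])
        show "Pi_fm (Suc 1) \<psi>" "\<forall>i\<in>fv \<psi>. e i \<in> ext (V \<gamma>)" "sat UNIV E e \<psi>" using \<psi> by (simp_all add:
            numeral_2_eq_2)
        show "sat (ext (V \<gamma>)) E e \<chi>" if "Sigma_fm 1 \<chi>" "\<forall>i\<in>fv \<chi>. e i \<in> ext (V \<gamma>)" "sat UNIV E e \<chi>"
            for \<chi> e
        proof (rule Levy_reflection[where ?x0.0 = c, OF transitive_class_V[OF \<psi>(3)] _ _ _ _ that])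
          show "y \<in> ext (V \<gamma>)" if "x \<in> ext (V \<gamma>)" "\<forall>z. E z y \<longrightarrow> E z x" for x y
            by (rule V_subset_closed[OF \<psi>(3) that])
        qed (use \<psi>(4) in simp_all)
      qed
      have "\<exists>\<alpha>. Ord E \<alpha> \<and> (\<forall>\<gamma>. Ord E \<gamma> \<longrightarrow> ord_le E \<alpha> \<gamma> \<longrightarrow> ?Q \<gamma> \<longrightarrow> sat (ext (V \<gamma>)) E e \<phi>)"
        by (rule eventually_sat_Sigma_Suc[of 2 ?Q, OF _ \<phi>3 sat]) (rule base)
      then obtain \<alpha> where \<alpha>: "Ord E \<alpha>" "\<forall>\<gamma>. Ord E \<gamma> \<longrightarrow> ord_le E \<alpha> \<gamma> \<longrightarrow> ?Q \<gamma> \<longrightarrow> sat (ext (V \<gamma>)) E e \<phi>"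
        by (elim exE conjE)
      define e' where "e' i = (if i \<in> fv \<phi> then e i else c)" for i
      obtain \<rho> where \<rho>: "\<And>\<gamma> e. Ord E \<gamma> \<Longrightarrow> (\<And>i. E (e i) (V \<gamma>)) \<Longrightarrow>
          sat (ext (V \<gamma>)) E e \<rho> \<longleftrightarrow> collapse_closed (ext (V \<gamma>)) \<and> pairs_closed (ext (V \<gamma>))"
        using reflecting_formula by blast
      have e'_D: "e' i \<in> D" for i unfolding e'_def using \<phi>(2) c by simp
      obtain \<beta> where \<beta>: "Ord E \<beta>" "ord_le E \<alpha> \<beta>" "ord_le E \<delta> \<beta>" using Ord_max[OF \<alpha>(1) \<delta>] .
      have e'_sat: "sat A E e' \<phi> \<longleftrightarrow> sat A E e \<phi>" for A by (rule sat_cong) (simp add: e'_def)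
      \<comment> \<open>\<open>\<phi>\<close> may fail at levels that do not reflect, so the
        eventually true assertion is the implication from \<open>\<rho>\<close> to
        \<open>\<phi>\<close>. Its premise holds at \<delta> because \<delta> is already Sigma 1
        correct.\<close>
      have "sat (ext (V \<delta>)) E e' (Neg (Conj \<rho> (Neg \<phi>)))"
      proof (rule MP[OF _ \<beta>(1)])
        show "\<forall>i\<in>fv (Neg (Conj \<rho> (Neg \<phi>))). E (e' i) (V \<delta>)" using e'_D unfolding D_def by simp
        fix \<gamma> assume \<gamma>: "Ord E \<gamma>" "ord_le E \<beta> \<gamma>"
        have le: "ord_le E \<alpha> \<gamma>" "ord_le E \<delta> \<gamma>" using ord_le_trans[OF \<gamma>(1) _ \<gamma>(2)] \<beta> by blast+
        then have "E c (V \<gamma>)" "\<And>i. E (e' i) (V \<gamma>)" using up[OF \<gamma>(1) le(2)] c e'_D by simp_all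
        then show "sat (ext (V \<gamma>)) E e' (Neg (Conj \<rho> (Neg \<phi>)))"
          using \<alpha>(2) \<gamma>(1) le(1) e'_sat \<rho>[OF \<gamma>(1)] by auto
      qed
      then show "sat D E e \<phi>" using e'_sat \<rho>[OF \<delta>] e'_D closed unfolding D_def by simp
    qed
  qed
qed

end

section \<open>Correctness makes every type recur\<close>

text \<open>\<open>\<exists>h. \<forall>x. level_at E v h x\<close> says that \<open>v\<close> is some \<open>V\<^sub>\<zeta>\<close>, with \<open>h = {V\<^sub>\<xi> | \<xi> < \<zeta>}\<close>; the
  quantifier over \<open>x\<close> is kept in front so that the matrix is bounded.\<close>

definition level_at :: "('v \<Rightarrow> 'v \<Rightarrow> bool) \<Rightarrow> 'v \<Rightarrow> 'v \<Rightarrow> 'v \<Rightarrow> bool" where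
  "level_at E v h x \<longleftrightarrow>
     (\<forall>y. E y v \<longrightarrow> (\<exists>w. E w h \<and> (\<forall>z. E z y \<longrightarrow> E z w))) \<and>
     (\<forall>w. E w h \<longrightarrow> (\<forall>z. E z x \<longrightarrow> E z w) \<longrightarrow> E x v) \<and>
     (\<forall>u. E u h \<longrightarrow>
        (\<forall>y. E y u \<longrightarrow> (\<exists>w. E w h \<and> E w u \<and> (\<forall>z. E z y \<longrightarrow> E z w))) \<and>
        (\<forall>w. E w h \<longrightarrow> E w u \<longrightarrow> (\<forall>z. E z x \<longrightarrow> E z w) \<longrightarrow> E x u))"

lemma d0_level_at: "d0 E (\<lambda>e. level_at E (e i) (e j) (e k))"
  unfolding level_at_def by (intro d0_intros)

context zfc_model begin

text \<open>By the third clause, a minimal non-level \<open>u\<close> in \<open>h\<close> would be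
  built from the levels in \<open>h\<close> below it as \<open>level_of_levels\<close> builds a
  level. So \<open>h\<close> is a set of levels, and the first two clauses give the same for
  \<open>v\<close>.\<close>

lemma level_iff: "(\<exists>h. \<forall>x. level_at E v h x) \<longleftrightarrow> (\<exists>\<zeta>. Ord E \<zeta> \<and> v = V \<zeta>)"
proof
  assume "\<exists>h. \<forall>x. level_at E v h x"
  then obtain h where h: "\<And>x. level_at E v h x" by blast
  have v: "E x v \<longleftrightarrow> (\<exists>w. E w h \<and> (\<forall>z. E z x \<longrightarrow> E z w))" for x
    using h[of x] unfolding level_at_def by blast
  have u: "E x u \<longleftrightarrow> (\<exists>w. E w h \<and> E w u \<and> (\<forall>z. E z x \<longrightarrow> E z w))" if "E u h" for u x
    using h[of x] that unfolding level_at_def by blast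
  have lev: "\<exists>\<xi>. Ord E \<xi> \<and> u = V \<xi>" if "E u h" for u
  proof (rule ccontr)
    assume n: "\<not> ?thesis"
    let ?X = "{u\<in>ext h. \<not> (\<exists>\<xi>. Ord E \<xi> \<and> u = V \<xi>)}"
    have "small ?X" by (rule small_sep[OF small_ext]) (intro pdef_intros pdef_Ord pterm_V)
    moreover have "?X \<noteq> {}" using n that by auto
    ultimately have "\<exists>y\<in>?X. \<forall>u\<in>?X. \<not> E u y" by (rule minimal)
    then obtain b where b: "b \<in> ?X" and min: "\<forall>u\<in>?X. \<not> E u b" by (rule bexE)
    have small_h: "small {w\<in>ext h. E w b}" by (rule small_sep[OF small_ext]) (intro pdef_intros)
    define h' where "h' = mk {w\<in>ext h. E w b}"
    have h': "E w h' \<longleftrightarrow> E w h \<and> E w b" for w unfolding h'_def E_mk[OF small_h] by simp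
    have "\<exists>\<xi>. Ord E \<xi> \<and> w = V \<xi>" if "E w h'" for w using min that unfolding h' by blast
    then have "\<exists>\<zeta>. Ord E \<zeta> \<and> (\<forall>x. E x (V \<zeta>) \<longleftrightarrow> (\<exists>w. E w h' \<and> (\<forall>z. E z x \<longrightarrow> E z w)))"
      by (rule level_of_levels)
    then obtain \<zeta> where \<zeta>: "Ord E \<zeta>" "\<And>x. E x (V \<zeta>) \<longleftrightarrow> (\<exists>w. E w h' \<and> (\<forall>z. E z x \<longrightarrow> E z w))" by blast
    have "E b h" using b by simp
    have "E x b \<longleftrightarrow> E x (V \<zeta>)" for x by (simp only: u[OF \<open>E b h\<close>, of x] \<zeta>(2)[of x] h' conj_assoc)
    then have "b = V \<zeta>" by (intro extensionality allI)
    then show False using b \<zeta>(1) by blast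
  qed
  obtain \<zeta> where \<zeta>: "Ord E \<zeta>" "\<And>x. E x (V \<zeta>) \<longleftrightarrow> (\<exists>w. E w h \<and> (\<forall>z. E z x \<longrightarrow> E z w))"
    using level_of_levels[OF lev] by blast
  have "v = V \<zeta>" by (intro extensionality allI) (simp only: v \<zeta>(2))
  then show "\<exists>\<zeta>. Ord E \<zeta> \<and> v = V \<zeta>" using \<zeta>(1) by blast
next
  assume "\<exists>\<zeta>. Ord E \<zeta> \<and> v = V \<zeta>"
  then obtain \<zeta> where \<zeta>: "Ord E \<zeta>" "v = V \<zeta>" by blast
  have small_h: "small (V ` ext \<zeta>)" by (intro small_image small_ext pterm_V pterm_var)
  define h where "h = mk (V ` ext \<zeta>)"
  have h: "E w h \<longleftrightarrow> (\<exists>\<xi>. E \<xi> \<zeta> \<and> w = V \<xi>)" for w unfolding h_def E_mk[OF small_h] by auto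
  have "level_at E v h x" for x unfolding level_at_def
  proof (intro conjI allI impI)
    show "\<exists>w. E w h \<and> (\<forall>z. E z y \<longrightarrow> E z w)" if "E y v" for y
      using that unfolding \<zeta>(2) E_V[OF \<zeta>(1)] h by blast
    show "E x v" if "E w h" "\<forall>z. E z x \<longrightarrow> E z w" for w
      using that unfolding \<zeta>(2) E_V[OF \<zeta>(1)] h by blast
  next
    fix u assume "E u h"
    then obtain \<xi> where \<xi>: "E \<xi> \<zeta>" "u = V \<xi>" unfolding h by blast
    have o\<xi>: "Ord E \<xi>" using Ord_elem[OF \<zeta>(1) \<xi>(1)] .
    show "\<exists>w. E w h \<and> E w u \<and> (\<forall>z. E z y \<longrightarrow> E z w)" if y: "E y u" for y
    proof -
      obtain \<eta> where "E \<eta> \<xi>" "\<forall>z. E z y \<longrightarrow> E z (V \<eta>)" using y unfolding \<xi>(2) E_V[OF o\<xi>] by blast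
      then show ?thesis using V_mem[OF o\<xi>, of \<eta>] Ord_trans[OF \<zeta>(1) \<xi>(1)] h[of "V \<eta>"] \<xi>(2) by blast
    qed
    show "E x u" if w: "E w h" "E w u" "\<forall>z. E z x \<longrightarrow> E z w" for w
    proof -
      obtain \<eta> where "E \<eta> \<zeta>" "w = V \<eta>" using w(1) unfolding h by blast
      then have "E \<eta> \<xi>" using V_mem_iff[OF Ord_elem[OF \<zeta>(1)] o\<xi>, of \<eta>] w(2) \<xi>(2) by simp
      then show ?thesis unfolding \<xi>(2) E_V[OF o\<xi>] using w(3) \<open>w = V \<eta>\<close> by blast
    qed
  qed
  then show "\<exists>h. \<forall>x. level_at E v h x" by blast
qed

lemma correct_imp_type_recurs:
  fixes \<sigma> :: "nat \<Rightarrow> 'v assertion"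
  assumes \<delta>: "Ord E \<delta>" and corr: "correct 3 E (ext (V \<delta>))" and A: "finite A"
    and \<sigma>: "\<And>n i. n \<in> A \<Longrightarrow> i \<in> fv (fst (\<sigma> n)) \<Longrightarrow> E (snd (\<sigma> n) i) (V \<delta>)"
    and c: "E c (V \<delta>)"
    and \<gamma>: "Ord E \<gamma>" "ord_le E \<delta> \<gamma>" and \<alpha>: "Ord E \<alpha>"
  shows "\<exists>\<beta>. Ord E \<beta> \<and> ord_le E \<alpha> \<beta> \<and>
    (\<forall>n\<in>A. sat (ext (V \<beta>)) E (snd (\<sigma> n)) (fst (\<sigma> n)) \<longleftrightarrow> sat (ext (V \<gamma>)) E (snd (\<sigma> n)) (fst (\<sigma> n)))"
proof (rule ccontr)
  assume n: "\<not> ?thesis"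
  define w where "w n \<longleftrightarrow> sat (ext (V \<gamma>)) E (snd (\<sigma> n)) (fst (\<sigma> n))" for n
  define T where "T v \<longleftrightarrow> (\<forall>n\<in>A. sat (ext v) E (snd (\<sigma> n)) (fst (\<sigma> n)) \<longleftrightarrow> w n)" for v
  have noT: "\<not> T (V \<beta>)" if "Ord E \<beta>" "ord_le E \<alpha> \<beta>" for \<beta> using n that unfolding T_def w_def by blast
  \<comment> \<open>One environment carries the parameters of all assertions, variable
    \<open>i\<close> of assertion \<open>n\<close> at \<open>prod_encode (n, i) + 4\<close>; the
    variables 0 to 3 are left to \<open>x\<close>, \<open>h\<close>, \<open>v\<close> and
    \<open>a\<close>.\<close>
  define e0 where "e0 k = (case prod_decode k of (n, i) \<Rightarrow> if n \<in> A \<and> i \<in> fv (fst (\<sigma> n)) then snd (\<sigma>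
      n) i else c)" for k
  have e0: "E (e0 k) (V \<delta>)" for k unfolding e0_def using \<sigma> c by (auto split: prod.split)
  define \<Theta> where "\<Theta> e \<longleftrightarrow> \<not> (E (e 3) (e 2) \<and> level_at E (e 2) (e 1) (e 0) \<and>
     (\<forall>n\<in>A. sat {x. E x (e 2)} E (\<lambda>i. e ((\<lambda>i. prod_encode (n, i) + 4) i)) (fst (\<sigma> n)) \<longleftrightarrow> w n))" for e
  have "d0 E \<Theta>" unfolding \<Theta>_def[abs_def]
    by (intro d0_neg d0_conj d0_mem d0_level_at d0_finite_ball A d0_iff d0_relativized d0_const)
  then obtain \<theta> where \<theta>: "Delta0 \<theta>" "\<And>e. \<Theta> e \<longleftrightarrow> sat UNIV E e \<theta>" unfolding d0_def by blast
  define \<psi> where "\<psi> = Forall 2 (Forall 1 (Exists 0 \<theta>))"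
  have "Sigma_fm (Suc 0) (Exists 0 \<theta>)" using \<theta>(1) by (simp add: Sigma_fm_Pi_fm.intros)
  then have "Pi_fm (Suc (Suc 0)) \<psi>" unfolding \<psi>_def
    by (rule Sigma_fm_Pi_fm.intros(6)[OF Sigma_fm_Pi_fm.intros(6)[OF Sigma_fm_Pi_fm.intros(5)]])
  then have Pi\<psi>: "Pi_fm 2 \<psi>" by (simp add: numeral_2_eq_2)
  have S\<psi>: "Sigma_fm 3 \<psi>" "Sigma_fm 3 (Exists 3 \<psi>)" using Pi\<psi> by (simp_all add: eval_nat_numeral
      Sigma_fm_Pi_fm.intros)
  have sat_\<psi>: "sat UNIV E e \<psi> \<longleftrightarrow> (\<forall>\<zeta>. Ord E \<zeta> \<longrightarrow> E (e 3) (V \<zeta>) \<longrightarrow> \<not> T (V \<zeta>))" if e: "\<And>k. e (k + 4) = e0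
      k" for e
  proof -
    have "\<Theta> (e(2 := v, 1 := h, 0 := x)) \<longleftrightarrow> \<not> (E (e 3) v \<and> level_at E v h x \<and> T v)" for v h x
    proof -
      have "sat (ext v) E (\<lambda>i. (e(2 := v, 1 := h, 0 := x)) (prod_encode (n, i) + 4)) (fst (\<sigma> n)) \<longleftrightarrow>
        sat (ext v) E (snd (\<sigma> n)) (fst (\<sigma> n))" if "n \<in> A" for n
        by (rule sat_cong) (use e that in \<open>simp add: e0_def\<close>)
      then show ?thesis unfolding \<Theta>_def T_def by simp
    qed
    moreover have "sat UNIV E e \<psi> \<longleftrightarrow> (\<forall>v h. \<exists>x. \<Theta> (e(2 := v, 1 := h, 0 := x)))"
      unfolding \<psi>_def by (simp add: \<theta>(2))
    ultimately have "sat UNIV E e \<psi> \<longleftrightarrow> (\<forall>v h. \<exists>x. \<not> (E (e 3) v \<and> level_at E v h x \<and> T v))"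
      by (simp only:)
    also have "\<dots> \<longleftrightarrow> (\<forall>v. E (e 3) v \<longrightarrow> (\<exists>h. \<forall>x. level_at E v h x) \<longrightarrow> \<not> T v)" by blast
    also have "\<dots> \<longleftrightarrow> (\<forall>\<zeta>. Ord E \<zeta> \<longrightarrow> E (e 3) (V \<zeta>) \<longrightarrow> \<not> T (V \<zeta>))" unfolding level_iff by blast
    finally show ?thesis .
  qed
  define e where "e k = (if k < 4 then c else e0 (k - 4))" for k
  have e: "E (e k) (V \<delta>)" "e (k + 4) = e0 k" for k unfolding e_def using e0 c by auto
  \<comment> \<open>A level that contains \<open>V \<alpha>\<close> has index above \<alpha>, so
    \<open>V \<alpha>\<close> can serve as \<open>a\<close>.\<close>
  have "sat UNIV E (e(3 := V \<alpha>)) \<psi>"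
  proof -
    have "\<not> T (V \<zeta>)" if "Ord E \<zeta>" "E (V \<alpha>) (V \<zeta>)" for \<zeta>
      using noT[OF that(1)] that V_mem_iff[OF \<alpha> that(1)] unfolding ord_le_def by blast
    then show ?thesis using sat_\<psi>[of "e(3 := V \<alpha>)"] e(2) by simp
  qed
  then have "sat UNIV E e (Exists 3 \<psi>)" by auto
  then have "sat (ext (V \<delta>)) E e (Exists 3 \<psi>)" using corr S\<psi>(2) e(1) unfolding correct_def by blast
  then obtain a where a: "E a (V \<delta>)" "sat (ext (V \<delta>)) E (e(3 := a)) \<psi>" by auto
  \<comment> \<open>Correctness is used a second time, to lift the Pi 2 statement about the witness
    \<open>a\<close> back to the universe. There it covers \<open>V \<gamma>\<close>, which contains
    \<open>a\<close>.\<close>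
  then have "sat UNIV E (e(3 := a)) \<psi>" using corr S\<psi>(1) e(1) unfolding correct_def by simp
  then have "\<not> T (V \<gamma>)" using sat_\<psi>[of "e(3 := a)"] e(2) \<gamma> V_mono[OF \<gamma> a(1)] by simp
  then show False unfolding T_def w_def by blast
qed

text \<open>If the valuations realized from \<gamma> on form the same set \<open>T\<close> for every
  \<gamma> from \<delta> on, then a box quantifies over \<open>T\<close> at all these worlds. Used
  with recurring types for validity and with the dial for refutation.\<close>

lemma holds_at_universal_eval:
  assumes w: "\<And>\<gamma> n. Ord E \<gamma> \<Longrightarrow> ord_le E \<delta> \<gamma> \<Longrightarrow> n \<in> A \<Longrightarrow>
      sat (ext (V \<gamma>)) E (snd (\<sigma> n)) (fst (\<sigma> n)) \<longleftrightarrow> w \<gamma> n"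
    and T: "\<And>\<gamma> u. Ord E \<gamma> \<Longrightarrow> ord_le E \<delta> \<gamma> \<Longrightarrow> u \<in> T \<longleftrightarrow> (\<exists>\<beta>. Ord E \<beta> \<and> ord_le E \<gamma> \<beta> \<and> u = w \<beta>)"
  shows "set_mfm q \<subseteq> A \<Longrightarrow> Ord E \<gamma> \<Longrightarrow> ord_le E \<delta> \<gamma> \<Longrightarrow> holds_at E \<gamma> (map_mfm \<sigma> q) \<longleftrightarrow> universal_eval T (w \<gamma>) q"
proof (induction q arbitrary: \<gamma>)
  case (Atom n)
  then show ?case using w Vlevel_eq by simp
next
  case (Box q)
  have IH: "holds_at E \<beta> (map_mfm \<sigma> q) \<longleftrightarrow> universal_eval T (w \<beta>) q" if "Ord E \<beta>" "ord_le E \<gamma> \<beta>" for \<beta>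
    using Box.IH[of \<beta>] Box.prems that ord_le_trans[OF that(1) Box.prems(3) that(2)] by simp
  have "universal_eval T (w \<gamma>) (Box q) \<longleftrightarrow> (\<forall>\<beta>. Ord E \<beta> \<longrightarrow> ord_le E \<gamma> \<beta> \<longrightarrow> universal_eval T (w \<beta>) q)"
    using T[OF Box.prems(2,3)] by auto
  then show ?case using IH by auto
qed auto

lemma correct_imp_S5_valid:
  fixes p :: "nat mfm"
  assumes \<delta>: "Ord E \<delta>" and corr: "correct 3 E (ext (V \<delta>))" and c: "E c (V \<delta>)"
    and p: "p \<in> S5" and \<sigma>: "\<And>n. \<sigma> n \<in> assertions (ext (V \<delta>))"
  shows "holds_at E \<delta> (map_mfm \<sigma> p)"
proof -
  let ?A = "set_mfm p"
  have fin: "finite ?A" by (induction p) auto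
  \<comment> \<open>The conjunct \<open>n \<in> ?A\<close> makes worlds of the same type have equal
    valuations, not merely valuations agreeing on \<open>?A\<close>.\<close>
  define w where "w \<gamma> n \<longleftrightarrow> n \<in> ?A \<and> sat (ext (V \<gamma>)) E (snd (\<sigma> n)) (fst (\<sigma> n))" for \<gamma> n
  define T where "T = {w \<beta> |\<beta>. Ord E \<beta> \<and> ord_le E \<delta> \<beta>}"
  have par: "E (snd (\<sigma> n) i) (V \<delta>)" if "n \<in> ?A" "i \<in> fv (fst (\<sigma> n))" for n i
    using \<sigma>[of n] that unfolding assertions_def by auto
  have "u \<in> T \<longleftrightarrow> (\<exists>\<beta>. Ord E \<beta> \<and> ord_le E \<gamma> \<beta> \<and> u = w \<beta>)" if \<gamma>: "Ord E \<gamma>" "ord_le E \<delta> \<gamma>" for \<gamma> u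
  proof
    assume "u \<in> T"
    then obtain \<beta> where \<beta>: "u = w \<beta>" "Ord E \<beta>" "ord_le E \<delta> \<beta>" unfolding T_def by blast
    obtain \<eta> where \<eta>: "Ord E \<eta>" "ord_le E \<gamma> \<eta>"
      "\<forall>n\<in>?A. sat (ext (V \<eta>)) E (snd (\<sigma> n)) (fst (\<sigma> n)) \<longleftrightarrow> sat (ext (V \<beta>)) E (snd (\<sigma> n)) (fst (\<sigma> n))"
      using correct_imp_type_recurs[where c = c and \<sigma> = \<sigma> and A = "set_mfm p", OF \<delta> corr fin _ c
          \<beta>(2,3) \<gamma>(1)] par
      by meson
    have "w \<eta> = w \<beta>" using \<eta>(3) by (auto simp: w_def fun_eq_iff)
    then show "\<exists>\<beta>. Ord E \<beta> \<and> ord_le E \<gamma> \<beta> \<and> u = w \<beta>" using \<eta>(1,2) \<beta>(1) by metis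
  next
    assume "\<exists>\<beta>. Ord E \<beta> \<and> ord_le E \<gamma> \<beta> \<and> u = w \<beta>"
    then show "u \<in> T" unfolding T_def using ord_le_trans[OF _ \<gamma>(2)] by blast
  qed
  note T = this
  have "holds_at E \<delta> (map_mfm \<sigma> p) \<longleftrightarrow> universal_eval T (w \<delta>) p"
  proof (rule holds_at_universal_eval[where A = "set_mfm p" and w = w and T = T])
    show "u \<in> T \<longleftrightarrow> (\<exists>\<beta>. Ord E \<beta> \<and> ord_le E \<gamma> \<beta> \<and> u = w \<beta>)" if "Ord E \<gamma>" "ord_le E \<delta> \<gamma>" for \<gamma> u
      by (rule T[OF that])
  qed (simp_all add: w_def \<delta> ord_le_refl)
  moreover have "w \<delta> \<in> T" unfolding T_def using \<delta> ord_le_refl by blast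
  ultimately show ?thesis using S5_sound[OF p] by blast
qed

end

section \<open>A dial\<close>

text \<open>In \<open>V \<gamma>\<close> the base case says that \<open>m\<close> contains all
  elements of elements, so \<open>m\<close> is the last level before the top; each further step
  descends to the last level before \<open>m'\<close>. Thus \<open>m\<close> is
  \<open>V \<alpha>\<close> where \<gamma> is \<alpha> plus \<open>k + 1\<close>. All quantifiers
  are bounded by \<open>D\<close>, which makes it an assertion.\<close>

primrec top_chain :: "('v \<Rightarrow> 'v \<Rightarrow> bool) \<Rightarrow> nat \<Rightarrow> 'v set \<Rightarrow> 'v \<Rightarrow> bool" where
  "top_chain E 0 D m \<longleftrightarrow> (\<forall>x\<in>D. \<forall>y\<in>D. E y x \<longrightarrow> E y m)"
| "top_chain E (Suc k) D m \<longleftrightarrow> (\<exists>m'\<in>D. top_chain E k D m' \<and> E m m' \<and> (\<forall>x\<in>D. E x m' \<longrightarrow> (\<forall>y\<in>D. E y x \<longrightarrow> E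
    y m)))"

lemma udef_top_chain: "udef E (\<lambda>D e. top_chain E k D (e i))"
proof (induction k arbitrary: i)
  case 0
  show ?case unfolding top_chain.simps by (intro udef_intros)
next
  case (Suc k)
  show ?case unfolding top_chain.simps by (intro udef_intros Suc.IH)
qed

context zfc_model begin

text \<open>If \<open>m\<close> is included in \<open>V \<alpha>\<close> with \<alpha> below
  \<gamma>, then every \<eta> below \<gamma> satisfies \<open>V \<eta>\<close> \<subseteq>
  \<open>m\<close> \<subseteq> \<open>V \<alpha>\<close>, because \<open>V \<eta>\<close> is an
  element of \<open>V \<gamma>\<close>. So \<alpha> is the largest ordinal below \<gamma>.\<close>

lemma top_iff:
  assumes \<gamma>: "Ord E \<gamma>"
  shows "E m (V \<gamma>) \<and> (\<forall>x y. E x (V \<gamma>) \<longrightarrow> E y x \<longrightarrow> E y m) \<longleftrightarrow> (\<exists>\<alpha>. Ord E \<alpha> \<and> \<gamma> = succ \<alpha> \<and> m = V \<alpha>)"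
proof
  assume m: "E m (V \<gamma>) \<and> (\<forall>x y. E x (V \<gamma>) \<longrightarrow> E y x \<longrightarrow> E y m)"
  then obtain \<alpha> where \<alpha>: "E \<alpha> \<gamma>" "\<forall>z. E z m \<longrightarrow> E z (V \<alpha>)" using E_V[OF \<gamma>] by blast
  have o: "Ord E \<alpha>" using Ord_elem[OF \<gamma> \<alpha>(1)] .
  have "E z m" if "E z (V \<alpha>)" for z using m V_mem[OF \<gamma> \<alpha>(1)] that by blast
  then have "m = V \<alpha>" using \<alpha>(2) by (intro extensionality) blast
  have "ord_le E \<eta> \<alpha>" if "E \<eta> \<gamma>" for \<eta>
    using m V_mem[OF \<gamma> that] V_subset_iff[OF Ord_elem[OF \<gamma> that] o] \<open>m = V \<alpha>\<close> by blast
  moreover have "E \<eta> \<gamma>" if "ord_le E \<eta> \<alpha>" for \<eta> using ord_le_less_trans[OF \<gamma> that \<alpha>(1)] .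
  ultimately have "\<gamma> = succ \<alpha>" by (intro extensionality) (auto simp: E_succ)
  then show "\<exists>\<alpha>. Ord E \<alpha> \<and> \<gamma> = succ \<alpha> \<and> m = V \<alpha>" using o \<open>m = V \<alpha>\<close> by blast
next
  assume "\<exists>\<alpha>. Ord E \<alpha> \<and> \<gamma> = succ \<alpha> \<and> m = V \<alpha>"
  then obtain \<alpha> where \<alpha>: "Ord E \<alpha>" "\<gamma> = succ \<alpha>" "m = V \<alpha>" by blast
  have "E y m" if x: "E x (V \<gamma>)" and "E y x" for x y
  proof -
    obtain \<xi> where \<xi>: "E \<xi> \<gamma>" "\<forall>z. E z x \<longrightarrow> E z (V \<xi>)" using x unfolding E_V[OF \<gamma>] by blast
    have "ord_le E \<xi> \<alpha>" using \<xi>(1) unfolding \<alpha>(2) E_succ .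
    then show ?thesis unfolding \<alpha>(3) using V_mono[OF \<alpha>(1)] \<xi>(2) \<open>E y x\<close> by blast
  qed
  moreover have "E m (V \<gamma>)" using V_mem[OF \<gamma>, of \<alpha>] less_succ \<alpha> by simp
  ultimately show "E m (V \<gamma>) \<and> (\<forall>x y. E x (V \<gamma>) \<longrightarrow> E y x \<longrightarrow> E y m)" by blast
qed

lemma top_chain_iff:
  assumes \<gamma>: "Ord E \<gamma>"
  shows "E m (V \<gamma>) \<and> top_chain E k (ext (V \<gamma>)) m \<longleftrightarrow> (\<exists>\<alpha>. Ord E \<alpha> \<and> \<gamma> = (succ ^^ Suc k) \<alpha> \<and> m = V \<alpha>)"
proof (induction k arbitrary: m)
  case 0
  have "top_chain E 0 (ext (V \<gamma>)) m \<longleftrightarrow> (\<forall>x y. E x (V \<gamma>) \<longrightarrow> E y x \<longrightarrow> E y m)"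
    using V_transitive[OF \<gamma>] by auto
  then show ?case using top_iff[OF \<gamma>, of m] by simp
next
  case (Suc k)
  have "E m (V \<gamma>) \<and> top_chain E (Suc k) (ext (V \<gamma>)) m \<longleftrightarrow>
    (\<exists>m'. (E m' (V \<gamma>) \<and> top_chain E k (ext (V \<gamma>)) m') \<and> E m m' \<and> (\<forall>x y. E x m' \<longrightarrow> E y x \<longrightarrow> E y m))"
  proof -
    have D: "y \<in> ext (V \<gamma>)" if "E y x" "x \<in> ext (V \<gamma>)" for x y using V_transitive[OF \<gamma>, of x y] that
        by simp
    have 1: "(\<forall>x\<in>ext (V \<gamma>). E x m' \<longrightarrow> (\<forall>y\<in>ext (V \<gamma>). E y x \<longrightarrow> E y m)) \<longleftrightarrow> (\<forall>x y. E x m' \<longrightarrow> E y x \<longrightarrow> E y m)"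
      if "m' \<in> ext (V \<gamma>)" for m'
      using D that by meson
    have "top_chain E (Suc k) (ext (V \<gamma>)) m \<longleftrightarrow>
      (\<exists>m'\<in>ext (V \<gamma>). top_chain E k (ext (V \<gamma>)) m' \<and> E m m' \<and> (\<forall>x y. E x m' \<longrightarrow> E y x \<longrightarrow> E y m))"
      unfolding top_chain.simps by (intro bex_cong refl) (simp only: 1)
    then show ?thesis using V_transitive[OF \<gamma>, of _ m] by auto
  qed
  also have "\<dots> \<longleftrightarrow> (\<exists>\<alpha>. Ord E \<alpha> \<and> \<gamma> = (succ ^^ Suc k) \<alpha> \<and> (E m (V \<alpha>) \<and> (\<forall>x y. E x (V \<alpha>) \<longrightarrow> E y x \<longrightarrow> E y
      m)))"
    unfolding Suc.IH by blast
  also have "\<dots> \<longleftrightarrow> (\<exists>\<alpha>. Ord E \<alpha> \<and> \<gamma> = (succ ^^ Suc k) \<alpha> \<and> (\<exists>\<beta>. Ord E \<beta> \<and> \<alpha> = succ \<beta> \<and> m = V \<beta>))"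
  proof (rule ex_cong1)
    fix \<alpha>
    show "(Ord E \<alpha> \<and> \<gamma> = (succ ^^ Suc k) \<alpha> \<and> (E m (V \<alpha>) \<and> (\<forall>x y. E x (V \<alpha>) \<longrightarrow> E y x \<longrightarrow> E y m))) \<longleftrightarrow>
      (Ord E \<alpha> \<and> \<gamma> = (succ ^^ Suc k) \<alpha> \<and> (\<exists>\<beta>. Ord E \<beta> \<and> \<alpha> = succ \<beta> \<and> m = V \<beta>))"
    proof (cases "Ord E \<alpha>")
      case True
      show ?thesis unfolding top_iff[OF True] ..
    qed simp
  qed
  also have "\<dots> \<longleftrightarrow> (\<exists>\<beta>. Ord E \<beta> \<and> \<gamma> = (succ ^^ Suc (Suc k)) \<beta> \<and> m = V \<beta>)"
    by (simp only: funpow_Suc_right[of "Suc k"] comp_def) (use Ord_succ in auto)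
  finally show ?case .
qed

text \<open>At a limit plus \<open>i\<close> exactly the dials \<open>k < i\<close> are on, so
  counting those below a bound \<open>N\<close> reads off \<open>i\<close> up to
  \<open>N\<close>.\<close>

definition dial :: "nat \<Rightarrow> 'v set \<Rightarrow> bool" where
  "dial k D \<longleftrightarrow> (\<exists>m\<in>D. top_chain E k D m)"

lemma udef_dial: "udef E (\<lambda>D e. dial k D)"
  unfolding dial_def by (intro udef_intros udef_top_chain)

lemma Ord_succ_pow: "Ord E \<alpha> \<Longrightarrow> Ord E ((succ ^^ n) \<alpha>)"
  by (induction n) (auto intro: Ord_succ)

lemma succ_pow_ge: "Ord E \<alpha> \<Longrightarrow> ord_le E \<alpha> ((succ ^^ n) \<alpha>)"
proof (induction n)
  case (Suc n)
  then have "E \<alpha> (succ ((succ ^^ n) \<alpha>))" unfolding E_succ by blast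
  then show ?case unfolding ord_le_def by simp
qed (simp add: ord_le_refl)

lemma limit_not_succ: "limit \<kappa> \<Longrightarrow> \<kappa> \<noteq> succ \<alpha>"
  using less_succ[of \<alpha>] E_irrefl unfolding limit_def by metis

lemma dial_limit:
  assumes \<kappa>: "limit \<kappa>" shows "dial k (ext (V ((succ ^^ i) \<kappa>))) \<longleftrightarrow> k < i"
proof -
  have o: "Ord E \<kappa>" using \<kappa> unfolding limit_def by blast
  have "dial k (ext (V ((succ ^^ i) \<kappa>))) \<longleftrightarrow> (\<exists>\<alpha>. Ord E \<alpha> \<and> (succ ^^ i) \<kappa> = (succ ^^ Suc k) \<alpha>)"
    unfolding dial_def using top_chain_iff[OF Ord_succ_pow[OF o], of _ i k] by blast
  also have "\<dots> \<longleftrightarrow> k < i"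
  proof (induction i arbitrary: k)
    case 0
    then show ?case using limit_not_succ[OF \<kappa>] by simp
  next
    case (Suc i)
    show ?case
    proof (cases k)
      case 0
      have "(succ ^^ Suc i) \<kappa> = (succ ^^ Suc 0) ((succ ^^ i) \<kappa>)" by simp
      then show ?thesis using 0 Ord_succ_pow[OF o] by blast
    next
      case (Suc j)
      have "(succ ^^ Suc i) \<kappa> = (succ ^^ Suc (Suc j)) \<alpha> \<longleftrightarrow> (succ ^^ i) \<kappa> = (succ ^^ Suc j) \<alpha>" for \<alpha>
        using succ_inject by auto
      then show ?thesis using Suc.IH[of j] Suc by simp
    qed
  qed
  finally show ?thesis .
qed

text \<open>A finite universal countermodel is simulated by assertions about the dial, each of whose
  positions recurs above every ordinal.\<close>

lemma Val_subset_S5: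
  fixes p :: "nat mfm"
  assumes \<delta>: "Ord E \<delta>" and c: "E c (V \<delta>)" and p: "p \<notin> S5"
  shows "\<exists>\<sigma>. (\<forall>n. \<sigma> n \<in> assertions (ext (V \<delta>))) \<and> \<not> holds_at E \<delta> (map_mfm \<sigma> p)"
proof -
  obtain T w0 where T: "w0 \<in> T" "\<not> universal_eval T w0 p" "finite T" by (rule S5_complete_finite[OF p])
  \<comment> \<open>The dial has the \<open>N + 1\<close> positions 0 to \<open>N\<close>, one more
    than there are valuations: the position that \<delta> happens to show is reserved for
    \<open>w0\<close>, and the others enumerate all of \<open>T\<close>.\<close>
  define N where "N = card T"
  define idx where "idx \<gamma> = card {k. k < N \<and> dial k (ext (V \<gamma>))}" for \<gamma>
  have idx_le: "idx \<gamma> \<le> N" for \<gamma>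
    unfolding idx_def using card_mono[of "{..<N}" "{k. k < N \<and> dial k (ext (V \<gamma>))}"] by auto
  have "card ({..N} - {idx \<delta>}) = card T" using idx_le[of \<delta>] by (simp add: N_def)
  then obtain h where h: "bij_betw h ({..N} - {idx \<delta>}) T"
    using finite_same_card_bij[of "{..N} - {idx \<delta>}" T] T(3) by auto
  define g where "g i = (if i = idx \<delta> then w0 else h i)" for i
  have g: "g i \<in> T" if "i \<le> N" for i
    using that T(1) h unfolding g_def bij_betw_def by auto
  have g_surj: "\<exists>i\<le>N. u = g i" if u: "u \<in> T" for u
  proof -
    have "u \<in> h ` ({..N} - {idx \<delta>})" using h u unfolding bij_betw_def by simp
    then obtain i where "u = h i" "i \<in> {..N} - {idx \<delta>}" by (rule imageE)
    then show ?thesis unfolding g_def by (intro exI[of _ i]) simp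
  qed
  \<comment> \<open>Assertion \<open>n\<close> says that the valuation at the current position makes
    \<open>n\<close> true; it is a truth function of the \<open>N\<close> dials.\<close>
  have "udef E (\<lambda>D e. (\<lambda>b. g (card {k. b k}) n) (\<lambda>k. k < N \<and> dial k D))" for n
    by (rule udef_boolean_combination) (rule udef_dial)
  then have "\<forall>n. \<exists>\<phi>. \<forall>D e. g (card {k. k < N \<and> dial k D}) n \<longleftrightarrow> sat D E e \<phi>"
    unfolding udef_def by simp
  then obtain \<phi> where \<phi>: "\<And>n D e. g (card {k. k < N \<and> dial k D}) n \<longleftrightarrow> sat D E e (\<phi> n)" by metis
  define \<sigma> where "\<sigma> n = (\<phi> n, \<lambda>_ :: nat. c)" for n :: nat
  have "holds_at E \<delta> (map_mfm \<sigma> p) \<longleftrightarrow> universal_eval T (g (idx \<delta>)) p"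
  proof (rule holds_at_universal_eval[of \<delta> UNIV \<sigma> "\<lambda>\<gamma>. g (idx \<gamma>)"])
    show "sat (ext (V \<gamma>)) E (snd (\<sigma> n)) (fst (\<sigma> n)) \<longleftrightarrow> g (idx \<gamma>) n" for \<gamma> n
      unfolding \<sigma>_def idx_def using \<phi> by simp
    show "u \<in> T \<longleftrightarrow> (\<exists>\<beta>. Ord E \<beta> \<and> ord_le E \<gamma> \<beta> \<and> u = g (idx \<beta>))" if "Ord E \<gamma>" for \<gamma> u
    proof
      assume "u \<in> T"
      then obtain i where i: "i \<le> N" "u = g i" using g_surj by blast
      obtain \<kappa> where \<kappa>: "limit \<kappa>" "E \<gamma> \<kappa>" using limit_above[OF \<open>Ord E \<gamma>\<close>] by blast
      have o: "Ord E \<kappa>" using \<kappa> unfolding limit_def by blast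
      have "{k. k < N \<and> dial k (ext (V ((succ ^^ i) \<kappa>)))} = {..<i}" unfolding dial_limit[OF \<kappa>(1)]
          using i(1) by auto
      then have "idx ((succ ^^ i) \<kappa>) = i" unfolding idx_def by simp
      moreover have "ord_le E \<gamma> ((succ ^^ i) \<kappa>)"
        using less_ord_le_trans[OF Ord_succ_pow[OF o] \<kappa>(2) succ_pow_ge[OF o]] unfolding ord_le_def
            by blast
      ultimately show "\<exists>\<beta>. Ord E \<beta> \<and> ord_le E \<gamma> \<beta> \<and> u = g (idx \<beta>)" using Ord_succ_pow[OF o] i(2) by
          metis
    next
      assume "\<exists>\<beta>. Ord E \<beta> \<and> ord_le E \<gamma> \<beta> \<and> u = g (idx \<beta>)"
      then show "u \<in> T" using g idx_le by blast
    qed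
  qed (simp_all add: \<delta> ord_le_refl)
  moreover have "g (idx \<delta>) = w0" unfolding g_def by simp
  ultimately have "\<not> holds_at E \<delta> (map_mfm \<sigma> p)" using T(2) by simp
  moreover have "\<sigma> n \<in> assertions (ext (V \<delta>))" for n unfolding assertions_def \<sigma>_def using c by simp
  ultimately show ?thesis by blast
qed

theorem Val_eq_S5_iff_correct:
  assumes \<delta>: "Ord E \<delta>"
  shows "Val E \<delta> (assertions (ext (V \<delta>))) = S5 \<longleftrightarrow> correct 3 E (ext (V \<delta>))"
proof
  assume S5: "Val E \<delta> (assertions (ext (V \<delta>))) = S5"
  show "correct 3 E (ext (V \<delta>))"
  proof (rule maximality_imp_correct[OF \<delta>])
    fix \<phi> e \<alpha> assume e: "\<forall>i\<in>fv \<phi>. E (e i) (V \<delta>)" and \<alpha>: "Ord E \<alpha>"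
      and sat: "\<And>\<gamma>. Ord E \<gamma> \<Longrightarrow> ord_le E \<alpha> \<gamma> \<Longrightarrow> sat (ext (V \<gamma>)) E e \<phi>"
    have "(\<phi>, e) \<in> assertions (ext (V \<delta>))" unfolding assertions_def using e by simp
    \<comment> \<open>The instance of \<open>five\<close> with an atom says that an assertion that
      is eventually true is true now, which is the hypothesis of
      \<open>maximality_imp_correct\<close>.\<close>
    moreover have five: "Imp (Dia (Box (Atom 0))) (Atom 0) \<in> Val E \<delta> (assertions (ext (V \<delta>)))"
      unfolding S5 by (rule S5.five)
    ultimately have "holds_at E \<delta> (map_mfm (\<lambda>_. (\<phi>, e)) (Imp (Dia (Box (Atom (0::nat)))) (Atom 0)))"
      using five[unfolded Val_def, THEN CollectD, THEN spec, of "\<lambda>_. (\<phi>, e)", THEN mp] by blast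
    then have *: "sat (Vlevel E \<delta>) E e \<phi>"
      if "\<exists>\<beta>. (Ord E \<beta> \<and> ord_le E \<delta> \<beta>) \<and> (\<forall>\<gamma>. Ord E \<gamma> \<and> ord_le E \<beta> \<gamma> \<longrightarrow> sat (Vlevel E \<gamma>) E e \<phi>)"
      using that by auto
    obtain \<beta> where \<beta>: "Ord E \<beta>" "ord_le E \<alpha> \<beta>" "ord_le E \<delta> \<beta>" using Ord_max[OF \<alpha> \<delta>] .
    have "sat (Vlevel E \<gamma>) E e \<phi>" if "Ord E \<gamma>" "ord_le E \<beta> \<gamma>" for \<gamma>
      using sat[OF that(1) ord_le_trans[OF that(1) \<beta>(2) that(2)]] Vlevel_eq[OF that(1)] by simp
    then show "sat (ext (V \<delta>)) E e \<phi>" using * \<beta> Vlevel_eq[OF \<delta>] by auto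
  qed
next
  assume corr: "correct 3 E (ext (V \<delta>))"
  \<comment> \<open>Correctness for the existence of a set rules out the empty world, where no
    default parameter would exist.\<close>
  have "Delta0 (Eq 0 0)" by (rule Delta0.intros)
  then have "Sigma_fm 3 (Exists 0 (Eq 0 0))"
    by (simp add: eval_nat_numeral Sigma_fm_Pi_fm.intros)
  then have "sat (ext (V \<delta>)) E e (Exists 0 (Eq 0 0)) \<longleftrightarrow> sat UNIV E e (Exists 0 (Eq 0 0))" for e
    by (intro corr[unfolded correct_def, rule_format]) simp
  then obtain c where c: "E c (V \<delta>)" by auto
  show "Val E \<delta> (assertions (ext (V \<delta>))) = S5"
  proof (intro equalityI subsetI)
    fix p :: "nat mfm" assume "p \<in> Val E \<delta> (assertions (ext (V \<delta>)))"
    then show "p \<in> S5" using Val_subset_S5[OF \<delta> c] unfolding Val_def by blast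
  next
    fix p :: "nat mfm" assume "p \<in> S5"
    then show "p \<in> Val E \<delta> (assertions (ext (V \<delta>)))"
      using correct_imp_S5_valid[OF \<delta> corr c] unfolding Val_def by blast
  qed
qed

end

theorem theorem12:
  fixes E :: "'v \<Rightarrow> 'v \<Rightarrow> bool" and \<delta> :: 'v
  assumes "zfc_model E" and "Ord E \<delta>"
  shows "Val E \<delta> (assertions (Vlevel E \<delta>)) = S5 \<longleftrightarrow> Sigma_correct 3 E \<delta>"
proof -
  interpret zfc_model E by (rule assms(1))
  have "Sigma_correct 3 E \<delta> \<longleftrightarrow> correct 3 E (Vlevel E \<delta>)" unfolding Sigma_correct_def correct_def ..
  then show ?thesis using Val_eq_S5_iff_correct[OF assms(2)] Vlevel_eq[OF assms(2)] by simp
qed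

end
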